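(* Let $s\in\mathbb{N}\setminus\{1\}$. Suppose $E$ is a uniformly complete vector lattice, $Y$ is a convex bornological space, and $P\colon E\to Y$ is a bounded $s$-homogeneous polynomial with associated symmetric $s$-linear map $\check{P}\colon E^s\to Y$. Then $P$ is orthogonally additive if and only if for every $f_1,\dots,f_s\in E_+$, writing $h:=\eta_s(f_1,\dots,f_s)\in E$ for the $s$th harmonic mean of $f_1,\dots,f_s$, \[ \check{P}(f_1,\dots,f_s)=\frac{1}{s}\Bigl(\check{P}(h,f_2,\dots,f_s)+\check{P}(f_1,h,f_3,\dots,f_s)+\cdots+\check{P}(f_1,\dots,f_{s-1},h)\Bigr), \] where in the $j$th summand ($j=1,\dots,s$) the $j$th argument $f_j$ is replaced by $h$.
   Context: All vector spaces are real and all vector lattices are Archimedean; $\mathbb{N}=\{1,2,\dots\}$; $E_+$ is the positive cone of $E$. Uniformly complete means relatively uniformly complete (every relatively uniformly Cauchy sequence converges relatively uniformly). The terms "convex bornological space" and "bounded" are used in their usual sense. A convex bornological space is a vector space $Y$ with a collection of subsets (the bounded sets) that covers $Y$ and is closed under taking subsets, finite unions, sums, scalar multiples, balanced hulls and convex hulls. A map $P\colon E\to Y$ is bounded if it maps order bounded subsets of $E$ to bounded subsets of $Y$. A map $P\colon E\to V$ into a vector space $V$ is an $s$-homogeneous polynomial if there is a (unique) symmetric $s$-linear map $\check{P}\colon E^s\to V$ with $P(f)=\check{P}(f,\dots,f)$ for all $f\in E$. It is orthogonally additive if $P(f+g)=P(f)+P(g)$ whenever $f,g\in E$ are disjoint (i.e.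 $|f|\wedge|g|=0$). Harmonic mean: for $x_1,\dots,x_s\in\mathbb{R}$, \[ \eta_s(x_1,\dots,x_s)=\begin{cases}\dfrac{s\prod_{i=1}^{s}|x_i|}{\sum_{j=1}^{s}\left(\frac{1}{|x_j|}\prod_{i=1}^{s}|x_i|\right)} & \text{if } x_1,\dots,x_s\neq 0,\\ 0 & \text{otherwise.}\end{cases} \] This function is continuous and positively homogeneous, so $\eta_s(f_1,\dots,f_s)\in E$ is defined for $f_1,\dots,f_s\in E$ by the Archimedean vector lattice functional calculus. For $f_1,\dots,f_s\in E_+$ it is given explicitly by \[ \eta_s(f_1,\dots,f_s)=s\inf\Bigl\{\sum_{k=1}^s a_kf_k : 0\le a_1,\dots,a_s\le 1,\ \sum_{k=1}^s\sqrt{a_k}=1\Bigr\}. \]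
   Formalization: The convex bornological space Y is additionally assumed separated (its only bounded linear subspace is {0}); without this the equivalence fails, e.g. for Y = ℝ with all subsets bounded and a suitable P = φ² on C[0,1]. *)

theory Defs
  imports "HOL-Analysis.Analysis" "HOL-Library.Lattice_Algebras"
begin

class archimedean_vector_lattice = ordered_real_vector + lattice_ab_group_add_abs +
  assumes archimedean:
    "0 \<le> x \<Longrightarrow> 0 \<le> y \<Longrightarrow> (\<And>n::nat. of_nat n *\<^sub>R x \<le> y) \<Longrightarrow> x = 0"

definition ru_Cauchy :: "(nat \<Rightarrow> 'a::archimedean_vector_lattice) \<Rightarrow> bool" where
  "ru_Cauchy f \<longleftrightarrow>
     (\<exists>u\<ge>0. \<forall>e>0. \<exists>N. \<forall>m\<ge>N. \<forall>n\<ge>N. \<bar>f m - f n\<bar> \<le> e *\<^sub>R u)"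

definition ru_convergent :: "(nat \<Rightarrow> 'a::archimedean_vector_lattice) \<Rightarrow> bool" where
  "ru_convergent f \<longleftrightarrow>
     (\<exists>l. \<exists>u\<ge>0. \<forall>e>0. \<exists>N. \<forall>n\<ge>N. \<bar>f n - l\<bar> \<le> e *\<^sub>R u)"

definition uniformly_complete :: "'a::archimedean_vector_lattice itself \<Rightarrow> bool" where
  "uniformly_complete _ \<longleftrightarrow> (\<forall>f :: nat \<Rightarrow> 'a. ru_Cauchy f \<longrightarrow> ru_convergent f)"

text \<open>
  Functional calculus on Archimedean vector lattices, in the sense of Buskes, de Pagter and
  van Rooij: \<open>\<phi>(f\<^sub>1, \<dots>, f\<^sub>s) = g\<close> means \<open>\<omega>(g) = \<phi>(\<omega>(f\<^sub>1), \<dots>, \<omega>(f\<^sub>s))\<close> for every real-valued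
  lattice homomorphism \<open>\<omega>\<close> on the vector sublattice generated by \<open>f\<^sub>1, \<dots>, f\<^sub>s, g\<close>.
  Here and below an \<open>s\<close>-tuple is a function on \<open>nat\<close> of which only the values on \<open>{1..s}\<close> matter.
\<close>

definition vector_sublattice :: "'a::archimedean_vector_lattice set \<Rightarrow> bool" where
  "vector_sublattice C \<longleftrightarrow>
     subspace C \<and> (\<forall>x\<in>C. \<forall>y\<in>C. sup x y \<in> C \<and> inf x y \<in> C)"

definition real_lattice_hom_on ::
    "'a::archimedean_vector_lattice set \<Rightarrow> ('a \<Rightarrow> real) \<Rightarrow> bool" where
  "real_lattice_hom_on C \<omega> \<longleftrightarrow>
     (\<forall>x\<in>C. \<forall>y\<in>C. \<omega> (x + y) = \<omega> x + \<omega> y) \<and>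
     (\<forall>c. \<forall>x\<in>C. \<omega> (c *\<^sub>R x) = c * \<omega> x) \<and>
     (\<forall>x\<in>C. \<forall>y\<in>C. \<omega> (sup x y) = sup (\<omega> x) (\<omega> y) \<and> \<omega> (inf x y) = inf (\<omega> x) (\<omega> y))"

definition is_functional_calculus_value ::
    "nat \<Rightarrow> ((nat \<Rightarrow> real) \<Rightarrow> real) \<Rightarrow> (nat \<Rightarrow> 'a::archimedean_vector_lattice) \<Rightarrow> 'a \<Rightarrow> bool" where
  "is_functional_calculus_value s \<phi> f g \<longleftrightarrow>
     (\<forall>\<omega>. real_lattice_hom_on (vector_sublattice hull (insert g (f ` {1..s}))) \<omega> \<longrightarrow>
        \<omega> g = \<phi> (\<lambda>i. \<omega> (f i)))"

definition functional_calculus ::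
    "nat \<Rightarrow> ((nat \<Rightarrow> real) \<Rightarrow> real) \<Rightarrow> (nat \<Rightarrow> 'a::archimedean_vector_lattice) \<Rightarrow> 'a" where
  "functional_calculus s \<phi> f = (THE g. is_functional_calculus_value s \<phi> f g)"

definition real_harmonic_mean :: "nat \<Rightarrow> (nat \<Rightarrow> real) \<Rightarrow> real" where
  "real_harmonic_mean s x =
     (if \<forall>i\<in>{1..s}. x i \<noteq> 0
      then real s * (\<Prod>i=1..s. \<bar>x i\<bar>) / (\<Sum>j=1..s. 1 / \<bar>x j\<bar> * (\<Prod>i=1..s. \<bar>x i\<bar>))
      else 0)"

definition harmonic_mean :: "nat \<Rightarrow> (nat \<Rightarrow> 'a::archimedean_vector_lattice) \<Rightarrow> 'a" where
  "harmonic_mean s f = functional_calculus s (real_harmonic_mean s) f"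

text \<open>The first conjunct says that \<open>T\<close> is a map on \<open>s\<close>-tuples, indexed by \<open>{1..s}\<close>.\<close>

definition symmetric_multilinear ::
    "nat \<Rightarrow> ((nat \<Rightarrow> 'a::real_vector) \<Rightarrow> 'b::real_vector) \<Rightarrow> bool" where
  "symmetric_multilinear s T \<longleftrightarrow>
     (\<forall>f g. (\<forall>i\<in>{1..s}. f i = g i) \<longrightarrow> T f = T g) \<and>
     (\<forall>f. \<forall>i\<in>{1..s}. linear (\<lambda>x. T (f(i := x)))) \<and>
     (\<forall>f \<pi>. \<pi> permutes {1..s} \<longrightarrow> T (f \<circ> \<pi>) = T f)"

definition homogeneous_polynomial_with ::
    "nat \<Rightarrow> ('a::real_vector \<Rightarrow> 'b::real_vector) \<Rightarrow> ((nat \<Rightarrow> 'a) \<Rightarrow> 'b) \<Rightarrow> bool" where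
  "homogeneous_polynomial_with s P T \<longleftrightarrow>
     symmetric_multilinear s T \<and> (\<forall>f. P f = T (\<lambda>_. f))"

definition orthogonally_additive ::
    "('a::archimedean_vector_lattice \<Rightarrow> 'b::real_vector) \<Rightarrow> bool" where
  "orthogonally_additive P \<longleftrightarrow> (\<forall>f g. inf \<bar>f\<bar> \<bar>g\<bar> = 0 \<longrightarrow> P (f + g) = P f + P g)"

definition convex_bornology :: "'b::real_vector set set \<Rightarrow> bool" where
  "convex_bornology \<B> \<longleftrightarrow>
     \<Union>\<B> = UNIV \<and>
     (\<forall>A\<in>\<B>. \<forall>A'. A' \<subseteq> A \<longrightarrow> A' \<in> \<B>) \<and>
     (\<forall>A\<in>\<B>. \<forall>A'\<in>\<B>. A \<union> A' \<in> \<B>) \<and>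
     (\<forall>A\<in>\<B>. \<forall>A'\<in>\<B>. {x + y |x y. x \<in> A \<and> y \<in> A'} \<in> \<B>) \<and>
     (\<forall>A\<in>\<B>. \<forall>c::real. (\<lambda>x. c *\<^sub>R x) ` A \<in> \<B>) \<and>
     (\<forall>A\<in>\<B>. {c *\<^sub>R x |c x. \<bar>c\<bar> \<le> 1 \<and> x \<in> A} \<in> \<B>) \<and>
     (\<forall>A\<in>\<B>. convex hull A \<in> \<B>)"

text \<open>
  Convex bornological spaces are understood to be separated (no bounded subspace other than
  \<open>{0}\<close>). Without this every map into a space all of whose subsets are bounded would be bounded,
  and for such maps orthogonal additivity does not force the harmonic mean identity.
\<close>

definition separated_bornology :: "'b::real_vector set set \<Rightarrow> bool" where
  "separated_bornology \<B> \<longleftrightarrow> (\<forall>V\<in>\<B>. subspace V \<longrightarrow> V = {0})"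

definition bounded_map ::
    "'b::real_vector set set \<Rightarrow> ('a::archimedean_vector_lattice \<Rightarrow> 'b) \<Rightarrow> bool" where
  "bounded_map \<B> P \<longleftrightarrow> (\<forall>A. (\<exists>a b. A \<subseteq> {a..b}) \<longrightarrow> P ` A \<in> \<B>)"

end

theory Submission
  imports Defs
begin

text \<open>
  Let \<open>u = f\<^sub>1 + \<dots> + f\<^sub>s\<close>. The real-valued lattice homomorphisms \<open>\<omega>\<close> with \<open>\<omega> u = 1\<close> separate the
  points of the ideal generated by \<open>u\<close>, and uniform completeness makes this ideal closed under
  the pointwise product with unit \<open>u\<close> and, by the Stone--Weierstrass theorem, under harmonic means.
  If \<open>P\<close> is orthogonally additive, polarization shows that its multilinear form \<open>T\<close> vanishes as soon
  as two of its arguments are disjoint; cutting an argument into thin layers then gives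
  \<open>T (a, b, \<dots>) = T (ab, u, \<dots>)\<close>. Hence \<open>T f = T (f\<^sub>1 \<cdots> f\<^sub>s, u, \<dots>, u)\<close>, and the harmonic mean
  identity reduces to the identity \<open>\<Sum>\<^sub>j h \<Prod>\<^bsub>i \<noteq> j\<^esub> f\<^sub>i = s \<Prod>\<^sub>i f\<^sub>i\<close> between real numbers.
  Conversely, the harmonic mean vanishes when two of the arguments are disjoint, so the identity makes
  \<open>T\<close> vanish there, and \<open>P (f + g)\<close> loses its mixed terms.
\<close>

section \<open>Principal ideals and real-valued homomorphisms\<close>

text \<open>The target space carries no topology, so there is no limit to take on the side of the
  values. An approximation is instead turned into an algebraic statement: the defect
  \<open>w\<close> of a desired identity satisfies \<open>real n *\<^sub>R w \<in> A\<close> for one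
  bounded set \<open>A\<close> and all positive \<open>n\<close>, and separation forces
  \<open>w = 0\<close>. A second obstacle is that orthogonal additivity speaks about two disjoint
  vectors, so polarization directly handles the case where all \<open>s\<close> slots fall into two
  mutually disjoint groups. A slot overlapping both groups is cut into two pieces, each of which
  joins one group after small truncations; boundedness removes the truncations again. Finally, the
  functional calculus is tested on homomorphisms of a small generated sublattice, while completeness
  is exploited in a principal ideal. Prime ideals bridge the two: they extend homomorphisms from the
  sublattice to the ideal, and they also supply the homomorphisms that separate points.\<close>

lemma scaleR_sup:
  fixes x y :: "'a::archimedean_vector_lattice"
  assumes "0 \<le> c"
  shows "c *\<^sub>R sup x y = sup (c *\<^sub>R x) (c *\<^sub>R y)"
proof (cases "c = 0")
  case False
  with assms have c: "0 < c" by simp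
  show ?thesis
  proof (rule antisym)
    have "x \<le> inverse c *\<^sub>R sup (c *\<^sub>R x) (c *\<^sub>R y)" "y \<le> inverse c *\<^sub>R sup (c *\<^sub>R x) (c *\<^sub>R y)"
      using c by (simp_all add: pos_le_divideR_eq)
    then have "sup x y \<le> inverse c *\<^sub>R sup (c *\<^sub>R x) (c *\<^sub>R y)" by simp
    from scaleR_left_mono[OF this, of c]
    show "c *\<^sub>R sup x y \<le> sup (c *\<^sub>R x) (c *\<^sub>R y)"
      using c by simp
    show "sup (c *\<^sub>R x) (c *\<^sub>R y) \<le> c *\<^sub>R sup x y"
      using c by (simp add: scaleR_left_mono)
  qed
qed simp

lemma scaleR_inf:
  fixes x y :: "'a::archimedean_vector_lattice"
  assumes "0 \<le> c"
  shows "c *\<^sub>R inf x y = inf (c *\<^sub>R x) (c *\<^sub>R y)"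
  by (simp only: inf_eq_neg_sup[of x y] inf_eq_neg_sup[of "c *\<^sub>R x" "c *\<^sub>R y"]
      scaleR_minus_right scaleR_sup[OF assms])

lemma pprt_scaleR:
  fixes x :: "'a::archimedean_vector_lattice"
  assumes "0 \<le> c"
  shows "pprt (c *\<^sub>R x) = c *\<^sub>R pprt x"
  using scaleR_sup[OF assms, of x 0] by (simp add: pprt_def)

lemma pprt_add_le:
  fixes x y :: "'a::archimedean_vector_lattice"
  shows "pprt (x + y) \<le> pprt x + pprt y"
  by (simp add: pprt_def add_mono add_nonneg_nonneg)

lemma inf_pprt_pprt_minus:
  fixes x :: "'a::archimedean_vector_lattice"
  shows "inf (pprt x) (pprt (- x)) = 0"
proof -
  have "inf (pprt x) (pprt (- x)) = inf (x + pprt (- x)) (pprt (- x))"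
    using arg_cong[OF prts[of x], of "\<lambda>y. y - nprt x"] by (simp add: pprt_neg)
  also have "\<dots> = inf x 0 + pprt (- x)"
    by (simp add: add_inf_distrib_right)
  also have "\<dots> = 0" by (metis add.commute neg_eq_iff_add_eq_0 nprt_def pprt_neg)
  finally show ?thesis .
qed

lemma abs_scaleR_lattice:
  fixes x :: "'a::archimedean_vector_lattice"
  shows "\<bar>c *\<^sub>R x\<bar> = \<bar>c\<bar> *\<^sub>R \<bar>x\<bar>"
proof (cases "0 \<le> c")
  case True
  then show ?thesis using scaleR_sup[OF True, of x "- x"]
    by (simp add: abs_lattice[where 'a='a])
next
  case False
  then have "0 \<le> - c" by simp
  from scaleR_sup[OF this, of x "- x"] False show ?thesis
    by (simp add: abs_lattice[where 'a='a] sup_commute)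
qed

text \<open>The Archimedean axiom speaks of nonnegative elements, so it is applied to
  \<open>pprt x\<close>, which inherits the bounds \<open>e *\<^sub>R v\<close> because these are
  nonnegative.\<close>

lemma le_zero_if_le_scaleR:
  fixes x v :: "'a::archimedean_vector_lattice"
  assumes v: "0 \<le> v" and le: "\<And>e. 0 < e \<Longrightarrow> x \<le> e *\<^sub>R v"
  shows "x \<le> 0"
proof -
  have "of_nat n *\<^sub>R pprt x \<le> v" for n
  proof (cases "n = 0")
    case False
    have "pprt x \<le> (1 / real n) *\<^sub>R v"
      using le[of "1 / real n"] False v by (simp add: pprt_def scaleR_nonneg_nonneg)
    from scaleR_left_mono[OF this, of "real n"] False show ?thesis by simp
  qed (simp add: v)
  then have "pprt x = 0" using archimedean[of "pprt x" v] v by simp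
  then show ?thesis by (simp add: le_zero_iff_zero_pprt)
qed

section \<open>Principal ideals and rules for homomorphisms on sublattices\<close>

definition principal_ideal :: "'a::archimedean_vector_lattice \<Rightarrow> 'a set" where
  "principal_ideal u = {x. \<exists>c. \<bar>x\<bar> \<le> c *\<^sub>R u}"

lemma principal_idealI: "\<bar>x\<bar> \<le> c *\<^sub>R u \<Longrightarrow> x \<in> principal_ideal u"
  by (auto simp: principal_ideal_def)

lemma principal_idealE:
  assumes "x \<in> principal_ideal u" "0 \<le> u"
  obtains c where "0 < c" "\<bar>x\<bar> \<le> c *\<^sub>R u"
proof -
  obtain c where c: "\<bar>x\<bar> \<le> c *\<^sub>R u" using assms by (auto simp: principal_ideal_def)
  have "c *\<^sub>R u \<le> (max c 1) *\<^sub>R u" using assms(2) by (intro scaleR_right_mono) auto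
  with c have "\<bar>x\<bar> \<le> (max c 1) *\<^sub>R u" by (rule order_trans)
  then show ?thesis by (intro that[of "max c 1"]) auto
qed

lemma principal_ideal_unit: "0 \<le> u \<Longrightarrow> u \<in> principal_ideal u"
  by (rule principal_idealI[of _ 1]) simp

lemma principal_ideal_abs_mono:
  "y \<in> principal_ideal u \<Longrightarrow> \<bar>x\<bar> \<le> \<bar>y\<bar> \<Longrightarrow> x \<in> principal_ideal u"
  by (auto simp: principal_ideal_def intro: order_trans)

lemma principal_ideal_interval: "0 \<le> x \<Longrightarrow> x \<le> u \<Longrightarrow> x \<in> principal_ideal u"
  by (rule principal_idealI[of _ 1]) simp

lemma vector_sublattice_principal_ideal:
  assumes u: "0 \<le> u"
  shows "vector_sublattice (principal_ideal u)"
proof -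
  have add: "x + y \<in> principal_ideal u"
    if x: "x \<in> principal_ideal u" and y: "y \<in> principal_ideal u" for x y
  proof -
    obtain c d where "\<bar>x\<bar> \<le> c *\<^sub>R u" "\<bar>y\<bar> \<le> d *\<^sub>R u"
      using x y by (auto simp: principal_ideal_def)
    then have "\<bar>x + y\<bar> \<le> (c + d) *\<^sub>R u"
      using abs_triangle_ineq[of x y] add_mono[of "\<bar>x\<bar>" "c *\<^sub>R u" "\<bar>y\<bar>" "d *\<^sub>R u"]
      by (auto simp: scaleR_add_left intro: order_trans)
    then show ?thesis by (rule principal_idealI)
  qed
  have scale: "c *\<^sub>R x \<in> principal_ideal u" if x: "x \<in> principal_ideal u" for c x
  proof -
    obtain d where "\<bar>x\<bar> \<le> d *\<^sub>R u"
      using x by (auto simp: principal_ideal_def)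
    then have "\<bar>c *\<^sub>R x\<bar> \<le> (\<bar>c\<bar> * d) *\<^sub>R u"
      using scaleR_left_mono[of "\<bar>x\<bar>" "d *\<^sub>R u" "\<bar>c\<bar>"] by (simp add: abs_scaleR_lattice)
    then show ?thesis by (rule principal_idealI)
  qed
  have pos: "pprt x \<in> principal_ideal u" if x: "x \<in> principal_ideal u" for x
    by (rule principal_ideal_abs_mono[OF x]) (simp add: pprt_def abs_ge_self)
  have sup: "sup x y \<in> principal_ideal u"
    if x: "x \<in> principal_ideal u" and y: "y \<in> principal_ideal u" for x y
  proof -
    have "sup x y = y + pprt (x + (-1) *\<^sub>R y)" by (simp add: pprt_def add_sup_distrib_left)
    then show ?thesis by (simp only: add pos scale x y)
  qed
  have inf: "inf x y \<in> principal_ideal u"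
    if x: "x \<in> principal_ideal u" and y: "y \<in> principal_ideal u" for x y
  proof -
    have "inf x y = (-1) *\<^sub>R sup ((-1) *\<^sub>R x) ((-1) *\<^sub>R y)" by (simp only: scaleR_minus1_left inf_eq_neg_sup[of x y])
    then show ?thesis by (simp only: sup scale x y)
  qed
  have "0 \<in> principal_ideal u" by (rule principal_idealI[of _ 0]) simp
  then show ?thesis
    unfolding vector_sublattice_def subspace_def
    by (intro conjI ballI allI impI add scale sup inf)
qed

lemma vector_sublatticeD:
  assumes "vector_sublattice C"
  shows "0 \<in> C"
    and "x \<in> C \<Longrightarrow> y \<in> C \<Longrightarrow> x + y \<in> C"
    and "x \<in> C \<Longrightarrow> y \<in> C \<Longrightarrow> x - y \<in> C"
    and "x \<in> C \<Longrightarrow> c *\<^sub>R x \<in> C"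
    and "x \<in> C \<Longrightarrow> - x \<in> C"
    and "x \<in> C \<Longrightarrow> y \<in> C \<Longrightarrow> sup x y \<in> C"
    and "x \<in> C \<Longrightarrow> y \<in> C \<Longrightarrow> inf x y \<in> C"
    and "x \<in> C \<Longrightarrow> \<bar>x\<bar> \<in> C"
    and "x \<in> C \<Longrightarrow> pprt x \<in> C"
    and "(\<And>i. i \<in> I \<Longrightarrow> h i \<in> C) \<Longrightarrow> sum h I \<in> C"
proof -
  have C: "subspace C" and L: "\<And>x y. x \<in> C \<Longrightarrow> y \<in> C \<Longrightarrow> sup x y \<in> C \<and> inf x y \<in> C"
    using assms unfolding vector_sublattice_def by blast+
  show "0 \<in> C" using subspace_0[OF C] .
  show "x \<in> C \<Longrightarrow> y \<in> C \<Longrightarrow> x + y \<in> C" by (rule subspace_add[OF C])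
  show "x \<in> C \<Longrightarrow> y \<in> C \<Longrightarrow> x - y \<in> C" by (rule subspace_diff[OF C])
  show "x \<in> C \<Longrightarrow> c *\<^sub>R x \<in> C" by (rule subspace_scale[OF C])
  show "x \<in> C \<Longrightarrow> - x \<in> C" by (rule subspace_neg[OF C])
  show "x \<in> C \<Longrightarrow> y \<in> C \<Longrightarrow> sup x y \<in> C" using L by blast
  show "x \<in> C \<Longrightarrow> y \<in> C \<Longrightarrow> inf x y \<in> C" using L by blast
  show "x \<in> C \<Longrightarrow> \<bar>x\<bar> \<in> C" using L subspace_neg[OF C] unfolding abs_lattice by blast
  show "x \<in> C \<Longrightarrow> pprt x \<in> C" using L subspace_0[OF C] unfolding pprt_def by blast
  show "(\<And>i. i \<in> I \<Longrightarrow> h i \<in> C) \<Longrightarrow> sum h I \<in> C" by (rule subspace_sum[OF C])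
qed

lemma real_lattice_homD:
  assumes C: "vector_sublattice C" and w: "real_lattice_hom_on C \<omega>"
  shows "\<omega> 0 = 0"
    and "x \<in> C \<Longrightarrow> y \<in> C \<Longrightarrow> \<omega> (x + y) = \<omega> x + \<omega> y"
    and "x \<in> C \<Longrightarrow> y \<in> C \<Longrightarrow> \<omega> (x - y) = \<omega> x - \<omega> y"
    and "x \<in> C \<Longrightarrow> \<omega> (c *\<^sub>R x) = c * \<omega> x"
    and "x \<in> C \<Longrightarrow> \<omega> (- x) = - \<omega> x"
    and "x \<in> C \<Longrightarrow> y \<in> C \<Longrightarrow> \<omega> (sup x y) = max (\<omega> x) (\<omega> y)"
    and "x \<in> C \<Longrightarrow> y \<in> C \<Longrightarrow> \<omega> (inf x y) = min (\<omega> x) (\<omega> y)"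
    and "x \<in> C \<Longrightarrow> \<omega> \<bar>x\<bar> = \<bar>\<omega> x\<bar>"
    and "x \<in> C \<Longrightarrow> \<omega> (pprt x) = max (\<omega> x) 0"
    and "x \<in> C \<Longrightarrow> y \<in> C \<Longrightarrow> x \<le> y \<Longrightarrow> \<omega> x \<le> \<omega> y"
proof -
  note Cs = vector_sublatticeD[OF C]
  have add: "\<omega> (x + y) = \<omega> x + \<omega> y" if "x \<in> C" "y \<in> C" for x y
    using w that by (auto simp: real_lattice_hom_on_def)
  have scale: "\<omega> (c *\<^sub>R x) = c * \<omega> x" if "x \<in> C" for x c
    using w that by (auto simp: real_lattice_hom_on_def)
  have sup: "\<omega> (sup x y) = max (\<omega> x) (\<omega> y)" if "x \<in> C" "y \<in> C" for x y
    using w that by (auto simp: real_lattice_hom_on_def sup_max)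
  have inf: "\<omega> (inf x y) = min (\<omega> x) (\<omega> y)" if "x \<in> C" "y \<in> C" for x y
    using w that by (auto simp: real_lattice_hom_on_def inf_min)
  have zero: "\<omega> 0 = 0" using scale[OF Cs(1), of 0] by simp
  have neg: "\<omega> (- x) = - \<omega> x" if "x \<in> C" for x
    using scale[OF that, of "-1"] by simp
  show "\<omega> 0 = 0" by fact
  show "x \<in> C \<Longrightarrow> y \<in> C \<Longrightarrow> \<omega> (x + y) = \<omega> x + \<omega> y" by (rule add)
  show "\<omega> (x - y) = \<omega> x - \<omega> y" if "x \<in> C" "y \<in> C"
    using add[of x "- y"] neg[of y] that Cs(5) by simp
  show "x \<in> C \<Longrightarrow> \<omega> (c *\<^sub>R x) = c * \<omega> x" by (rule scale)
  show "x \<in> C \<Longrightarrow> \<omega> (- x) = - \<omega> x" by (rule neg)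
  show "x \<in> C \<Longrightarrow> y \<in> C \<Longrightarrow> \<omega> (sup x y) = max (\<omega> x) (\<omega> y)" by (rule sup)
  show "x \<in> C \<Longrightarrow> y \<in> C \<Longrightarrow> \<omega> (inf x y) = min (\<omega> x) (\<omega> y)" by (rule inf)
  show "\<omega> \<bar>x\<bar> = \<bar>\<omega> x\<bar>" if "x \<in> C"
    using sup[of x "- x"] neg[of x] that Cs(5) by (simp add: abs_lattice[where 'a='a] max_def)
  show "\<omega> (pprt x) = max (\<omega> x) 0" if "x \<in> C"
    using sup[of x 0] zero that Cs(1) by (simp add: pprt_def)
  show "\<omega> x \<le> \<omega> y" if "x \<in> C" "y \<in> C" "x \<le> y"
    using sup[of x y] that by (simp add: sup_absorb2 max_def split: if_splits)
qed

text \<open>Order ideals are represented by their sets of positive elements.\<close>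

definition positive_ideal :: "'a::archimedean_vector_lattice set \<Rightarrow> bool" where
  "positive_ideal I \<longleftrightarrow> 0 \<in> I \<and> (\<forall>x\<in>I. 0 \<le> x) \<and> (\<forall>x\<in>I. \<forall>y\<in>I. x + y \<in> I) \<and>
     (\<forall>x\<in>I. \<forall>y. 0 \<le> y \<longrightarrow> y \<le> x \<longrightarrow> y \<in> I)"

lemma positive_idealD:
  assumes "positive_ideal I"
  shows "0 \<in> I" "x \<in> I \<Longrightarrow> 0 \<le> x" "x \<in> I \<Longrightarrow> y \<in> I \<Longrightarrow> x + y \<in> I"
    "x \<in> I \<Longrightarrow> 0 \<le> y \<Longrightarrow> y \<le> x \<Longrightarrow> y \<in> I"
  using assms unfolding positive_ideal_def by blast+

lemma positive_ideal_scaleR: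
  assumes I: "positive_ideal I" and x: "x \<in> I" and c: "0 \<le> c"
  shows "c *\<^sub>R x \<in> I"
proof -
  have nat: "real n *\<^sub>R x \<in> I" for n
    by (induction n) (use positive_idealD(1,3)[OF I] x in \<open>auto simp: scaleR_add_left\<close>)
  obtain n where n: "c \<le> real n" using real_arch_simple by blast
  have "0 \<le> x" using positive_idealD(2)[OF I x] .
  then have "0 \<le> c *\<^sub>R x" "c *\<^sub>R x \<le> real n *\<^sub>R x"
    using c n by (auto intro: scaleR_nonneg_nonneg scaleR_right_mono)
  with nat[of n] show ?thesis using positive_idealD(4)[OF I] by blast
qed

text \<open>Zorn's lemma gives an ideal \<open>I\<close> that is maximal among those containing
  \<open>I0\<close> and avoiding \<open>y\<close>. If disjoint \<open>a\<close> and \<open>b\<close>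
  were both outside \<open>I\<close>, enlarging \<open>I\<close> by either would capture
  \<open>y\<close>, and the infimum of the two resulting bounds on \<open>y\<close> is an element of
  \<open>I\<close>.\<close>

lemma prime_positive_ideal_avoiding:
  fixes y :: "'a::archimedean_vector_lattice"
  assumes I0: "positive_ideal I0" and y0: "y \<notin> I0" and ypos: "0 \<le> y"
  obtains I where "positive_ideal I" "I0 \<subseteq> I" "y \<notin> I"
    "\<And>a b. 0 \<le> a \<Longrightarrow> 0 \<le> b \<Longrightarrow> inf a b = 0 \<Longrightarrow> a \<in> I \<or> b \<in> I"
proof -
  define A where "A = {I. positive_ideal I \<and> I0 \<subseteq> I \<and> y \<notin> I}"
  have "\<exists>M\<in>A. \<forall>X\<in>A. M \<subseteq> X \<longrightarrow> X = M"
  proof (rule subset_Zorn_nonempty)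
    show "A \<noteq> {}" using I0 y0 by (auto simp: A_def)
    fix \<C> assume ne: "\<C> \<noteq> {}" and ch: "subset.chain A \<C>"
    then have sub: "\<C> \<subseteq> A" by (auto simp: subset_chain_def)
    have tot: "X \<subseteq> Z \<or> Z \<subseteq> X" if "X \<in> \<C>" "Z \<in> \<C>" for X Z
      using ch that by (auto simp: subset_chain_def)
    have pI: "positive_ideal X" if "X \<in> \<C>" for X using sub that by (auto simp: A_def)
    have "positive_ideal (\<Union>\<C>)"
      unfolding positive_ideal_def
    proof (intro conjI ballI allI impI)
      show "0 \<in> \<Union>\<C>" using ne positive_idealD(1)[OF pI] by blast
      show "0 \<le> x" if "x \<in> \<Union>\<C>" for x using that positive_idealD(2)[OF pI] by blast
      show "x + z \<in> \<Union>\<C>" if xz: "x \<in> \<Union>\<C>" "z \<in> \<Union>\<C>" for x z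
      proof -
        from xz obtain X Z where XZ: "X \<in> \<C>" "Z \<in> \<C>" "x \<in> X" "z \<in> Z" by blast
        with tot[of X Z] obtain W where "W \<in> \<C>" "x \<in> W" "z \<in> W" by blast
        then show ?thesis using positive_idealD(3)[OF pI] by blast
      qed
      show "z \<in> \<Union>\<C>" if "x \<in> \<Union>\<C>" "0 \<le> z" "z \<le> x" for x z
        using that positive_idealD(4)[OF pI] by blast
    qed
    then show "\<Union>\<C> \<in> A" using sub ne by (auto simp: A_def)
  qed
  then obtain I where IA: "I \<in> A" and max: "\<And>X. X \<in> A \<Longrightarrow> I \<subseteq> X \<Longrightarrow> X = I" by blast
  from IA have I: "positive_ideal I" "I0 \<subseteq> I" "y \<notin> I" by (auto simp: A_def)
  note Is = positive_idealD[OF I(1)]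
  have gen: "\<exists>i\<in>I. \<exists>n. y \<le> i + real n *\<^sub>R a" if a: "0 \<le> a" "a \<notin> I" for a
  proof -
    \<comment> \<open>The positive part of the ideal generated by \<open>I\<close> and
      \<open>a\<close>; maximality of \<open>I\<close> forces it to contain
      \<open>y\<close>.\<close>
    define J where "J = {x. 0 \<le> x \<and> (\<exists>i\<in>I. \<exists>n. x \<le> i + real n *\<^sub>R a)}"
    have "positive_ideal J"
      unfolding positive_ideal_def
    proof (intro conjI ballI allI impI)
      show "0 \<in> J" using Is(1) by (auto simp: J_def intro!: bexI[of _ 0] exI[of _ 0])
      show "0 \<le> x" if "x \<in> J" for x using that by (auto simp: J_def)
      show "x + z \<in> J" if xz: "x \<in> J" "z \<in> J" for x z
      proof -
        from xz obtain i n j m where *: "0 \<le> x" "0 \<le> z" "i \<in> I" "j \<in> I"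
          "x \<le> i + real n *\<^sub>R a" "z \<le> j + real m *\<^sub>R a" by (auto simp: J_def)
        have "x + z \<le> (i + real n *\<^sub>R a) + (j + real m *\<^sub>R a)"
          using *(5,6) by (rule add_mono)
        also have "\<dots> = (i + j) + real (n + m) *\<^sub>R a"
          by (simp add: scaleR_add_left)
        finally show ?thesis unfolding J_def mem_Collect_eq
          using add_nonneg_nonneg[OF *(1,2)] Is(3)[OF *(3,4)] by blast
      qed
      show "z \<in> J" if "x \<in> J" "0 \<le> z" "z \<le> x" for x z
        using that unfolding J_def by (auto intro: order_trans)
    qed
    moreover have IJ: "I \<subseteq> J"
    proof
      fix x assume "x \<in> I"
      then show "x \<in> J" using Is(2) by (auto simp: J_def intro!: bexI[of _ x] exI[of _ 0])
    qed
    moreover have "a \<in> J" using a Is(1) by (auto simp: J_def intro!: bexI[of _ 0] exI[of _ 1])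
    ultimately have "y \<in> J" using max[of J] I a by (auto simp: A_def)
    then show ?thesis by (auto simp: J_def)
  qed
  have prime: "a \<in> I \<or> b \<in> I" if ab: "0 \<le> a" "0 \<le> b" "inf a b = 0" for a b
  proof (rule ccontr)
    assume "\<not> (a \<in> I \<or> b \<in> I)"
    then obtain i n j m where ij: "i \<in> I" "j \<in> I"
      and y: "y \<le> i + real n *\<^sub>R a" "y \<le> j + real m *\<^sub>R b"
      using gen[of a] gen[of b] ab by blast
    \<comment> \<open>A common shift \<open>i + j\<close> and a common factor \<open>N\<close> can
      be pulled out of the infimum, leaving \<open>inf a b = 0\<close>.\<close>
    define N where "N = real (n + m)"
    have "i + real n *\<^sub>R a \<le> (i + j) + N *\<^sub>R a" "j + real m *\<^sub>R b \<le> (i + j) + N *\<^sub>R b"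
      using ab Is(2)[OF ij(1)] Is(2)[OF ij(2)]
      by (intro add_mono scaleR_right_mono; simp add: N_def)+
    then have "y \<le> inf ((i + j) + N *\<^sub>R a) ((i + j) + N *\<^sub>R b)"
      using y by (auto intro: order_trans)
    also have "\<dots> = (i + j) + N *\<^sub>R inf a b"
      by (simp add: add_inf_distrib_left scaleR_inf N_def)
    finally have "y \<le> i + j" using ab by simp
    then have "y \<in> I" using ypos ij Is(3,4) by blast
    with I show False by blast
  qed
  show ?thesis using that[OF I prime] .
qed

text \<open>Modulo a prime ideal the lattice is totally ordered, so each element bounded by the
  unit \<open>u\<close> has a standard part relative to \<open>u\<close>; taking standard parts is a homomorphism.\<close>

lemma real_lattice_hom_of_prime:
  fixes u :: "'a::archimedean_vector_lattice"
  assumes I: "positive_ideal I" and uI: "u \<notin> I" and u: "0 \<le> u"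
    and prime: "\<And>a b. 0 \<le> a \<Longrightarrow> 0 \<le> b \<Longrightarrow> inf a b = 0 \<Longrightarrow> a \<in> I \<or> b \<in> I"
  obtains \<omega> where "real_lattice_hom_on (principal_ideal u) \<omega>" "\<omega> u = 1"
    "\<And>z. z \<in> principal_ideal u \<Longrightarrow> pprt z \<in> I \<Longrightarrow> \<omega> z \<le> 0"
proof -
  note Is = positive_idealD[OF I]
  \<comment> \<open>Read \<open>N z\<close> as \<open>z \<le> 0\<close> modulo \<open>I\<close>.
    Primeness makes this order total.\<close>
  define N where "N z \<longleftrightarrow> pprt z \<in> I" for z
  have tot: "N z \<or> N (- z)" for z
    unfolding N_def by (rule prime) (auto simp: inf_pprt_pprt_minus)
  have Nadd: "N (z + w)" if "N z" "N w" for z w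
    using Is(4)[OF Is(3) zero_le_pprt pprt_add_le] that unfolding N_def .
  have Nscale: "N (c *\<^sub>R z)" if "N z" "0 \<le> c" for c z
    using that positive_ideal_scaleR[OF I] by (simp add: N_def pprt_scaleR)
  have Nmono: "N z" if "N w" "z \<le> w" for z w
    using that Is(4)[of "pprt w" "pprt z"] unfolding N_def by simp
  have Nsup: "N (sup z w)" if "N z" "N w" for z w
  proof -
    have "sup z w \<le> pprt z + pprt w"
      by (metis add_increasing add_increasing2 le_sup_iff pprt_def sup.cobounded1 zero_le_pprt)
    moreover have "N (pprt z + pprt w)" using that Is(3) by (simp add: N_def add_nonneg_nonneg)
    ultimately show ?thesis using Nmono by blast
  qed
  have Nneg: "N z" if "z \<le> 0" for z using that Is(1) by (simp add: N_def)
  \<comment> \<open>Here \<open>u \<notin> I\<close> enters: positive multiples of \<open>u\<close>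
    stay strictly positive modulo \<open>I\<close>.\<close>
  have Nu: "\<not> N (c *\<^sub>R u)" if "0 < c" for c
  proof
    assume "N (c *\<^sub>R u)"
    from Nscale[OF this, of "inverse c"] show False using that uI u by (simp add: N_def)
  qed
  \<comment> \<open>\<open>t\<close> is the standard part of \<open>z\<close>: modulo
    \<open>I\<close>, \<open>z\<close> lies below every larger and above every smaller multiple of
    \<open>u\<close>. Leaving out \<open>r = t\<close> tolerates infinitesimal differences.\<close>
  define st where "st z t \<longleftrightarrow> (\<forall>r>t. N (z - r *\<^sub>R u)) \<and> (\<forall>r<t. N (r *\<^sub>R u - z))" for z t
  have st_le: "t \<le> t'" if zt: "st z t" and zt': "st w t'" and wz: "N (z - w)" for z w t t'
  proof (rule ccontr)
    assume "\<not> t \<le> t'"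
    then obtain r r' where r: "t' < r" "r < r'" "r' < t" by (metis dense not_le)
    have "N (w - r *\<^sub>R u)" "N (r' *\<^sub>R u - z)" using zt zt' r unfolding st_def by auto
    from Nadd[OF Nadd[OF this] wz] have "N ((r' - r) *\<^sub>R u)"
      by (simp add: scaleR_diff_left algebra_simps)
    with Nu r show False by simp
  qed
  have st_unique: "t = t'" if "st z t" "st z t'" for z t t'
    using st_le[OF that] st_le[OF that(2,1)] Nneg[of 0] by auto
  have st_ex: "\<exists>t. st z t" if z: "z \<in> principal_ideal u" for z
  proof -
    obtain c where c: "0 < c" "\<bar>z\<bar> \<le> c *\<^sub>R u" using principal_idealE[OF z u] .
    have zc: "z \<le> c *\<^sub>R u" "- z \<le> c *\<^sub>R u"
      using c(2) abs_ge_self[of z] abs_ge_minus_self[of z] by (auto intro: order_trans)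
    \<comment> \<open>A Dedekind cut: the standard part is the infimum of the coefficients
      \<open>r\<close> for which \<open>r *\<^sub>R u\<close> lies above \<open>z\<close> modulo
      \<open>I\<close>.\<close>
    define S where "S = {r. N (z - r *\<^sub>R u)}"
    have "c \<in> S" using zc by (auto simp: S_def intro: Nneg)
    have low: "- c \<le> r" if "r \<in> S" for r
    proof (rule ccontr)
      assume "\<not> - c \<le> r"
      have "N (- z - c *\<^sub>R u)" using zc by (intro Nneg) auto
      with that have "N ((z - r *\<^sub>R u) + (- z - c *\<^sub>R u))" unfolding S_def by (intro Nadd) auto
      then have "N ((- c - r) *\<^sub>R u)" by (simp add: scaleR_diff_left diff_diff_eq add.commute)
      with Nu \<open>\<not> - c \<le> r\<close> show False by simp
    qed
    have "bdd_below S" using low by (auto simp: bdd_below_def)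
    have "st z (Inf S)"
      unfolding st_def
    proof (intro conjI allI impI)
      fix r assume "Inf S < r"
      then obtain r' where r': "r' \<in> S" "r' < r"
        using cInf_lessD[of S r] \<open>c \<in> S\<close> by blast
      have "r' *\<^sub>R u \<le> r *\<^sub>R u" using r' u by (intro scaleR_right_mono) auto
      then have "z - r *\<^sub>R u \<le> z - r' *\<^sub>R u" by simp
      with r' show "N (z - r *\<^sub>R u)" using Nmono unfolding S_def by blast
    next
      fix r assume "r < Inf S"
      then have "r \<notin> S" using cInf_lower[OF _ \<open>bdd_below S\<close>] by force
      then show "N (r *\<^sub>R u - z)" using tot[of "z - r *\<^sub>R u"] by (simp add: S_def)
    qed
    then show ?thesis by blast
  qed
  have st_add: "st (z + w) (t + t')" if "st z t" "st w t'" for z w t t'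
    unfolding st_def
  proof (intro conjI allI impI)
    fix r assume "t + t' < r"
    then obtain p where p: "t < p" "t' < r - p" using dense[of t "r - t'"] by (auto simp: less_diff_eq)
    then have "N ((z - p *\<^sub>R u) + (w - (r - p) *\<^sub>R u))"
      using that unfolding st_def by (intro Nadd) auto
    moreover have "(z - p *\<^sub>R u) + (w - (r - p) *\<^sub>R u) = z + w - r *\<^sub>R u"
      by (simp add: scaleR_diff_left)
    ultimately show "N (z + w - r *\<^sub>R u)" by simp
  next
    fix r assume "r < t + t'"
    then obtain p where p: "p < t" "r - p < t'" using dense[of "r - t'" t] by (auto simp: diff_less_eq)
    then have "N ((p *\<^sub>R u - z) + ((r - p) *\<^sub>R u - w))"
      using that unfolding st_def by (intro Nadd) auto
    moreover have "(p *\<^sub>R u - z) + ((r - p) *\<^sub>R u - w) = r *\<^sub>R u - (z + w)"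
      by (simp add: scaleR_diff_left)
    ultimately show "N (r *\<^sub>R u - (z + w))" by simp
  qed
  have st_neg: "st (- z) (- t)" if "st z t" for z t
    unfolding st_def
  proof (intro conjI allI impI)
    fix r assume "- t < r"
    then have "- r < t" by simp
    then have "N ((- r) *\<^sub>R u - z)" using that unfolding st_def by blast
    moreover have "(- r) *\<^sub>R u - z = - z - r *\<^sub>R u" by simp
    ultimately show "N (- z - r *\<^sub>R u)" by (simp only:)
  next
    fix r assume "r < - t"
    then have "t < - r" by simp
    then have "N (z - (- r) *\<^sub>R u)" using that unfolding st_def by blast
    moreover have "z - (- r) *\<^sub>R u = r *\<^sub>R u - - z" by simp
    ultimately show "N (r *\<^sub>R u - - z)" by (simp only:)
  qed
  have st_pos: "st (c *\<^sub>R z) (c * t)" if "st z t" "0 < c" for z t c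
    unfolding st_def
  proof (intro conjI allI impI)
    fix r assume "c * t < r"
    then have "t < r / c" using that by (simp add: field_simps)
    then have "N (c *\<^sub>R (z - (r / c) *\<^sub>R u))" using that unfolding st_def by (intro Nscale) auto
    then show "N (c *\<^sub>R z - r *\<^sub>R u)" using that by (simp add: scaleR_diff_right)
  next
    fix r assume "r < c * t"
    then have "r / c < t" using that by (simp add: field_simps)
    then have "N (c *\<^sub>R ((r / c) *\<^sub>R u - z))" using that unfolding st_def by (intro Nscale) auto
    then show "N (r *\<^sub>R u - c *\<^sub>R z)" using that by (simp add: scaleR_diff_right)
  qed
  have u_neg: "N (r *\<^sub>R u)" if "r \<le> 0" for r
    using that u by (intro Nneg) (simp add: scaleR_nonpos_nonneg)
  have st_zero: "st 0 0"
    unfolding st_def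
  proof (intro conjI allI impI)
    fix r :: real assume "0 < r"
    then show "N (0 - r *\<^sub>R u)" using u_neg[of "- r"] by simp
  next
    fix r :: real assume "r < 0"
    then show "N (r *\<^sub>R u - 0)" using u_neg[of r] by simp
  qed
  have st_u: "st u 1"
    unfolding st_def
  proof (intro conjI allI impI)
    fix r :: real assume "1 < r"
    then show "N (u - r *\<^sub>R u)" using u_neg[of "1 - r"] by (simp add: scaleR_diff_left)
  next
    fix r :: real assume "r < 1"
    then show "N (r *\<^sub>R u - u)" using u_neg[of "r - 1"] by (simp add: scaleR_diff_left)
  qed
  have st_scale: "st (c *\<^sub>R z) (c * t)" if "st z t" for z t c
  proof (cases "c = 0 \<or> 0 < c")
    case True
    then show ?thesis using st_zero st_pos[OF that] by auto
  next
    case False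
    then have "0 < - c" by simp
    from st_neg[OF st_pos[OF that this]] show ?thesis by simp
  qed
  have st_sup: "st (sup z w) (max t t')" if "st z t" "st w t'" for z w t t'
    unfolding st_def
  proof (intro conjI allI impI)
    fix r assume "max t t' < r"
    then have "N (sup (z - r *\<^sub>R u) (w - r *\<^sub>R u))"
      using that unfolding st_def by (intro Nsup) auto
    moreover have "sup (z - r *\<^sub>R u) (w - r *\<^sub>R u) = sup z w - r *\<^sub>R u"
      using add_sup_distrib_right[of z w "- (r *\<^sub>R u)"] by simp
    ultimately show "N (sup z w - r *\<^sub>R u)" by simp
  next
    fix r assume "r < max t t'"
    then have "N (r *\<^sub>R u - z) \<or> N (r *\<^sub>R u - w)" using that unfolding st_def by (auto simp: less_max_iff_disj)
    then show "N (r *\<^sub>R u - sup z w)"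
      by (auto elim!: Nmono intro: diff_left_mono)
  qed
  have st_inf: "st (inf z w) (min t t')" if "st z t" "st w t'" for z w t t'
  proof -
    have "st (- sup (- z) (- w)) (- max (- t) (- t'))"
      by (intro st_neg st_sup that)
    moreover have "- max (- t) (- t') = min t t'" by (simp add: max_def min_def)
    ultimately show ?thesis by (simp only: inf_eq_neg_sup[of z w])
  qed
  define \<omega> where "\<omega> z = (THE t. st z t)" for z
  have wI: "\<omega> z = t" if "st z t" for z t
    unfolding \<omega>_def using that st_unique by blast
  have w: "st z (\<omega> z)" if "z \<in> principal_ideal u" for z
    using st_ex[OF that] wI by auto
  have "real_lattice_hom_on (principal_ideal u) \<omega>"
    unfolding real_lattice_hom_on_def sup_real_def inf_real_def
    by (intro conjI ballI allI impI wI st_add st_scale st_sup st_inf w)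
  moreover have "\<omega> u = 1" by (rule wI[OF st_u])
  moreover have "\<omega> z \<le> 0" if "z \<in> principal_ideal u" "pprt z \<in> I" for z
    using st_le[OF w[OF that(1)] st_zero] that(2) by (simp add: N_def)
  ultimately show ?thesis using that by blast
qed

section \<open>Separation of points and extension of homomorphisms\<close>

definition unital_homs :: "'a::archimedean_vector_lattice \<Rightarrow> ('a \<Rightarrow> real) set" where
  "unital_homs u = {\<omega>. real_lattice_hom_on (principal_ideal u) \<omega> \<and> \<omega> u = 1}"

text \<open>If \<open>x\<close> fails to be nonnegative, the Archimedean property leaves room for a
  shift: \<open>z = x + e *\<^sub>R u\<close> still has a nonzero negative part for some
  \<open>e > 0\<close>. A prime ideal avoiding that part contains \<open>pprt z\<close> and yields
  \<open>\<omega> z \<le> 0\<close>, that is \<open>\<omega> x \<le> - e\<close>. The shift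
  compensates for standard parts turning strict inequalities into weak ones.\<close>

lemma unital_homs_separate:
  fixes u :: "'a::archimedean_vector_lattice"
  assumes u: "0 \<le> u" and x: "x \<in> principal_ideal u"
    and pos: "\<And>\<omega>. \<omega> \<in> unital_homs u \<Longrightarrow> 0 \<le> \<omega> x"
  shows "0 \<le> x"
proof (rule ccontr)
  assume neg: "\<not> 0 \<le> x"
  note C = vector_sublattice_principal_ideal[OF u]
  have "\<exists>e>0. \<not> - x \<le> e *\<^sub>R u"
  proof (rule ccontr)
    assume "\<not> (\<exists>e>0. \<not> - x \<le> e *\<^sub>R u)"
    then have le: "- x \<le> e *\<^sub>R u" if "0 < e" for e using that by blast
    then have "- x \<le> 0" by (intro le_zero_if_le_scaleR[OF u])
    then show False using neg by simp
  qed
  then obtain e where e: "0 < e" "\<not> - x \<le> e *\<^sub>R u" by blast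
  define z where "z = x + e *\<^sub>R u"
  have zC: "z \<in> principal_ideal u"
    unfolding z_def
    by (intro vector_sublatticeD(2)[OF C] vector_sublatticeD(4)[OF C] x principal_ideal_unit u)
  have "\<not> - z \<le> 0"
  proof
    assume "- z \<le> 0"
    from add_right_mono[OF this, of "e *\<^sub>R u"] e show False by (simp add: z_def)
  qed
  then have y: "pprt (- z) \<noteq> 0" by (simp add: le_zero_iff_zero_pprt)
  have "positive_ideal {0::'a}" by (auto simp: positive_ideal_def)
  then obtain I where I: "positive_ideal I" "pprt (- z) \<notin> I"
    "\<And>a b. 0 \<le> a \<Longrightarrow> 0 \<le> b \<Longrightarrow> inf a b = 0 \<Longrightarrow> a \<in> I \<or> b \<in> I"
    using prime_positive_ideal_avoiding[of "{0}" "pprt (- z)"] y by (metis singletonD zero_le_pprt)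
  \<comment> \<open>Otherwise \<open>I\<close> would contain all nonnegative multiples of
    \<open>u\<close>, and with them the negative part of \<open>z\<close>.\<close>
  have "u \<notin> I"
  proof
    assume uI: "u \<in> I"
    obtain c where c: "0 < c" "\<bar>z\<bar> \<le> c *\<^sub>R u" using principal_idealE[OF zC u] .
    have "pprt (- z) \<le> \<bar>z\<bar>" by (simp add: pprt_def abs_ge_minus_self)
    then have "pprt (- z) \<le> c *\<^sub>R u" using c by (auto intro: order_trans)
    then show False
      using positive_idealD(4)[OF I(1) positive_ideal_scaleR[OF I(1) uI]] c I(2)
      by (metis less_imp_le zero_le_pprt)
  qed
  from real_lattice_hom_of_prime[OF I(1) this u I(3)]
  obtain \<omega> where w: "real_lattice_hom_on (principal_ideal u) \<omega>" "\<omega> u = 1"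
    "\<And>z. z \<in> principal_ideal u \<Longrightarrow> pprt z \<in> I \<Longrightarrow> \<omega> z \<le> 0" by blast
  have "pprt z \<in> I" using I(3)[of "pprt z" "pprt (- z)"] I(2) by (auto simp: inf_pprt_pprt_minus)
  then have "\<omega> z \<le> 0" using w(3)[OF zC] by blast
  moreover have "\<omega> z = \<omega> x + e"
    unfolding z_def using real_lattice_homD(2,4)[OF C w(1)] vector_sublatticeD(4)[OF C]
      x principal_ideal_unit[OF u] w(2) by simp
  moreover have "0 \<le> \<omega> x" using pos w by (auto simp: unital_homs_def)
  ultimately show False using e by linarith
qed

lemma unital_homs_le:
  fixes u :: "'a::archimedean_vector_lattice"
  assumes "0 \<le> u" "x \<in> principal_ideal u" "y \<in> principal_ideal u"
    and "\<And>\<omega>. \<omega> \<in> unital_homs u \<Longrightarrow> \<omega> x \<le> \<omega> y"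
  shows "x \<le> y"
proof -
  note C = vector_sublattice_principal_ideal[OF assms(1)]
  have "0 \<le> y - x"
  proof (rule unital_homs_separate[OF assms(1)])
    show "y - x \<in> principal_ideal u" by (intro vector_sublatticeD(3)[OF C] assms)
    fix \<omega> assume w: "\<omega> \<in> unital_homs u"
    then have "\<omega> (y - x) = \<omega> y - \<omega> x"
      by (intro real_lattice_homD(3)[OF C] assms) (simp add: unital_homs_def)
    with assms(4)[OF w] show "0 \<le> \<omega> (y - x)" by simp
  qed
  then show ?thesis by simp
qed

lemma unital_homs_eq:
  fixes u :: "'a::archimedean_vector_lattice"
  assumes "0 \<le> u" "x \<in> principal_ideal u" "y \<in> principal_ideal u"
    and "\<And>\<omega>. \<omega> \<in> unital_homs u \<Longrightarrow> \<omega> x = \<omega> y"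
  shows "x = y"
  by (intro antisym unital_homs_le[OF assms(1-3)] unital_homs_le[OF assms(1,3,2)])
    (simp_all only: assms(4) order_refl)

text \<open>The ideal \<open>I0\<close> collects the positive elements dominated by the kernel of
  \<open>\<omega>\<close>. It misses \<open>u\<close>, so it extends to a prime ideal missing
  \<open>u\<close>, whose homomorphism satisfies \<open>\<omega>' x \<le> \<omega> x\<close> on
  \<open>C\<close> because the positive part of \<open>x - \<omega> x *\<^sub>R u\<close> lies in
  \<open>I0\<close>. Applying this to \<open>- x\<close> gives equality.\<close>

lemma real_lattice_hom_extend:
  fixes u :: "'a::archimedean_vector_lattice"
  assumes C: "vector_sublattice C" and uC: "u \<in> C" and u: "0 \<le> u"
    and CI: "C \<subseteq> principal_ideal u" and w: "real_lattice_hom_on C \<omega>" and wu: "\<omega> u = 1"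
  obtains \<omega>' where "\<omega>' \<in> unital_homs u" "\<And>x. x \<in> C \<Longrightarrow> \<omega>' x = \<omega> x"
proof -
  note Cs = vector_sublatticeD[OF C] and ws = real_lattice_homD[OF C w]
  define I0 where "I0 = {x. 0 \<le> x \<and> (\<exists>c\<in>C. x \<le> c \<and> \<omega> c = 0)}"
  have "positive_ideal I0"
    unfolding positive_ideal_def
  proof (intro conjI ballI allI impI)
    show "0 \<in> I0" using Cs(1) ws(1) by (auto simp: I0_def)
    show "0 \<le> x" if "x \<in> I0" for x using that by (auto simp: I0_def)
    show "x + y \<in> I0" if xy: "x \<in> I0" "y \<in> I0" for x y
    proof -
      from xy obtain c d where "0 \<le> x" "0 \<le> y" "c \<in> C" "d \<in> C" "x \<le> c" "y \<le> d" "\<omega> c = 0" "\<omega> d = 0"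
        by (auto simp: I0_def)
      then show ?thesis
        using Cs(2) ws(2) by (auto simp: I0_def intro!: bexI[of _ "c + d"] add_mono)
    qed
    show "y \<in> I0" if "x \<in> I0" "0 \<le> y" "y \<le> x" for x y
      using that by (auto simp: I0_def intro: order_trans)
  qed
  moreover have "u \<notin> I0" using ws(10)[OF uC] wu by (force simp: I0_def)
  ultimately obtain I where I: "positive_ideal I" "I0 \<subseteq> I" "u \<notin> I"
    "\<And>a b. 0 \<le> a \<Longrightarrow> 0 \<le> b \<Longrightarrow> inf a b = 0 \<Longrightarrow> a \<in> I \<or> b \<in> I"
    using prime_positive_ideal_avoiding[OF _ _ u] by metis
  from real_lattice_hom_of_prime[OF I(1,3) u I(4)]
  obtain \<omega>' where w': "real_lattice_hom_on (principal_ideal u) \<omega>'" "\<omega>' u = 1"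
    "\<And>z. z \<in> principal_ideal u \<Longrightarrow> pprt z \<in> I \<Longrightarrow> \<omega>' z \<le> 0" by blast
  note w's = real_lattice_homD[OF vector_sublattice_principal_ideal[OF u] w'(1)]
  have le: "\<omega>' x \<le> \<omega> x" if x: "x \<in> C" for x
  proof -
    have xC: "x - \<omega> x *\<^sub>R u \<in> C" by (intro Cs(3,4) x uC)
    have "\<omega> (x - \<omega> x *\<^sub>R u) = 0" using x uC Cs wu by (simp add: ws)
    then have "pprt (x - \<omega> x *\<^sub>R u) \<in> I0"
      using Cs(9)[OF xC] ws(9)[OF xC] by (auto simp: I0_def)
    then have "\<omega>' (x - \<omega> x *\<^sub>R u) \<le> 0" using w'(3) xC CI I(2) by blast
    moreover have "\<omega>' (x - \<omega> x *\<^sub>R u) = \<omega>' x - \<omega> x"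
      using x uC CI w'(2) Cs(4)[OF uC] by (subst w's(3)) (auto simp: w's(4) subset_eq)
    ultimately show ?thesis by simp
  qed
  have "\<omega>' x = \<omega> x" if x: "x \<in> C" for x
    using le[OF x] le[OF Cs(5)[OF x]] ws(5)[OF x] w's(5)[of x] x CI by force
  then show ?thesis using that w' by (auto simp: unital_homs_def)
qed

section \<open>Functions represented by elements of a principal ideal\<close>

lemmas principal_ideal_closed = vector_sublatticeD[OF vector_sublattice_principal_ideal]

lemma unital_hom_on: "\<omega> \<in> unital_homs u \<Longrightarrow> real_lattice_hom_on (principal_ideal u) \<omega>"
  by (simp add: unital_homs_def)

lemma unital_hom_unit: "\<omega> \<in> unital_homs u \<Longrightarrow> \<omega> u = 1"
  by (simp add: unital_homs_def)

lemmas unital_hom = real_lattice_homD[OF vector_sublattice_principal_ideal unital_hom_on]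

lemma unital_hom_sum:
  assumes u: "0 \<le> u" and w: "\<omega> \<in> unital_homs u" and h: "\<And>i. i \<in> I \<Longrightarrow> h i \<in> principal_ideal u"
  shows "\<omega> (\<Sum>i\<in>I. h i) = (\<Sum>i\<in>I. \<omega> (h i))"
  using h
proof (induction I rule: infinite_finite_induct)
  case (insert i I)
  have "\<omega> (h i + (\<Sum>i\<in>I. h i)) = \<omega> (h i) + \<omega> (\<Sum>i\<in>I. h i)"
    by (intro unital_hom(2)[OF u w] principal_ideal_closed(10)[OF u] insert.prems) auto
  with insert show ?case by simp
qed (simp_all add: unital_hom(1)[OF u w])

lemma unital_hom_interval:
  assumes u: "0 \<le> u" and w: "\<omega> \<in> unital_homs u" and x: "0 \<le> x" "x \<le> u"
  shows "0 \<le> \<omega> x" "\<omega> x \<le> 1"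
proof -
  have x': "x \<in> principal_ideal u" using x by (rule principal_ideal_interval)
  show "0 \<le> \<omega> x"
    using unital_hom(10)[OF u w principal_ideal_closed(1)[OF u] x' x(1)] unital_hom(1)[OF u w] by simp
  show "\<omega> x \<le> 1"
    using unital_hom(10)[OF u w x' principal_ideal_unit[OF u] x(2)] unital_hom_unit[OF w] by simp
qed

lemma unital_homs_intervalI:
  assumes u: "0 \<le> u" and z: "z \<in> principal_ideal u"
    and "\<And>\<omega>. \<omega> \<in> unital_homs u \<Longrightarrow> 0 \<le> \<omega> z \<and> \<omega> z \<le> 1"
  shows "0 \<le> z" "z \<le> u"
  using assms
  by (auto intro!: unital_homs_separate[OF u z] unital_homs_le[OF u z principal_ideal_unit[OF u]]
      simp: unital_hom_unit)

text \<open>The Kakutani picture: an element \<open>z\<close> of the ideal is seen as the function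
  sending \<open>\<omega>\<close> to \<open>\<omega> z\<close>. Squares, products and harmonic means
  are formed pointwise; this predicate says that the result comes from an element.\<close>

definition representable :: "'a::archimedean_vector_lattice \<Rightarrow> (('a \<Rightarrow> real) \<Rightarrow> real) \<Rightarrow> bool" where
  "representable u \<Phi> \<longleftrightarrow> (\<exists>z\<in>principal_ideal u. \<forall>\<omega>\<in>unital_homs u. \<omega> z = \<Phi> \<omega>)"

lemma representableE:
  assumes "representable u \<Phi>"
  obtains z where "z \<in> principal_ideal u" "\<And>\<omega>. \<omega> \<in> unital_homs u \<Longrightarrow> \<omega> z = \<Phi> \<omega>"
  using assms by (auto simp: representable_def)

lemma representableI:
  "z \<in> principal_ideal u \<Longrightarrow> (\<And>\<omega>. \<omega> \<in> unital_homs u \<Longrightarrow> \<omega> z = \<Phi> \<omega>) \<Longrightarrow> representable u \<Phi>"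
  by (auto simp: representable_def)

text \<open>Completeness provides a limit \<open>l\<close>, but relative to an unknown regulator
  \<open>v\<close>. Comparison with far terms bounds \<open>\<bar>z n - l\<bar>\<close> by
  \<open>(2 * d n) *\<^sub>R u + e *\<^sub>R v\<close> for every \<open>e > 0\<close>, and the
  Archimedean property discards \<open>v\<close>; thus \<open>l\<close> lies in the ideal of
  \<open>u\<close> and has the right values.\<close>

lemma representable_uniform_limit:
  fixes u :: "'a::archimedean_vector_lattice"
  assumes uc: "uniformly_complete TYPE('a)" and u: "0 \<le> u"
    and approx: "\<And>e. 0 < e \<Longrightarrow>
      \<exists>z\<in>principal_ideal u. \<forall>\<omega>\<in>unital_homs u. \<bar>\<omega> z - \<Phi> \<omega>\<bar> \<le> e"
  shows "representable u \<Phi>"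
proof -
  define d where "d n = 1 / real (Suc n)" for n
  have d: "0 < d n" for n by (simp add: d_def)
  have d_small: "\<exists>N. \<forall>n\<ge>N. d n < e" if "0 < e" for e
  proof -
    from reals_Archimedean[OF that] obtain N where N: "inverse (real (Suc N)) < e" by blast
    have "d n < e" if "N \<le> n" for n
      using N that le_imp_inverse_le[of "real (Suc N)" "real (Suc n)"]
      by (simp add: d_def inverse_eq_divide)
    then show ?thesis by blast
  qed
  have "\<forall>n. \<exists>z. z \<in> principal_ideal u \<and> (\<forall>\<omega>\<in>unital_homs u. \<bar>\<omega> z - \<Phi> \<omega>\<bar> \<le> d n)"
    using approx[OF d] by blast
  then obtain z where z: "\<And>n. z n \<in> principal_ideal u"
    and zw: "\<And>n \<omega>. \<omega> \<in> unital_homs u \<Longrightarrow> \<bar>\<omega> (z n) - \<Phi> \<omega>\<bar> \<le> d n"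
    by metis
  have dist: "\<bar>z m - z n\<bar> \<le> (d m + d n) *\<^sub>R u" for m n
  proof (rule unital_homs_le[OF u])
    show "\<bar>z m - z n\<bar> \<in> principal_ideal u" "(d m + d n) *\<^sub>R u \<in> principal_ideal u"
      by (intro principal_ideal_closed[OF u] z principal_ideal_unit u)+
    fix \<omega> assume w: "\<omega> \<in> unital_homs u"
    have "\<omega> \<bar>z m - z n\<bar> = \<bar>\<omega> (z m) - \<omega> (z n)\<bar>"
      using z by (simp add: unital_hom(3,8)[OF u w] principal_ideal_closed(3)[OF u])
    also have "\<dots> \<le> d m + d n" using zw[OF w, of m] zw[OF w, of n] by linarith
    also have "\<dots> = \<omega> ((d m + d n) *\<^sub>R u)"
      using unital_hom(4)[OF u w principal_ideal_unit[OF u]] unital_hom_unit[OF w] by simp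
    finally show "\<omega> \<bar>z m - z n\<bar> \<le> \<omega> ((d m + d n) *\<^sub>R u)" .
  qed
  have "ru_Cauchy z"
    unfolding ru_Cauchy_def
  proof (intro exI[of _ u] conjI allI impI u)
    fix e :: real assume "0 < e"
    then obtain N where N: "\<And>n. N \<le> n \<Longrightarrow> d n < e / 2" using d_small[of "e / 2"] by auto
    have "\<bar>z m - z n\<bar> \<le> e *\<^sub>R u" if "N \<le> m" "N \<le> n" for m n
    proof -
      have "(d m + d n) *\<^sub>R u \<le> e *\<^sub>R u"
        using N[OF that(1)] N[OF that(2)] u by (intro scaleR_right_mono) auto
      with dist show ?thesis by (rule order_trans)
    qed
    then show "\<exists>N. \<forall>m\<ge>N. \<forall>n\<ge>N. \<bar>z m - z n\<bar> \<le> e *\<^sub>R u" by blast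
  qed
  then obtain l v where v: "0 \<le> v"
    and l: "\<And>e. 0 < e \<Longrightarrow> \<exists>N. \<forall>n\<ge>N. \<bar>z n - l\<bar> \<le> e *\<^sub>R v"
    using uc unfolding uniformly_complete_def ru_convergent_def by metis
  have lim: "\<bar>z n - l\<bar> \<le> (2 * d n) *\<^sub>R u" for n
  proof -
    have "\<bar>z n - l\<bar> - (2 * d n) *\<^sub>R u \<le> e *\<^sub>R v" if e: "0 < e" for e
    proof -
      obtain N where N: "\<And>m. N \<le> m \<Longrightarrow> \<bar>z m - l\<bar> \<le> e *\<^sub>R v" using l[OF e] by blast
      define m where "m = max N n"
      have dm: "d m \<le> d n" by (simp add: d_def m_def frac_le)
      have "\<bar>z n - l\<bar> \<le> \<bar>z n - z m\<bar> + \<bar>z m - l\<bar>"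
        using abs_triangle_ineq[of "z n - z m" "z m - l"] by simp
      also have "\<dots> \<le> (d n + d m) *\<^sub>R u + e *\<^sub>R v"
        using dist N[of m] by (intro add_mono) (auto simp: m_def)
      also have "\<dots> \<le> (2 * d n) *\<^sub>R u + e *\<^sub>R v"
        using dm u by (intro add_right_mono scaleR_right_mono) auto
      finally show ?thesis by (simp add: diff_le_eq add.commute)
    qed
    from le_zero_if_le_scaleR[OF v this] show ?thesis by simp
  qed
  have zl: "z n - l \<in> principal_ideal u" for n using lim by (rule principal_idealI)
  have "z 0 - (z 0 - l) \<in> principal_ideal u" by (intro principal_ideal_closed(3)[OF u] z zl)
  then have lI: "l \<in> principal_ideal u" by simp
  have "\<omega> l = \<Phi> \<omega>" if w: "\<omega> \<in> unital_homs u" for \<omega>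
  proof (rule ccontr)
    assume "\<omega> l \<noteq> \<Phi> \<omega>"
    then obtain N where N: "\<And>n. N \<le> n \<Longrightarrow> d n < \<bar>\<omega> l - \<Phi> \<omega>\<bar> / 3"
      using d_small[of "\<bar>\<omega> l - \<Phi> \<omega>\<bar> / 3"] by auto
    have "\<omega> \<bar>z N - l\<bar> \<le> \<omega> ((2 * d N) *\<^sub>R u)"
      by (intro unital_hom(10)[OF u w] lim principal_ideal_closed[OF u] zl principal_ideal_unit u)
    then have "\<bar>\<omega> (z N) - \<omega> l\<bar> \<le> 2 * d N"
      using unital_hom(8)[OF u w zl] unital_hom(3)[OF u w z lI]
        unital_hom(4)[OF u w principal_ideal_unit[OF u]] unital_hom_unit[OF w] by simp
    then show False using zw[OF w, of N] N[of N] by simp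
  qed
  with lI show ?thesis by (rule representableI)
qed

lemma representable_const: "0 \<le> u \<Longrightarrow> representable u (\<lambda>_. c)"
  by (rule representableI[of "c *\<^sub>R u"])
    (simp_all add: principal_ideal_closed(4) principal_ideal_unit unital_hom(4) unital_hom_unit)

lemma representable_add:
  assumes u: "0 \<le> u" and "representable u \<Phi>" "representable u \<Psi>"
  shows "representable u (\<lambda>\<omega>. \<Phi> \<omega> + \<Psi> \<omega>)"
proof -
  obtain x where x: "x \<in> principal_ideal u" "\<And>\<omega>. \<omega> \<in> unital_homs u \<Longrightarrow> \<omega> x = \<Phi> \<omega>"
    using assms(2) by (rule representableE) blast
  obtain y where y: "y \<in> principal_ideal u" "\<And>\<omega>. \<omega> \<in> unital_homs u \<Longrightarrow> \<omega> y = \<Psi> \<omega>"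
    using assms(3) by (rule representableE) blast
  show ?thesis
    by (rule representableI[of "x + y"])
      (simp_all add: x y principal_ideal_closed(2)[OF u] unital_hom(2)[OF u])
qed

lemma representable_scale:
  assumes u: "0 \<le> u" and "representable u \<Phi>"
  shows "representable u (\<lambda>\<omega>. c * \<Phi> \<omega>)"
proof -
  obtain x where x: "x \<in> principal_ideal u" "\<And>\<omega>. \<omega> \<in> unital_homs u \<Longrightarrow> \<omega> x = \<Phi> \<omega>"
    using assms(2) by (rule representableE) blast
  show ?thesis
    by (rule representableI[of "c *\<^sub>R x"])
      (simp_all add: x principal_ideal_closed(4)[OF u] unital_hom(4)[OF u])
qed

lemma representable_bounded:
  assumes u: "0 \<le> u" and "representable u \<Phi>"
  obtains c where "0 < c" "\<And>\<omega>. \<omega> \<in> unital_homs u \<Longrightarrow> \<bar>\<Phi> \<omega>\<bar> \<le> c"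
proof -
  obtain x where x: "x \<in> principal_ideal u" "\<And>\<omega>. \<omega> \<in> unital_homs u \<Longrightarrow> \<omega> x = \<Phi> \<omega>"
    using assms(2) by (rule representableE) blast
  obtain c where c: "0 < c" "\<bar>x\<bar> \<le> c *\<^sub>R u" using principal_idealE[OF x(1) u] .
  have "\<bar>\<Phi> \<omega>\<bar> \<le> c" if w: "\<omega> \<in> unital_homs u" for \<omega>
    using unital_hom(10)[OF u w principal_ideal_closed(8)[OF u x(1)]
        principal_ideal_closed(4)[OF u principal_ideal_unit[OF u]] c(2)]
      unital_hom(4)[OF u w principal_ideal_unit[OF u]] unital_hom(8)[OF u w x(1)] unital_hom_unit[OF w] x(2)[OF w]
    by simp
  with c(1) show ?thesis using that by blast
qed

section \<open>Squares, products and continuous functions of elements\<close>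

definition layer :: "nat \<Rightarrow> 'a::archimedean_vector_lattice \<Rightarrow> 'a \<Rightarrow> nat \<Rightarrow> 'a" where
  "layer n u a k = inf a ((real (Suc k) / real n) *\<^sub>R u) - inf a ((real k / real n) *\<^sub>R u)"

text \<open>A Riemann sum with left endpoints for \<open>a^2\<close>, the integral of
  \<open>2 * r\<close> over \<open>r\<close> from \<open>0\<close> to \<open>a\<close>. It is built
  from lattice operations and scalars, so it exists before any product is available.\<close>

definition layer_square :: "nat \<Rightarrow> 'a::archimedean_vector_lattice \<Rightarrow> 'a \<Rightarrow> 'a" where
  "layer_square n u a = (\<Sum>k<n. (2 * real k / real n) *\<^sub>R layer n u a k)"

text \<open>Each summand misses the increment of \<open>(m k)\<^sup>2\<close> by exactly the square
  of the increment of \<open>m\<close>: either the node \<open>k / n\<close> equals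
  \<open>m k\<close>, or both truncations equal \<open>t\<close> and nothing changes. These squares
  are at most \<open>1 / n\<close> times the increments, which telescope to
  \<open>t\<close>.\<close>

lemma square_layer_sum:
  fixes t :: real
  assumes t: "0 \<le> t" "t \<le> 1" and n: "0 < n"
  defines "S \<equiv> \<Sum>k<n. 2 * real k / real n * (min t (real (Suc k) / real n) - min t (real k / real n))"
  shows "S \<le> t\<^sup>2" "t\<^sup>2 - S \<le> 1 / real n"
proof -
  define m where "m k = min t (real k / real n)" for k
  have m: "m 0 = 0" "m n = t" using t n by (auto simp: m_def)
  have step: "m k \<le> m (Suc k)" "0 \<le> (m (Suc k))\<^sup>2 - (m k)\<^sup>2 - 2 * real k / real n * (m (Suc k) - m k)"
    "(m (Suc k))\<^sup>2 - (m k)\<^sup>2 - 2 * real k / real n * (m (Suc k) - m k) \<le> (m (Suc k) - m k) / real n" for k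
  proof -
    show mono: "m k \<le> m (Suc k)" using n by (auto simp: m_def min_le_iff_disj divide_right_mono)
    have "(m (Suc k))\<^sup>2 - (m k)\<^sup>2 - 2 * real k / real n * (m (Suc k) - m k)
        = (m (Suc k) - m k)\<^sup>2"
    proof (cases "t \<le> real k / real n")
      case True
      moreover have "real k / real n \<le> real (Suc k) / real n" by (intro divide_right_mono) auto
      ultimately have "m k = t" "m (Suc k) = t" unfolding m_def by linarith+
      then show ?thesis by simp
    next
      case False
      then have mk: "2 * real k / real n = 2 * m k" by (simp add: m_def)
      show ?thesis unfolding mk by (simp add: power2_eq_square algebra_simps)
    qed
    note sq = this
    show "0 \<le> (m (Suc k))\<^sup>2 - (m k)\<^sup>2 - 2 * real k / real n * (m (Suc k) - m k)"
      unfolding sq by simp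
    have "m (Suc k) - m k \<le> 1 / real n"
    proof -
      have "real (Suc k) / real n = real k / real n + 1 / real n" "0 < 1 / real n"
        using n by (auto simp: add_divide_distrib)
      then show ?thesis unfolding m_def by linarith
    qed
    then have "(m (Suc k) - m k) * (m (Suc k) - m k) \<le> (m (Suc k) - m k) * (1 / real n)"
      using mono by (intro mult_left_mono) auto
    then show "(m (Suc k))\<^sup>2 - (m k)\<^sup>2 - 2 * real k / real n * (m (Suc k) - m k) \<le> (m (Suc k) - m k) / real n"
      unfolding sq by (simp add: power2_eq_square)
  qed
  have S_eq: "S = (\<Sum>k<n. 2 * real k / real n * (m (Suc k) - m k))"
    by (simp add: S_def m_def)
  have "t\<^sup>2 = (\<Sum>k<n. (m (Suc k))\<^sup>2 - (m k)\<^sup>2)"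
    using sum_lessThan_telescope[of "\<lambda>k. (m k)\<^sup>2" n] m by simp
  then have eq: "t\<^sup>2 - S = (\<Sum>k<n. (m (Suc k))\<^sup>2 - (m k)\<^sup>2 - 2 * real k / real n * (m (Suc k) - m k))"
    by (simp add: S_eq sum_subtractf)
  have "0 \<le> t\<^sup>2 - S" unfolding eq by (intro sum_nonneg step)
  moreover have "t\<^sup>2 - S \<le> (\<Sum>k<n. (m (Suc k) - m k) / real n)"
    unfolding eq by (intro sum_mono step)
  moreover have "(\<Sum>k<n. (m (Suc k) - m k) / real n) = t / real n"
    using sum_lessThan_telescope[of m n] m by (simp add: sum_divide_distrib[symmetric])
  moreover have "t / real n \<le> 1 / real n" using t by (intro divide_right_mono) auto
  ultimately show "S \<le> t\<^sup>2" "t\<^sup>2 - S \<le> 1 / real n" by linarith+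
qed

lemma layer_in_principal_ideal:
  assumes u: "0 \<le> u" and a: "0 \<le> a" "a \<le> u"
  shows "layer n u a k \<in> principal_ideal u" "layer_square n u a \<in> principal_ideal u"
proof -
  have aI: "a \<in> principal_ideal u" using a by (rule principal_ideal_interval)
  show l: "layer n u a k \<in> principal_ideal u" for k
    unfolding layer_def by (intro principal_ideal_closed[OF u] aI principal_ideal_unit u)
  show "layer_square n u a \<in> principal_ideal u"
    unfolding layer_square_def by (intro principal_ideal_closed[OF u] l)
qed

lemma layer_square_approx:
  assumes u: "0 \<le> u" and a: "0 \<le> a" "a \<le> u" and n: "0 < n" and w: "\<omega> \<in> unital_homs u"
  shows "\<omega> (layer_square n u a) \<le> (\<omega> a)\<^sup>2" "(\<omega> a)\<^sup>2 - \<omega> (layer_square n u a) \<le> 1 / real n"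
proof -
  have aI: "a \<in> principal_ideal u" using a by (rule principal_ideal_interval)
  note cl = principal_ideal_closed[OF u] and uI = principal_ideal_unit[OF u]
  note l = layer_in_principal_ideal(1)[OF u a]
  have "\<omega> (layer n u a k) = min (\<omega> a) (real (Suc k) / real n) - min (\<omega> a) (real k / real n)" for k
    unfolding layer_def
    by (subst unital_hom(3)[OF u w]) (auto simp: unital_hom(4,7)[OF u w] unital_hom_unit[OF w] cl(4,7) aI uI)
  then have "\<omega> (layer_square n u a) = (\<Sum>k<n. 2 * real k / real n *
      (min (\<omega> a) (real (Suc k) / real n) - min (\<omega> a) (real k / real n)))"
    unfolding layer_square_def
    by (subst unital_hom_sum[OF u w]) (auto simp: unital_hom(4)[OF u w] l cl(4))
  then show "\<omega> (layer_square n u a) \<le> (\<omega> a)\<^sup>2" "(\<omega> a)\<^sup>2 - \<omega> (layer_square n u a) \<le> 1 / real n"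
    using square_layer_sum[OF unital_hom_interval[OF u w a] n] by simp_all
qed

text \<open>The layer approximation handles values in \<open>[0, 1]\<close>, so
  \<open>\<Phi>\<close> is moved there by an affine map to \<open>\<Psi>\<close>; its square is
  recovered from that of \<open>\<Psi>\<close> by subtracting affine terms.\<close>

lemma representable_square:
  fixes u :: "'a::archimedean_vector_lattice"
  assumes uc: "uniformly_complete TYPE('a)" and u: "0 \<le> u" and rep: "representable u \<Phi>"
  shows "representable u (\<lambda>\<omega>. (\<Phi> \<omega>)\<^sup>2)"
proof -
  obtain c where c: "0 < c" "\<And>\<omega>. \<omega> \<in> unital_homs u \<Longrightarrow> \<bar>\<Phi> \<omega>\<bar> \<le> c"
    using representable_bounded[OF u rep] by blast
  define \<Psi> where "\<Psi> \<omega> = 1 / (2 * c) * (\<Phi> \<omega> + c)" for \<omega>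
  have "representable u \<Psi>"
    unfolding \<Psi>_def by (intro representable_scale representable_add representable_const u rep)
  then obtain a where a: "a \<in> principal_ideal u" "\<And>\<omega>. \<omega> \<in> unital_homs u \<Longrightarrow> \<omega> a = \<Psi> \<omega>"
    by (rule representableE) blast
  have "0 \<le> \<Psi> \<omega> \<and> \<Psi> \<omega> \<le> 1" if "\<omega> \<in> unital_homs u" for \<omega>
    using c(1) c(2)[OF that] unfolding \<Psi>_def by (auto simp: divide_simps abs_le_iff)
  then have a01: "0 \<le> a" "a \<le> u" using unital_homs_intervalI[OF u a(1)] a(2) by auto
  have "representable u (\<lambda>\<omega>. (\<Psi> \<omega>)\<^sup>2)"
  proof (rule representable_uniform_limit[OF uc u])
    fix e :: real assume "0 < e"
    then obtain n where n: "0 < n" "1 / real n < e"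
      by (metis ex_inverse_of_nat_less inverse_eq_divide)
    show "\<exists>z\<in>principal_ideal u. \<forall>\<omega>\<in>unital_homs u. \<bar>\<omega> z - (\<Psi> \<omega>)\<^sup>2\<bar> \<le> e"
    proof (intro bexI[of _ "layer_square n u a"] ballI)
      show "layer_square n u a \<in> principal_ideal u" by (rule layer_in_principal_ideal[OF u a01])
      fix \<omega> assume "\<omega> \<in> unital_homs u"
      then show "\<bar>\<omega> (layer_square n u a) - (\<Psi> \<omega>)\<^sup>2\<bar> \<le> e"
        using layer_square_approx[OF u a01 n(1)] a(2) n(2) by fastforce
    qed
  qed
  then have "representable u (\<lambda>\<omega>. (2 * c)\<^sup>2 * (\<Psi> \<omega>)\<^sup>2 + ((- 2 * c) * \<Phi> \<omega> + (- c\<^sup>2)))"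
    by (intro representable_add representable_scale representable_const u rep)
  moreover have "(2 * c)\<^sup>2 * (\<Psi> \<omega>)\<^sup>2 + ((- 2 * c) * \<Phi> \<omega> + (- c\<^sup>2)) = (\<Phi> \<omega>)\<^sup>2" for \<omega>
  proof -
    have "(2 * c)\<^sup>2 * (\<Psi> \<omega>)\<^sup>2 = (\<Phi> \<omega> + c)\<^sup>2"
      using c(1) by (simp add: \<Psi>_def power_divide power_mult_distrib)
    then show ?thesis by (simp add: power2_eq_square algebra_simps)
  qed
  ultimately show ?thesis by simp
qed

lemma representable_mult:
  fixes u :: "'a::archimedean_vector_lattice"
  assumes uc: "uniformly_complete TYPE('a)" and u: "0 \<le> u"
    and rep: "representable u \<Phi>" "representable u \<Psi>"
  shows "representable u (\<lambda>\<omega>. \<Phi> \<omega> * \<Psi> \<omega>)"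
proof -
  have "representable u (\<lambda>\<omega>. 1 / 2 * ((\<Phi> \<omega> + \<Psi> \<omega>)\<^sup>2 + ((- 1) * (\<Phi> \<omega>)\<^sup>2 + (- 1) * (\<Psi> \<omega>)\<^sup>2)))"
    by (intro representable_add representable_scale representable_square[OF uc] u rep)
  moreover have "1 / 2 * ((\<Phi> \<omega> + \<Psi> \<omega>)\<^sup>2 + ((- 1) * (\<Phi> \<omega>)\<^sup>2 + (- 1) * (\<Psi> \<omega>)\<^sup>2)) = \<Phi> \<omega> * \<Psi> \<omega>" for \<omega>
    by (simp add: power2_eq_square algebra_simps)
  ultimately show ?thesis by simp
qed

text \<open>The continuous functions on the cube whose composition with \<open>x\<close> is
  representable form an algebra that contains the constants and the coordinates in \<open>I\<close>,
  and the latter separate points. Stone--Weierstrass approximates \<open>\<phi>\<close> uniformly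
  from this algebra, and uniform limits stay representable.\<close>

lemma representable_continuous:
  fixes u :: "'a::archimedean_vector_lattice" and I :: "nat set"
  assumes uc: "uniformly_complete TYPE('a)" and u: "0 \<le> u"
    and f: "\<And>i. i \<in> I \<Longrightarrow> 0 \<le> f i \<and> f i \<le> u"
    and cont: "continuous_on (PiE I (\<lambda>_. {0..1})) \<phi>"
  shows "representable u (\<lambda>\<omega>. \<phi> (restrict (\<lambda>i. \<omega> (f i)) I))"
proof -
  define S where "S = (PiE I (\<lambda>_. {0..1}) :: (nat \<Rightarrow> real) set)"
  define x where "x \<omega> = restrict (\<lambda>i. \<omega> (f i)) I" for \<omega> :: "'a \<Rightarrow> real"
  have xS: "x \<omega> \<in> S" if "\<omega> \<in> unital_homs u" for \<omega>
    using f unital_hom_interval[OF u that] by (auto simp: x_def S_def)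
  interpret function_ring_on "{g. continuous_on S g \<and> representable u (\<lambda>\<omega>. g (x \<omega>))}" S
  proof
    \<comment> \<open>Points of the cube take the value \<open>undefined\<close> off
      \<open>I\<close>. With singleton factors there, the cube becomes a product of compact sets
      over all indices.\<close>
    have "S = PiE UNIV (\<lambda>i. if i \<in> I then {0..1} else {undefined})"
      by (auto simp: S_def PiE_iff extensional_def split: if_splits) 
    moreover have "compactin (product_topology (\<lambda>_. euclidean) UNIV)
        (PiE UNIV (\<lambda>i. if i \<in> I then {0..1::real} else {undefined}))"
      by (subst compactin_PiE) auto
    ultimately show "compact S" by (simp add: euclidean_product_topology)
    fix y z assume "y \<in> S" "z \<in> S" "y \<noteq> z"
    then obtain i where i: "i \<in> I" "y i \<noteq> z i" unfolding S_def by (metis PiE_ext)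
    have "continuous_on S (\<lambda>x. x i)" 
      by (rule continuous_on_subset[OF continuous_on_product_coordinates subset_UNIV])
    moreover have "representable u (\<lambda>\<omega>. x \<omega> i)"
      using i f by (intro representableI[of "f i"]) (auto simp: x_def intro: principal_ideal_interval)
    ultimately show "\<exists>g\<in>{g. continuous_on S g \<and> representable u (\<lambda>\<omega>. g (x \<omega>))}. g y \<noteq> g z"
      using i by (intro bexI[of _ "\<lambda>x. x i"]) auto
  qed (auto intro!: continuous_intros representable_add representable_mult[OF uc] representable_const u)
  have "representable u (\<lambda>\<omega>. \<phi> (x \<omega>))"
  proof (rule representable_uniform_limit[OF uc u])
    fix e :: real assume "0 < e"
    with Stone_Weierstrass_basic[of \<phi> e] cont
    obtain g where g: "representable u (\<lambda>\<omega>. g (x \<omega>))" "\<And>y. y \<in> S \<Longrightarrow> \<bar>\<phi> y - g y\<bar> < e"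
      by (auto simp: S_def)
    from g(1) obtain z where z: "z \<in> principal_ideal u" "\<And>\<omega>. \<omega> \<in> unital_homs u \<Longrightarrow> \<omega> z = g (x \<omega>)"
      by (rule representableE) blast
    show "\<exists>z\<in>principal_ideal u. \<forall>\<omega>\<in>unital_homs u. \<bar>\<omega> z - \<phi> (x \<omega>)\<bar> \<le> e"
      using z g(2)[OF xS] by (intro bexI[of _ z]) (auto simp: abs_minus_commute less_imp_le)
  qed
  then show ?thesis by (simp add: x_def)
qed

section \<open>Harmonic means\<close>

lemma nonneg_le_sum:
  fixes f :: "'i \<Rightarrow> 'a::ordered_comm_monoid_add"
  assumes "finite I" "i \<in> I" "\<And>j. j \<in> I \<Longrightarrow> 0 \<le> f j"
  shows "f i \<le> sum f I"
proof -
  have "0 \<le> sum f (I - {i})" using assms by (intro sum_nonneg) auto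
  then show ?thesis using assms by (simp add: sum.remove[of I i] add_increasing2)
qed

section \<open>The harmonic mean of real numbers\<close>

lemma real_harmonic_mean_eq_divide:
  assumes "\<And>i. i \<in> {1..s} \<Longrightarrow> x i \<noteq> 0"
  shows "real_harmonic_mean s x = real s / (\<Sum>j=1..s. 1 / \<bar>x j\<bar>)"
proof -
  have "(\<Prod>i=1..s. \<bar>x i\<bar>) \<noteq> 0" using assms by simp
  then show ?thesis
    using assms unfolding real_harmonic_mean_def sum_distrib_right[symmetric] by auto
qed

lemma real_harmonic_mean_zero: "i \<in> {1..s} \<Longrightarrow> x i = 0 \<Longrightarrow> real_harmonic_mean s x = 0"
  by (auto simp: real_harmonic_mean_def)

lemma real_harmonic_mean_cong:
  assumes "\<And>i. i \<in> {1..s} \<Longrightarrow> x i = y i"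
  shows "real_harmonic_mean s x = real_harmonic_mean s y"
proof -
  have *: "(\<forall>i\<in>{1..s}. x i \<noteq> 0) \<longleftrightarrow> (\<forall>i\<in>{1..s}. y i \<noteq> 0)" using assms by simp
  have **: "(\<Prod>i=1..s. \<bar>x i\<bar>) = (\<Prod>i=1..s. \<bar>y i\<bar>)" using assms by (intro prod.cong) auto
  have ***: "(\<Sum>j=1..s. 1 / \<bar>x j\<bar> * p) = (\<Sum>j=1..s. 1 / \<bar>y j\<bar> * p)" for p
    using assms by (intro sum.cong) auto
  show ?thesis unfolding real_harmonic_mean_def * ** *** ..
qed

lemma real_harmonic_mean_scale:
  assumes c: "0 < c"
  shows "real_harmonic_mean s (\<lambda>i. c * x i) = c * real_harmonic_mean s x"
proof (cases "\<forall>i\<in>{1..s}. x i \<noteq> 0")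
  case True
  have "(\<Sum>j=1..s. 1 / \<bar>c * x j\<bar>) = (1 / c) * (\<Sum>j=1..s. 1 / \<bar>x j\<bar>)"
    unfolding sum_distrib_left using c by (intro sum.cong) (auto simp: abs_mult)
  then show ?thesis
    using True c by (subst (1 2) real_harmonic_mean_eq_divide) auto
next
  case False
  then obtain i where "i \<in> {1..s}" "x i = 0" by blast
  then show ?thesis by (simp add: real_harmonic_mean_zero)
qed

text \<open>One reciprocal is at most the sum of all. The upper bound gives continuity where a
  coordinate vanishes and later keeps the harmonic mean divided by \<open>s\<close> below the
  unit.\<close>

lemma real_harmonic_mean_bounds:
  assumes x: "\<And>i. i \<in> {1..s} \<Longrightarrow> 0 \<le> x i" and i: "i \<in> {1..s}"
  shows "0 \<le> real_harmonic_mean s x" "real_harmonic_mean s x \<le> real s * x i"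
proof -
  show "0 \<le> real_harmonic_mean s x"
    by (simp add: real_harmonic_mean_def prod_nonneg sum_nonneg)
  show "real_harmonic_mean s x \<le> real s * x i"
  proof (cases "\<forall>i\<in>{1..s}. x i \<noteq> 0")
    case True
    then have xi: "0 < x i" using x[OF i] i by fastforce
    have "1 / x i = (\<Sum>j\<in>{i}. 1 / \<bar>x j\<bar>)" using xi by simp
    also have "\<dots> \<le> (\<Sum>j=1..s. 1 / \<bar>x j\<bar>)" using i by (intro sum_mono2) auto
    finally have le: "1 / x i \<le> (\<Sum>j=1..s. 1 / \<bar>x j\<bar>)" .
    have "real s / (\<Sum>j=1..s. 1 / \<bar>x j\<bar>) \<le> real s / (1 / x i)"
    proof (intro divide_left_mono mult_pos_pos le)
      show "0 < (\<Sum>j=1..s. 1 / \<bar>x j\<bar>)" by (rule less_le_trans[OF _ le]) (simp add: xi)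
    qed (use xi in auto)
    then show ?thesis using True by (subst real_harmonic_mean_eq_divide) auto
  next
    case False
    then obtain j where "j \<in> {1..s}" "x j = 0" by blast
    then show ?thesis using x[OF i] by (simp add: real_harmonic_mean_zero)
  qed
qed

text \<open>The delicate points are those with a zero coordinate \<open>x i\<close>, where the
  formula changes; there the mean is squeezed between \<open>0\<close> and
  \<open>real s * y i\<close>. Elsewhere the explicit quotient applies at all nearby points.\<close>

lemma continuous_on_real_harmonic_mean:
  "continuous_on {x. \<forall>i\<in>{1..s}. 0 \<le> x i} (real_harmonic_mean s)" (is "continuous_on ?S _")
  unfolding continuous_on_def
proof
  fix x assume x: "x \<in> ?S"
  have coord: "((\<lambda>y. y i) \<longlongrightarrow> x i) (at x within ?S)" for i
    by (rule tendsto_within_subset[of _ _ _ UNIV])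
      (use continuous_on_product_coordinates[of i] in \<open>auto simp: continuous_on_def\<close>)
  show "(real_harmonic_mean s \<longlongrightarrow> real_harmonic_mean s x) (at x within ?S)"
  proof (cases "\<forall>i\<in>{1..s}. x i \<noteq> 0")
    case True
    have "((\<lambda>y. real s * (\<Prod>i=1..s. \<bar>y i\<bar>) / (\<Sum>j=1..s. 1 / \<bar>y j\<bar> * (\<Prod>i=1..s. \<bar>y i\<bar>)))
        \<longlongrightarrow> real s * (\<Prod>i=1..s. \<bar>x i\<bar>) / (\<Sum>j=1..s. 1 / \<bar>x j\<bar> * (\<Prod>i=1..s. \<bar>x i\<bar>))) (at x within ?S)"
    \<comment> \<open>For \<open>s = 0\<close> the denominator is an empty sum, but the quotient is
      constant.\<close>
    proof (cases "s = 0")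
      case False
      then have "0 < (\<Sum>j=1..s. 1 / \<bar>x j\<bar> * (\<Prod>i=1..s. \<bar>x i\<bar>))"
        using True by (intro sum_pos mult_pos_pos prod_pos) auto
      then show ?thesis using True by (intro tendsto_intros coord) auto
    qed simp
    moreover have "\<forall>\<^sub>F y in at x within ?S. \<forall>i\<in>{1..s}. y i \<noteq> 0"
      using True by (intro eventually_ball_finite ballI tendsto_imp_eventually_ne[OF coord]) auto
    then have "\<forall>\<^sub>F y in at x within ?S.
        real s * (\<Prod>i=1..s. \<bar>y i\<bar>) / (\<Sum>j=1..s. 1 / \<bar>y j\<bar> * (\<Prod>i=1..s. \<bar>y i\<bar>)) = real_harmonic_mean s y"
      by eventually_elim (simp add: real_harmonic_mean_def)
    ultimately show ?thesis
      using True by (simp add: real_harmonic_mean_def[of s x] tendsto_cong)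
  next
    case False
    then obtain i where i: "i \<in> {1..s}" "x i = 0" by blast
    have "\<forall>\<^sub>F y in at x within ?S. y \<in> ?S" by (auto simp: eventually_at_filter)
    then have "\<forall>\<^sub>F y in at x within ?S. 0 \<le> real_harmonic_mean s y"
      "\<forall>\<^sub>F y in at x within ?S. real_harmonic_mean s y \<le> real s * y i"
      by (eventually_elim, use real_harmonic_mean_bounds i(1) in blast)+
    moreover have "((\<lambda>y. real s * y i) \<longlongrightarrow> real s * 0) (at x within ?S)"
      using coord[of i] i(2) by (intro tendsto_mult_left) simp
    ultimately have "(real_harmonic_mean s \<longlongrightarrow> 0) (at x within ?S)"
      by (intro tendsto_sandwich[of "\<lambda>_. 0" "real_harmonic_mean s" _ "\<lambda>y. real s * y i"]) auto
    then show ?thesis using i by (simp add: real_harmonic_mean_zero)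
  qed
qed

section \<open>Functional calculus in the lattice\<close>

lemma vector_sublattice_hull: "vector_sublattice (vector_sublattice hull A)"
proof (rule hull_in)
  fix T :: "'a set set" assume "\<forall>C\<in>T. vector_sublattice C"
  then show "vector_sublattice (\<Inter>T)"
    unfolding vector_sublattice_def by (auto intro: subspace_Inter)
qed

lemma real_lattice_hom_on_subset:
  "real_lattice_hom_on C \<omega> \<Longrightarrow> D \<subseteq> C \<Longrightarrow> real_lattice_hom_on D \<omega>"
  unfolding real_lattice_hom_on_def by blast

text \<open>The two candidates are tested on different generated sublattices. Both lie in the
  principal ideal of \<open>v\<close>, whose unital homomorphisms restrict to each and separate
  points.\<close>

lemma is_functional_calculus_value_unique:
  fixes f :: "nat \<Rightarrow> 'a::archimedean_vector_lattice"
  assumes g: "is_functional_calculus_value s \<phi> f g" and h: "is_functional_calculus_value s \<phi> f h"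
  shows "g = h"
proof -
  define v where "v = \<bar>g\<bar> + \<bar>h\<bar> + (\<Sum>i=1..s. \<bar>f i\<bar>)"
  have v: "0 \<le> v" by (simp add: v_def add_nonneg_nonneg sum_nonneg)
  have g': "g \<in> principal_ideal v" and h': "h \<in> principal_ideal v"
    by (rule principal_idealI[of _ 1]; simp add: v_def add_increasing add_increasing2 sum_nonneg)+
  have f': "f i \<in> principal_ideal v" if "i \<in> {1..s}" for i
  proof -
    have "\<bar>f i\<bar> \<le> (\<Sum>i=1..s. \<bar>f i\<bar>)" using that by (intro nonneg_le_sum[where f = "\<lambda>i. \<bar>f i\<bar>"]) auto
    then show ?thesis by (intro principal_idealI[of _ 1]) (simp add: v_def add_increasing add_nonneg_nonneg)
  qed
  have sub: "vector_sublattice hull (insert y (f ` {1..s})) \<subseteq> principal_ideal v"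
    if "y \<in> principal_ideal v" for y
    by (rule hull_minimal) (use that f' vector_sublattice_principal_ideal[OF v] in auto)
  show ?thesis
  proof (rule unital_homs_eq[OF v g' h'])
    fix \<omega> assume w: "\<omega> \<in> unital_homs v"
    show "\<omega> g = \<omega> h"
      using g h real_lattice_hom_on_subset[OF unital_hom_on[OF w] sub[OF g']]
        real_lattice_hom_on_subset[OF unital_hom_on[OF w] sub[OF h']]
      unfolding is_functional_calculus_value_def by metis
  qed
qed

lemma functional_calculus_eqI:
  "is_functional_calculus_value s \<phi> f g \<Longrightarrow> functional_calculus s \<phi> f = g"
  unfolding functional_calculus_def by (blast intro: is_functional_calculus_value_unique)

text \<open>The definition tests \<open>z\<close> against every homomorphism of the generated
  sublattice \<open>C\<close>, whereas \<open>zw\<close> covers the unital ones on the ideal. If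
  \<open>\<omega> u = 0\<close>, both sides vanish. Otherwise \<open>\<omega>\<close> is divided by
  \<open>\<omega> u\<close> and extended to the ideal, and positive homogeneity of the mean restores
  the factor.\<close>

lemma is_harmonic_meanI:
  fixes f :: "nat \<Rightarrow> 'a::archimedean_vector_lattice"
  assumes s: "1 \<le> s" and f: "\<And>i. i \<in> {1..s} \<Longrightarrow> 0 \<le> f i"
    and u: "u = (\<Sum>i=1..s. f i)" and z: "z \<in> principal_ideal u"
    and zw: "\<And>\<omega>. \<omega> \<in> unital_homs u \<Longrightarrow> \<omega> z = real_harmonic_mean s (\<lambda>i. \<omega> (f i))"
  shows "is_functional_calculus_value s (real_harmonic_mean s) f z"
  unfolding is_functional_calculus_value_def
proof (intro allI impI)
  define C where "C = vector_sublattice hull (insert z (f ` {1..s}))"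
  fix \<omega> assume "real_lattice_hom_on (vector_sublattice hull (insert z (f ` {1..s}))) \<omega>"
  then have w: "real_lattice_hom_on C \<omega>" by (simp add: C_def)
  have C: "vector_sublattice C" unfolding C_def by (rule vector_sublattice_hull)
  have fC: "f i \<in> C" if "i \<in> {1..s}" for i using that unfolding C_def by (intro hull_inc) auto
  have zC: "z \<in> C" unfolding C_def by (intro hull_inc) auto
  have uC: "u \<in> C" unfolding u by (intro vector_sublatticeD(10)[OF C] fC)
  have u0: "0 \<le> u" unfolding u by (intro sum_nonneg f)
  have fu: "f i \<le> u" if "i \<in> {1..s}" for i unfolding u using that f by (intro nonneg_le_sum) auto
  have CI: "C \<subseteq> principal_ideal u"
    unfolding C_def
    by (rule hull_minimal)
      (use z f fu vector_sublattice_principal_ideal[OF u0] in \<open>auto intro: principal_ideal_interval\<close>)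
  note ws = real_lattice_homD[OF C w]
  have wu0: "0 \<le> \<omega> u" using ws(10)[OF vector_sublatticeD(1)[OF C] uC u0] ws(1) by simp
  show "\<omega> z = real_harmonic_mean s (\<lambda>i. \<omega> (f i))"
  proof (cases "\<omega> u = 0")
    case True
    obtain c where c: "0 < c" "\<bar>z\<bar> \<le> c *\<^sub>R u" using principal_idealE[OF z u0] .
    have "\<bar>\<omega> z\<bar> \<le> c * \<omega> u"
      using ws(10)[OF vector_sublatticeD(8)[OF C zC] vector_sublatticeD(4)[OF C uC] c(2)]
        ws(8)[OF zC] ws(4)[OF uC] by simp
    moreover have "\<omega> (f 1) = 0"
      using ws(10)[OF fC uC fu, of 1] ws(10)[OF vector_sublatticeD(1)[OF C] fC f, of 1] ws(1) s True by simp
    ultimately show ?thesis using True s real_harmonic_mean_zero[of 1 s "\<lambda>i. \<omega> (f i)"] by simp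
  next
    case False
    with wu0 have pos: "0 < \<omega> u" by simp
    define \<omega>1 where "\<omega>1 x = \<omega> x / \<omega> u" for x
    have "real_lattice_hom_on C \<omega>1"
      unfolding real_lattice_hom_on_def \<omega>1_def sup_real_def inf_real_def using pos
      by (auto simp: ws(2,4,6,7) add_divide_distrib max_def min_def divide_right_mono divide_le_cancel)
    moreover have "\<omega>1 u = 1" using False by (simp add: \<omega>1_def)
    ultimately obtain \<omega>2 where w2: "\<omega>2 \<in> unital_homs u" "\<And>x. x \<in> C \<Longrightarrow> \<omega>2 x = \<omega>1 x"
      using real_lattice_hom_extend[OF C uC u0 CI] by blast
    have eq: "\<omega> x = \<omega> u * \<omega>2 x" if "x \<in> C" for x using w2(2)[OF that] False by (simp add: \<omega>1_def)
    have "\<omega> z = \<omega> u * real_harmonic_mean s (\<lambda>i. \<omega>2 (f i))"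
      using eq[OF zC] zw[OF w2(1)] by simp
    also have "\<dots> = real_harmonic_mean s (\<lambda>i. \<omega> u * \<omega>2 (f i))"
      by (rule real_harmonic_mean_scale[OF pos, symmetric])
    also have "\<dots> = real_harmonic_mean s (\<lambda>i. \<omega> (f i))"
      by (rule real_harmonic_mean_cong) (use eq fC in auto)
    finally show ?thesis .
  qed
qed

text \<open>Stone--Weierstrass on the cube produces an element with the right values, and uniqueness
  identifies it with the definite description. From here on the harmonic mean is accessed through
  unital homomorphisms.\<close>

lemma harmonic_mean_hom:
  fixes f :: "nat \<Rightarrow> 'a::archimedean_vector_lattice"
  assumes uc: "uniformly_complete TYPE('a)" and s: "1 \<le> s"
    and f: "\<And>i. i \<in> {1..s} \<Longrightarrow> 0 \<le> f i" and u: "u = (\<Sum>i=1..s. f i)"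
  shows "harmonic_mean s f \<in> principal_ideal u"
    and "\<omega> \<in> unital_homs u \<Longrightarrow> \<omega> (harmonic_mean s f) = real_harmonic_mean s (\<lambda>i. \<omega> (f i))"
proof -
  have u0: "0 \<le> u" unfolding u by (intro sum_nonneg f)
  have fu: "f i \<le> u" if "i \<in> {1..s}" for i unfolding u using that f by (intro nonneg_le_sum) auto
  have "continuous_on (PiE {1..s} (\<lambda>_. {0..1})) (real_harmonic_mean s)"
    by (rule continuous_on_subset[OF continuous_on_real_harmonic_mean]) (force simp: PiE_iff)
  then have "representable u (\<lambda>\<omega>. real_harmonic_mean s (restrict (\<lambda>i. \<omega> (f i)) {1..s}))"
    by (intro representable_continuous[OF uc u0] conjI f fu)
  moreover have "real_harmonic_mean s (restrict (\<lambda>i. \<omega> (f i)) {1..s}) = real_harmonic_mean s (\<lambda>i. \<omega> (f i))" for \<omega>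
    by (rule real_harmonic_mean_cong) simp
  ultimately obtain z where z: "z \<in> principal_ideal u"
    "\<And>\<omega>. \<omega> \<in> unital_homs u \<Longrightarrow> \<omega> z = real_harmonic_mean s (\<lambda>i. \<omega> (f i))"
    by (auto simp: representable_def)
  have "harmonic_mean s f = z"
    unfolding harmonic_mean_def by (rule functional_calculus_eqI, rule is_harmonic_meanI) (use s f u z in auto)
  with z show "harmonic_mean s f \<in> principal_ideal u"
    "\<omega> \<in> unital_homs u \<Longrightarrow> \<omega> (harmonic_mean s f) = real_harmonic_mean s (\<lambda>i. \<omega> (f i))" by simp_all
qed

lemma harmonic_mean_disjoint:
  fixes f :: "nat \<Rightarrow> 'a::archimedean_vector_lattice"
  assumes uc: "uniformly_complete TYPE('a)" and f: "\<And>i. i \<in> {1..s} \<Longrightarrow> 0 \<le> f i"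
    and ij: "i \<in> {1..s}" "j \<in> {1..s}" "inf (f i) (f j) = 0"
  shows "harmonic_mean s f = 0"
proof -
  define u where "u = (\<Sum>i=1..s. f i)"
  have s: "1 \<le> s" using ij by simp
  have u0: "0 \<le> u" unfolding u_def by (intro sum_nonneg f)
  have fI: "f i \<in> principal_ideal u" if "i \<in> {1..s}" for i
    using that f by (intro principal_ideal_interval) (auto simp: u_def intro!: nonneg_le_sum)
  show ?thesis
  proof (rule unital_homs_eq[OF u0 harmonic_mean_hom(1)[OF uc s f u_def] principal_ideal_closed(1)[OF u0]])
    fix \<omega> assume w: "\<omega> \<in> unital_homs u"
    have "min (\<omega> (f i)) (\<omega> (f j)) = 0"
      using unital_hom(7)[OF u0 w fI fI, of i j] ij unital_hom(1)[OF u0 w] by simp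
    then have "\<omega> (f i) = 0 \<or> \<omega> (f j) = 0" by (auto simp: min_def split: if_splits)
    then show "\<omega> (harmonic_mean s f) = \<omega> 0"
      using ij(1,2) harmonic_mean_hom(2)[OF uc s f u_def w] unital_hom(1)[OF u0 w]
        real_harmonic_mean_zero[of i s "\<lambda>i. \<omega> (f i)"] real_harmonic_mean_zero[of j s "\<lambda>i. \<omega> (f i)"]
      by auto
  qed
qed

section \<open>Symmetric multilinear maps\<close>

text \<open>The subsets of \<open>M\<close> pair off as \<open>S\<close> and
  \<open>insert b S\<close> with opposite terms. In the applications the sign
  \<open>(- 1) ^ card S\<close> flips while the other factor is insensitive to
  \<open>b\<close>.\<close>

lemma sum_Pow_toggle:
  fixes g :: "'i set \<Rightarrow> 'b::real_vector"
  assumes M: "finite M" "b \<in> M" and g: "\<And>S. S \<subseteq> M \<Longrightarrow> b \<notin> S \<Longrightarrow> g (insert b S) = - g S"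
  shows "(\<Sum>S\<in>Pow M. g S) = 0"
proof -
  define C where "C = M - {b}"
  have C: "finite C" "b \<notin> C" "M = insert b C" using M by (auto simp: C_def)
  have inj: "inj_on (insert b) (Pow C)" using C(2) by (auto simp: inj_on_def)
  have "(\<Sum>S\<in>Pow M. g S) = (\<Sum>S\<in>Pow C. g S) + (\<Sum>S\<in>insert b ` Pow C. g S)"
    unfolding C(3) Pow_insert using C by (intro sum.union_disjoint) auto
  also have "(\<Sum>S\<in>insert b ` Pow C. g S) = (\<Sum>S\<in>Pow C. g (insert b S))"
    using inj by (simp add: sum.reindex)
  also have "\<dots> = (\<Sum>S\<in>Pow C. - g S)" using C g by (intro sum.cong) auto
  finally show ?thesis by (simp add: sum_negf)
qed

lemma symmetric_multilinearD:
  assumes T: "symmetric_multilinear s T"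
  shows "(\<And>i. i \<in> {1..s} \<Longrightarrow> f i = g i) \<Longrightarrow> T f = T g"
    and "i \<in> {1..s} \<Longrightarrow> T (f(i := x + y)) = T (f(i := x)) + T (f(i := y))"
    and "i \<in> {1..s} \<Longrightarrow> T (f(i := x - y)) = T (f(i := x)) - T (f(i := y))"
    and "i \<in> {1..s} \<Longrightarrow> T (f(i := c *\<^sub>R x)) = c *\<^sub>R T (f(i := x))"
    and "i \<in> {1..s} \<Longrightarrow> T (f(i := 0)) = 0"
    and "i \<in> {1..s} \<Longrightarrow> T (f(i := (\<Sum>k\<in>K. h k))) = (\<Sum>k\<in>K. T (f(i := h k)))"
    and "\<pi> permutes {1..s} \<Longrightarrow> T (f \<circ> \<pi>) = T f"
proof -
  show "(\<And>i. i \<in> {1..s} \<Longrightarrow> f i = g i) \<Longrightarrow> T f = T g"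
    using T unfolding symmetric_multilinear_def by blast
  show "\<pi> permutes {1..s} \<Longrightarrow> T (f \<circ> \<pi>) = T f"
    using T unfolding symmetric_multilinear_def by blast
  have lin: "linear (\<lambda>x. T (f(i := x)))" if "i \<in> {1..s}"
    using T that unfolding symmetric_multilinear_def by blast
  show "i \<in> {1..s} \<Longrightarrow> T (f(i := x + y)) = T (f(i := x)) + T (f(i := y))"
    using linear_add[OF lin] .
  show "i \<in> {1..s} \<Longrightarrow> T (f(i := x - y)) = T (f(i := x)) - T (f(i := y))"
    using linear_diff[OF lin] .
  show "i \<in> {1..s} \<Longrightarrow> T (f(i := c *\<^sub>R x)) = c *\<^sub>R T (f(i := x))"
    using linear_scale[OF lin] .
  show "i \<in> {1..s} \<Longrightarrow> T (f(i := 0)) = 0"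
    using linear_0[OF lin] .
  show "i \<in> {1..s} \<Longrightarrow> T (f(i := (\<Sum>k\<in>K. h k))) = (\<Sum>k\<in>K. T (f(i := h k)))"
    using linear_sum[OF lin] .
qed

text \<open>Here \<open>c\<close> chooses one summand for each expanded slot. The background
  \<open>h\<close> stays arbitrary in the induction, because the slot just expanded is absorbed into
  it.\<close>

lemma symmetric_multilinear_expand:
  assumes T: "symmetric_multilinear s T" and J: "J \<subseteq> {1..s}" and S: "finite S"
  shows "T (\<lambda>i. if i \<in> J then \<Sum>k\<in>S. g k else h i)
    = (\<Sum>c\<in>PiE J (\<lambda>_. S). T (\<lambda>i. if i \<in> J then g (c i) else h i))"
proof -
  have "finite J" using J finite_subset by blast
  then show ?thesis using J
  proof (induction J arbitrary: h)
    case empty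
    then show ?case by simp
  next
    case (insert j J)
    let ?G = "\<Sum>k\<in>S. g k"
    have j: "j \<in> {1..s}" using insert by auto
    have "T (\<lambda>i. if i \<in> insert j J then ?G else h i) = T ((\<lambda>i. if i \<in> J then ?G else h i)(j := ?G))"
      by (rule arg_cong[of _ _ T]) auto
    also have "\<dots> = (\<Sum>k\<in>S. T ((\<lambda>i. if i \<in> J then ?G else h i)(j := g k)))"
      by (rule symmetric_multilinearD(6)[OF T j])
    also have "\<dots> = (\<Sum>k\<in>S. T (\<lambda>i. if i \<in> J then ?G else (h(j := g k)) i))"
      using insert.hyps by (intro sum.cong refl arg_cong[of _ _ T]) auto
    also have "\<dots> = (\<Sum>k\<in>S. \<Sum>c\<in>PiE J (\<lambda>_. S). T (\<lambda>i. if i \<in> J then g (c i) else (h(j := g k)) i))"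
      using insert by simp
    also have "\<dots> = (\<Sum>(k, c)\<in>S \<times> PiE J (\<lambda>_. S).
        T (\<lambda>i. if i \<in> insert j J then g ((c(j := k)) i) else h i))"
    proof -
      have "(\<lambda>i. if i \<in> J then g (c i) else (h(j := g k)) i)
          = (\<lambda>i. if i \<in> insert j J then g ((c(j := k)) i) else h i)" for k c
        using insert.hyps by auto
      then show ?thesis by (simp only: sum.cartesian_product)
    qed
    also have "\<dots> = (\<Sum>c\<in>PiE (insert j J) (\<lambda>_. S). T (\<lambda>i. if i \<in> insert j J then g (c i) else h i))"
      unfolding PiE_insert_eq
      using inj_combinator[OF insert.hyps(2), of "\<lambda>_. S"]
      by (subst sum.reindex) (auto simp: case_prod_unfold intro!: sum.cong arg_cong[of _ _ T])
    finally show ?case .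
  qed
qed

text \<open>After expansion, the term of a choice \<open>c\<close> carries the alternating sum over
  all \<open>S\<close> containing its range. This cancels by toggling an index outside the range, so
  the permutations survive, each contributing \<open>T f\<close> by symmetry. Hence \<open>N\<close>
  is \<open>s!\<close> up to sign.\<close>

lemma polarization:
  assumes T: "symmetric_multilinear s T"
  obtains N :: real where "N \<noteq> 0"
    "\<And>f. (\<Sum>S\<in>Pow {1..s}. (- 1) ^ card S *\<^sub>R T (\<lambda>_. \<Sum>i\<in>S. f i)) = N *\<^sub>R T f"
proof -
  define A where "A = {1..s}"
  have A: "finite A" by (simp add: A_def)
  define E where "E = {c \<in> PiE A (\<lambda>_. A). c ` A = A}"
  define N :: real where "N = (- 1) ^ card A * real (card E)"
  have "restrict id A \<in> E" by (auto simp: E_def)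
  moreover have finE: "finite (PiE A (\<lambda>_. A))" using A by (intro finite_PiE) auto
  then have "finite E" by (simp add: E_def)
  ultimately have "N \<noteq> 0" by (auto simp: N_def)
  moreover have "(\<Sum>S\<in>Pow {1..s}. (- 1) ^ card S *\<^sub>R T (\<lambda>_. \<Sum>i\<in>S. f i)) = N *\<^sub>R T f" for f
  proof -
    have ex: "T (\<lambda>_. \<Sum>i\<in>S. f i) = (\<Sum>c\<in>PiE A (\<lambda>_. A). if c ` A \<subseteq> S then T (\<lambda>i. f (c i)) else 0)"
      if S: "S \<in> Pow A" for S
    proof -
      have "T (\<lambda>_. \<Sum>i\<in>S. f i) = T (\<lambda>i. if i \<in> A then \<Sum>i\<in>S. f i else 0)"
        by (rule symmetric_multilinearD(1)[OF T]) (simp add: A_def)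
      also have "\<dots> = (\<Sum>c\<in>PiE A (\<lambda>_. S). T (\<lambda>i. if i \<in> A then f (c i) else 0))"
        using S A by (intro symmetric_multilinear_expand[OF T]) (auto simp: A_def finite_subset)
      also have "\<dots> = (\<Sum>c\<in>PiE A (\<lambda>_. S). T (\<lambda>i. f (c i)))"
        by (intro sum.cong refl symmetric_multilinearD(1)[OF T]) (simp add: A_def)
      also have "\<dots> = (\<Sum>c\<in>PiE A (\<lambda>_. A). if c ` A \<subseteq> S then T (\<lambda>i. f (c i)) else 0)"
        using S finE by (intro sum.mono_neutral_cong_left) (auto simp: PiE_iff)
      finally show ?thesis .
    qed
    have inner: "(\<Sum>S\<in>Pow A. (- 1) ^ card S *\<^sub>R (if c ` A \<subseteq> S then T (\<lambda>i. f (c i)) else 0))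
        = (if c \<in> E then (- 1) ^ card A *\<^sub>R T f else 0)" if c: "c \<in> PiE A (\<lambda>_. A)" for c
    proof (cases "c ` A = A")
      case True
      \<comment> \<open>\<open>c\<close> is \<open>undefined\<close> off \<open>A\<close>; extension
        by the identity makes it a permutation in the sense of \<open>permutes\<close>. Surjectivity
        on a finite set gives injectivity.\<close>
      define \<pi> where "\<pi> i = (if i \<in> A then c i else i)" for i
      have "bij_betw \<pi> A A"
        using True A by (intro bij_betw_imageI eq_card_imp_inj_on) (auto simp: \<pi>_def)
      then have perm: "\<pi> permutes {1..s}" 
        unfolding A_def[symmetric] by (rule bij_imp_permutes) (simp add: \<pi>_def)
      have "T (\<lambda>i. f (c i)) = T (f \<circ> \<pi>)"
        by (rule symmetric_multilinearD(1)[OF T]) (simp add: \<pi>_def A_def)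
      also have "\<dots> = T f" by (rule symmetric_multilinearD(7)[OF T perm])
      finally have Tc: "T (\<lambda>i. f (c i)) = T f" .
      have "(\<Sum>S\<in>Pow A. (- 1) ^ card S *\<^sub>R (if c ` A \<subseteq> S then T (\<lambda>i. f (c i)) else 0))
          = (\<Sum>S\<in>{A}. (- 1) ^ card S *\<^sub>R (if c ` A \<subseteq> S then T (\<lambda>i. f (c i)) else 0))"
        using A True by (intro sum.mono_neutral_right) auto
      then show ?thesis using True c Tc by (simp add: E_def)
    next
      case False
      then obtain b where b: "b \<in> A" "b \<notin> c ` A" using c by (auto simp: PiE_iff)
      have "(\<Sum>S\<in>Pow A. (- 1) ^ card S *\<^sub>R (if c ` A \<subseteq> S then T (\<lambda>i. f (c i)) else 0)) = 0"
      proof (rule sum_Pow_toggle[OF A b(1)])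
        fix S assume "S \<subseteq> A" "b \<notin> S"
        moreover have "c ` A \<subseteq> insert b S \<longleftrightarrow> c ` A \<subseteq> S" using b by blast
        ultimately show "(- 1) ^ card (insert b S) *\<^sub>R (if c ` A \<subseteq> insert b S then T (\<lambda>i. f (c i)) else 0)
            = - ((- 1) ^ card S *\<^sub>R (if c ` A \<subseteq> S then T (\<lambda>i. f (c i)) else 0))"
          using finite_subset[OF _ A, of S] by simp
      qed
      then show ?thesis using False by (simp add: E_def)
    qed
    have "(\<Sum>S\<in>Pow {1..s}. (- 1) ^ card S *\<^sub>R T (\<lambda>_. \<Sum>i\<in>S. f i))
        = (\<Sum>S\<in>Pow A. \<Sum>c\<in>PiE A (\<lambda>_. A). (- 1) ^ card S *\<^sub>R (if c ` A \<subseteq> S then T (\<lambda>i. f (c i)) else 0))"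
      unfolding A_def[symmetric] by (intro sum.cong refl) (simp add: ex scaleR_sum_right)
    also have "\<dots> = (\<Sum>c\<in>PiE A (\<lambda>_. A). if c \<in> E then (- 1) ^ card A *\<^sub>R T f else 0)"
      by (subst sum.swap) (intro sum.cong refl inner)
    also have "\<dots> = (\<Sum>c\<in>E. (- 1) ^ card A *\<^sub>R T f)"
      using finE by (intro sum.mono_neutral_cong_right) (auto simp: E_def)
    also have "\<dots> = N *\<^sub>R T f" by (simp add: N_def sum_constant_scaleR mult.commute)
    finally show ?thesis .
  qed
  ultimately show ?thesis using that by blast
qed

section \<open>Bornologies and boundedness of the multilinear form\<close>

lemma bornology_subset: "convex_bornology \<B> \<Longrightarrow> A \<in> \<B> \<Longrightarrow> A' \<subseteq> A \<Longrightarrow> A' \<in> \<B>"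
  unfolding convex_bornology_def by blast

lemma bornology_combination:
  assumes cb: "convex_bornology \<B>" and A: "A \<in> \<B>" and I: "finite I"
  shows "{\<Sum>i\<in>I. c i *\<^sub>R x i |x. \<forall>i\<in>I. x i \<in> A} \<in> \<B>"
  using I
proof induction
  case empty
  obtain Z where Z: "Z \<in> \<B>" "0 \<in> Z" using cb unfolding convex_bornology_def by (metis UNIV_I UnionE)
  have "{\<Sum>i\<in>{}. c i *\<^sub>R x i |x. \<forall>i\<in>{}. x i \<in> A} \<subseteq> Z" using Z by auto
  then show ?case by (rule bornology_subset[OF cb Z(1)])
next
  case (insert j I)
  have "(\<lambda>x. c j *\<^sub>R x) ` A \<in> \<B>" using cb A unfolding convex_bornology_def by blast
  with insert.IH have "{x + y |x y. x \<in> (\<lambda>x. c j *\<^sub>R x) ` A \<and> y \<in> {\<Sum>i\<in>I. c i *\<^sub>R x i |x. \<forall>i\<in>I. x i \<in> A}} \<in> \<B>"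
    using cb unfolding convex_bornology_def by blast
  moreover have "{\<Sum>i\<in>insert j I. c i *\<^sub>R x i |x. \<forall>i\<in>insert j I. x i \<in> A}
      \<subseteq> {x + y |x y. x \<in> (\<lambda>x. c j *\<^sub>R x) ` A \<and> y \<in> {\<Sum>i\<in>I. c i *\<^sub>R x i |x. \<forall>i\<in>I. x i \<in> A}}"
    using insert.hyps by auto
  ultimately show ?case by (rule bornology_subset[OF cb])
qed

text \<open>The balanced hull of \<open>A\<close> contains the whole line spanned by
  \<open>w\<close>, and separation forces that line to be zero. This takes the place of letting
  \<open>n\<close> tend to infinity.\<close>

lemma separated_bornology_eq_zero:
  assumes cb: "convex_bornology \<B>" and sep: "separated_bornology \<B>" and A: "A \<in> \<B>"
    and w: "\<And>n::nat. 0 < n \<Longrightarrow> real n *\<^sub>R w \<in> A"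
  shows "w = 0"
proof -
  have "span {w} \<subseteq> {c *\<^sub>R x |c x. \<bar>c\<bar> \<le> 1 \<and> x \<in> A}"
  proof
    fix y assume "y \<in> span {w}"
    then obtain r where y: "y = r *\<^sub>R w" by (auto simp: span_singleton)
    obtain n :: nat where n: "\<bar>r\<bar> < real n" using reals_Archimedean2 by blast
    then have "y = (r / real n) *\<^sub>R (real n *\<^sub>R w)" "\<bar>r / real n\<bar> \<le> 1" "0 < n"
      using y by auto
    with w show "y \<in> {c *\<^sub>R x |c x. \<bar>c\<bar> \<le> 1 \<and> x \<in> A}" by blast
  qed
  moreover have "{c *\<^sub>R x |c x. \<bar>c\<bar> \<le> 1 \<and> x \<in> A} \<in> \<B>"
    using cb A unfolding convex_bornology_def by blast
  ultimately have "span {w} \<in> \<B>" using cb unfolding convex_bornology_def by blast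
  then have "span {w} = {0}" using sep subspace_span unfolding separated_bornology_def by blast
  then show ?thesis using span_base[of w "{w}"] by auto
qed

definition bounded_on_intervals ::
    "'b::real_vector set set \<Rightarrow> nat \<Rightarrow> ((nat \<Rightarrow> 'a::archimedean_vector_lattice) \<Rightarrow> 'b) \<Rightarrow> bool" where
  "bounded_on_intervals \<B> s T \<longleftrightarrow> (\<forall>u\<ge>0. {T f |f. \<forall>i\<in>{1..s}. 0 \<le> f i \<and> f i \<le> u} \<in> \<B>)"

text \<open>Polarization writes \<open>T f\<close> as a combination, with coefficients independent
  of \<open>f\<close>, of values of \<open>P\<close> at partial sums of the \<open>f i\<close>;
  these sums lie between \<open>0\<close> and \<open>real s *\<^sub>R u\<close>.\<close>

lemma bounded_on_intervals_polynomial: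
  fixes P :: "'a::archimedean_vector_lattice \<Rightarrow> 'b::real_vector"
  assumes cb: "convex_bornology \<B>" and P: "homogeneous_polynomial_with s P T"
    and bdd: "bounded_map \<B> P"
  shows "bounded_on_intervals \<B> s T"
  unfolding bounded_on_intervals_def
proof (intro allI impI)
  fix u :: 'a assume u: "0 \<le> u"
  have T: "symmetric_multilinear s T" and PT: "\<And>f. P f = T (\<lambda>_. f)"
    using P by (auto simp: homogeneous_polynomial_with_def)
  obtain N :: real where N: "N \<noteq> 0"
    "\<And>f. (\<Sum>S\<in>Pow {1..s}. (- 1) ^ card S *\<^sub>R T (\<lambda>_. \<Sum>i\<in>S. f i)) = N *\<^sub>R T f"
    using polarization[OF T] by blast
  define D where "D = P ` {0..real s *\<^sub>R u}"
  have D: "D \<in> \<B>" unfolding D_def using bdd by (auto simp: bounded_map_def)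
  have "{T f |f. \<forall>i\<in>{1..s}. 0 \<le> f i \<and> f i \<le> u}
      \<subseteq> {\<Sum>S\<in>Pow {1..s}. ((- 1) ^ card S / N) *\<^sub>R x S |x. \<forall>S\<in>Pow {1..s}. x S \<in> D}"
  proof safe
    fix f :: "nat \<Rightarrow> 'a" assume f: "\<forall>i\<in>{1..s}. 0 \<le> f i \<and> f i \<le> u"
    have "(\<Sum>i\<in>S. f i) \<in> {0..real s *\<^sub>R u}" if "S \<subseteq> {1..s}" for S
    proof -
      have "(\<Sum>i\<in>S. f i) \<le> (\<Sum>i\<in>S. u)" using f that by (intro sum_mono) auto
      also have "\<dots> = real (card S) *\<^sub>R u" by (rule sum_constant_scaleR)
      also have "\<dots> \<le> real s *\<^sub>R u"
        using card_mono[OF _ that] u by (intro scaleR_right_mono) auto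
      finally show ?thesis using f that by (auto intro!: sum_nonneg)
    qed
    then have "\<forall>S\<in>Pow {1..s}. P (\<Sum>i\<in>S. f i) \<in> D" unfolding D_def by blast
    moreover have "T f = (1 / N) *\<^sub>R (\<Sum>S\<in>Pow {1..s}. (- 1) ^ card S *\<^sub>R P (\<Sum>i\<in>S. f i))"
      using N by (simp add: PT)
    then have "T f = (\<Sum>S\<in>Pow {1..s}. ((- 1) ^ card S / N) *\<^sub>R P (\<Sum>i\<in>S. f i))"
      by (simp add: scaleR_sum_right)
    ultimately show "\<exists>x. T f = (\<Sum>S\<in>Pow {1..s}. ((- 1) ^ card S / N) *\<^sub>R x S) \<and> (\<forall>S\<in>Pow {1..s}. x S \<in> D)"
      by (intro exI[of _ "\<lambda>S. P (\<Sum>i\<in>S. f i)"]) blast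
  qed
  moreover have "{\<Sum>S\<in>Pow {1..s}. ((- 1) ^ card S / N) *\<^sub>R x S |x. \<forall>S\<in>Pow {1..s}. x S \<in> D} \<in> \<B>"
    by (rule bornology_combination[OF cb D]) simp
  ultimately show "{T f |f. \<forall>i\<in>{1..s}. 0 \<le> f i \<and> f i \<le> u} \<in> \<B>"
    by (rule bornology_subset[OF cb, rotated])
qed

section \<open>Orthosymmetry\<close>

lemma pprt_diff_eq:
  fixes x y :: "'a::archimedean_vector_lattice"
  shows "pprt (x - y) = x - inf x y"
  by (simp add: pprt_def diff_inf_eq_sup add_sup_distrib_left sup_commute)

lemma inf_add_le:
  fixes a b c :: "'a::archimedean_vector_lattice"
  assumes "0 \<le> a" "0 \<le> b" "0 \<le> c"
  shows "inf (a + b) c \<le> inf a c + inf b c"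
proof -
  have "inf a c + inf b c = inf (inf (a + b) (a + c)) (inf (c + b) (c + c))"
    by (simp add: add_inf_distrib_left add_inf_distrib_right inf.assoc inf.left_commute)
  moreover have "inf (a + b) c \<le> a + b" "inf (a + b) c \<le> a + c" "inf (a + b) c \<le> c + b" "inf (a + b) c \<le> c + c"
    using assms by (auto intro: le_infI2 add_increasing add_increasing2)
  ultimately show ?thesis by simp
qed

lemma disjoint_mono:
  fixes a b c d :: "'a::archimedean_vector_lattice"
  assumes "inf a b = 0" "0 \<le> c" "c \<le> a" "0 \<le> d" "d \<le> b"
  shows "inf c d = 0"
  using assms inf_mono[OF assms(3,5)] by (intro antisym) auto

lemma disjoint_sum_left:
  fixes c :: "'a::archimedean_vector_lattice"
  assumes X: "finite X" and c: "0 \<le> c" and f: "\<And>i. i \<in> X \<Longrightarrow> 0 \<le> f i" "\<And>i. i \<in> X \<Longrightarrow> inf (f i) c = 0"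
  shows "inf (\<Sum>i\<in>X. f i) c = 0"
  using X f
proof induction
  case (insert i X)
  have nn: "0 \<le> f i" "0 \<le> (\<Sum>i\<in>X. f i)" using insert.prems by (auto intro: sum_nonneg)
  have "inf (f i + (\<Sum>i\<in>X. f i)) c \<le> inf (f i) c + inf (\<Sum>i\<in>X. f i) c"
    by (rule inf_add_le[OF nn c])
  also have "\<dots> = 0" using insert by simp
  finally show ?case using insert.hyps nn c by (intro antisym) (auto simp: add_nonneg_nonneg)
qed (use c in \<open>simp add: inf_absorb1\<close>)

lemma disjoint_scaleR:
  fixes x y :: "'a::archimedean_vector_lattice"
  assumes "inf x y = 0" "0 \<le> x" "0 \<le> y" "0 \<le> c"
  shows "inf x (c *\<^sub>R y) = 0"
proof -
  define d where "d = max c 1"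
  have le: "1 *\<^sub>R x \<le> d *\<^sub>R x" "c *\<^sub>R y \<le> d *\<^sub>R y"
    using assms by (intro scaleR_right_mono; simp add: d_def)+
  show ?thesis
  proof (rule disjoint_mono)
    show "inf (d *\<^sub>R x) (d *\<^sub>R y) = 0"
      using scaleR_inf[of d x y] assms by (simp add: d_def)
    show "x \<le> d *\<^sub>R x" using le(1) by simp
    show "0 \<le> c *\<^sub>R y" using assms by (intro scaleR_nonneg_nonneg)
  qed (use assms le in simp_all)
qed

text \<open>By disjointness \<open>P\<close> at a partial sum over \<open>S\<close> splits into a
  part depending on \<open>S \<inter> A\<close> and one depending on \<open>S \<inter> B\<close>. In
  the polarization sum each part ignores some index of the other block, so toggling that index
  cancels it.\<close>

lemma orthogonally_additive_vanishes_on_partition: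
  assumes P: "homogeneous_polynomial_with s P T" and oa: "orthogonally_additive P"
    and AB: "A \<inter> B = {}" "A \<union> B = {1..s}" "A \<noteq> {}" "B \<noteq> {}"
    and f: "\<And>i. i \<in> {1..s} \<Longrightarrow> 0 \<le> f i"
    and disj: "\<And>i j. i \<in> A \<Longrightarrow> j \<in> B \<Longrightarrow> inf (f i) (f j) = 0"
  shows "T f = 0"
proof -
  have T: "symmetric_multilinear s T" and PT: "\<And>f. P f = T (\<lambda>_. f)"
    using P by (auto simp: homogeneous_polynomial_with_def)
  obtain N :: real where N: "N \<noteq> 0"
    "\<And>f. (\<Sum>S\<in>Pow {1..s}. (- 1) ^ card S *\<^sub>R T (\<lambda>_. \<Sum>i\<in>S. f i)) = N *\<^sub>R T f"
    using polarization[OF T] by blast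
  have split: "P (\<Sum>i\<in>S. f i) = P (\<Sum>i\<in>S \<inter> A. f i) + P (\<Sum>i\<in>S \<inter> B. f i)" if S: "S \<in> Pow {1..s}" for S
  proof -
    have fin: "finite S" using S finite_subset by auto
    have "S = (S \<inter> A) \<union> (S \<inter> B)" using S AB by blast
    then have "(\<Sum>i\<in>S. f i) = (\<Sum>i\<in>S \<inter> A. f i) + (\<Sum>i\<in>S \<inter> B. f i)"
      using fin AB by (subst \<open>S = (S \<inter> A) \<union> (S \<inter> B)\<close>, subst sum.union_disjoint) auto
    moreover have nn: "0 \<le> (\<Sum>i\<in>S \<inter> A. f i)" "0 \<le> (\<Sum>i\<in>S \<inter> B. f i)"
      using S f by (auto intro!: sum_nonneg)
    have "inf (\<Sum>j\<in>S \<inter> B. f j) (f i) = 0" if "i \<in> A" for i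
    proof (rule disjoint_sum_left)
      show "0 \<le> f i" using that AB f by blast
      show "0 \<le> f j" if "j \<in> S \<inter> B" for j using that AB f by blast
      show "inf (f j) (f i) = 0" if "j \<in> S \<inter> B" for j
        using that disj[OF \<open>i \<in> A\<close>, of j] by (simp add: inf_commute)
    qed (simp add: fin)
    then have "inf (\<Sum>i\<in>S \<inter> A. f i) (\<Sum>i\<in>S \<inter> B. f i) = 0"
      using fin S f nn by (intro disjoint_sum_left) (auto simp: inf_commute)
    then have "inf \<bar>\<Sum>i\<in>S \<inter> A. f i\<bar> \<bar>\<Sum>i\<in>S \<inter> B. f i\<bar> = 0" using nn by simp
    ultimately show ?thesis using oa by (simp add: orthogonally_additive_def)
  qed
  have half: "(\<Sum>S\<in>Pow {1..s}. (- 1) ^ card S *\<^sub>R P (\<Sum>i\<in>S \<inter> C. f i)) = 0" if b: "b \<in> {1..s}" "b \<notin> C" for b C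
  proof (rule sum_Pow_toggle[OF _ b(1)])
    fix S assume "S \<subseteq> {1..s}" "b \<notin> S"
    moreover have "insert b S \<inter> C = S \<inter> C" using b by blast
    ultimately show "(- 1) ^ card (insert b S) *\<^sub>R P (\<Sum>i\<in>insert b S \<inter> C. f i)
        = - ((- 1) ^ card S *\<^sub>R P (\<Sum>i\<in>S \<inter> C. f i))"
      using finite_subset[of S "{1..s}"] by simp
  qed simp
  obtain a b where "a \<in> A" "b \<in> B" using AB by blast
  then have ab: "a \<in> {1..s}" "a \<notin> B" "b \<in> {1..s}" "b \<notin> A" using AB by auto
  have "N *\<^sub>R T f = (\<Sum>S\<in>Pow {1..s}. (- 1) ^ card S *\<^sub>R P (\<Sum>i\<in>S. f i))"
    using N(2)[of f] by (simp add: PT)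
  also have "\<dots> = (\<Sum>S\<in>Pow {1..s}. (- 1) ^ card S *\<^sub>R P (\<Sum>i\<in>S \<inter> A. f i))
      + (\<Sum>S\<in>Pow {1..s}. (- 1) ^ card S *\<^sub>R P (\<Sum>i\<in>S \<inter> B. f i))"
    unfolding sum.distrib[symmetric] by (intro sum.cong refl) (simp only: split scaleR_add_right)
  also have "\<dots> = 0" using half[OF ab(3,4)] half[OF ab(1,2)] by simp
  finally show ?thesis using N(1) by simp
qed

text \<open>What truncation at level \<open>1 / n\<close> removes is
  \<open>inf (f i) ((1 / real n) *\<^sub>R u)\<close>; multiplied by \<open>n\<close> it is still at
  most \<open>u\<close>. Hence \<open>n\<close> times \<open>T f\<close> is a value of
  \<open>T\<close> on the interval.\<close>

lemma vanishes_of_truncation: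
  fixes f :: "nat \<Rightarrow> 'a::archimedean_vector_lattice"
  assumes cb: "convex_bornology \<B>" and sep: "separated_bornology \<B>"
    and T: "symmetric_multilinear s T" and bdd: "bounded_on_intervals \<B> s T"
    and i: "i \<in> {1..s}" and f: "\<And>k. k \<in> {1..s} \<Longrightarrow> 0 \<le> f k \<and> f k \<le> u"
    and trunc: "\<And>d. 0 < d \<Longrightarrow> T (f(i := pprt (f i - d *\<^sub>R u))) = 0"
  shows "T f = 0"
proof -
  have u: "0 \<le> u" using f[OF i] by (meson order_trans)
  show ?thesis
  proof (rule separated_bornology_eq_zero[OF cb sep])
    show "{T f |f. \<forall>i\<in>{1..s}. 0 \<le> f i \<and> f i \<le> u} \<in> \<B>"
      using bdd u by (simp add: bounded_on_intervals_def)
    fix n :: nat assume n: "0 < n"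
    define x where "x = real n *\<^sub>R inf (f i) ((1 / real n) *\<^sub>R u)"
    have "T f = T (f(i := pprt (f i - (1 / real n) *\<^sub>R u) + inf (f i) ((1 / real n) *\<^sub>R u)))"
      by (simp only: pprt_diff_eq diff_add_cancel fun_upd_triv)
    also have "\<dots> = T (f(i := inf (f i) ((1 / real n) *\<^sub>R u)))"
      using trunc[of "1 / real n"] n by (simp add: symmetric_multilinearD(2)[OF T i])
    finally have "real n *\<^sub>R T f = T (f(i := x))"
      unfolding x_def by (simp add: symmetric_multilinearD(4)[OF T i])
    moreover have "0 \<le> x" "x \<le> u"
    proof -
      show "0 \<le> x" unfolding x_def using f[OF i] u by (intro scaleR_nonneg_nonneg) (auto intro: scaleR_nonneg_nonneg)
      have "x \<le> real n *\<^sub>R ((1 / real n) *\<^sub>R u)" unfolding x_def by (intro scaleR_left_mono) auto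
      then show "x \<le> u" using n by simp
    qed
    ultimately show "real n *\<^sub>R T f \<in> {T f |f. \<forall>i\<in>{1..s}. 0 \<le> f i \<and> f i \<le> u}"
      using f by (auto intro!: exI[of _ "f(i := x)"])
  qed
qed

text \<open>Slots are released from truncation one at a time. The levels \<open>e\<close> form a
  family, since the level at the slot being released runs through all \<open>d > 0\<close> while the
  others stay fixed.\<close>

lemma vanishes_of_truncations:
  fixes f :: "nat \<Rightarrow> 'a::archimedean_vector_lattice"
  assumes cb: "convex_bornology \<B>" and sep: "separated_bornology \<B>"
    and T: "symmetric_multilinear s T" and bdd: "bounded_on_intervals \<B> s T"
    and S: "S \<subseteq> {1..s}" and f: "\<And>k. k \<in> {1..s} \<Longrightarrow> 0 \<le> f k \<and> f k \<le> u"
    and trunc: "\<And>e. (\<And>i. 0 < e i) \<Longrightarrow> T (\<lambda>i. if i \<in> S then pprt (f i - e i *\<^sub>R u) else f i) = 0"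
  shows "T f = 0"
proof -
  have "finite S" using S finite_subset by blast
  then show ?thesis using S trunc
  proof (induction S)
    case empty
    from empty(2)[of "\<lambda>_. 1"] show ?case by simp
  next
    case (insert j S)
    show ?case
    proof (rule insert.IH)
      show "S \<subseteq> {1..s}" using insert by auto
      fix e :: "nat \<Rightarrow> real" assume e: "\<And>i. 0 < e i"
      have j: "j \<in> {1..s}" using insert by auto
      define g where "g i = (if i \<in> S then pprt (f i - e i *\<^sub>R u) else f i)" for i
      have "T g = 0"
      proof (rule vanishes_of_truncation[OF cb sep T bdd j])
        show "0 \<le> g k \<and> g k \<le> u" if k: "k \<in> {1..s}" for k
        proof (cases "k \<in> S")
          case True
          have "0 \<le> f k" "f k \<le> u" using f[OF k] by auto
          moreover have "0 \<le> e k *\<^sub>R u" using e[of k] calculation by (intro scaleR_nonneg_nonneg) (auto intro: order_trans)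
          ultimately have "pprt (f k - e k *\<^sub>R u) \<le> u"
            by (simp add: pprt_def diff_le_eq add_increasing2 order_trans[of 0 "f k" u])
          with True show ?thesis by (simp add: g_def)
        qed (use f k in \<open>auto simp: g_def\<close>)
        fix d :: real assume d: "0 < d"
        have "g(j := pprt (g j - d *\<^sub>R u))
          = (\<lambda>i. if i \<in> insert j S then pprt (f i - (e(j := d)) i *\<^sub>R u) else f i)"
          using insert.hyps by (auto simp: g_def)
        then show "T (g(j := pprt (g j - d *\<^sub>R u))) = 0"
          using insert.prems(2)[of "e(j := d)"] e d by simp
      qed
      then show "T (\<lambda>i. if i \<in> S then pprt (f i - e i *\<^sub>R u) else f i) = 0" by (simp add: g_def[abs_def])
    qed
  qed
qed

text \<open>Induction on the number of slots outside \<open>A \<union> B\<close>. Such a slot \<open>h\<close> splits into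
  \<open>h \<and> nF\<close>, which is disjoint from the slots in \<open>B\<close>, and \<open>(h - nF)\<^sup>+\<close>, which is disjoint from the
  truncations of the slots in \<open>A\<close>; here \<open>F\<close> is the sum of the slots in \<open>A\<close>.\<close>

lemma orthogonally_additive_vanishes_on_disjoint_families:
  fixes f :: "nat \<Rightarrow> 'a::archimedean_vector_lattice"
  assumes cb: "convex_bornology \<B>" and sep: "separated_bornology \<B>"
    and P: "homogeneous_polynomial_with s P T" and oa: "orthogonally_additive P"
    and bdd: "bounded_on_intervals \<B> s T"
    and "A \<subseteq> {1..s}" "B \<subseteq> {1..s}" "A \<inter> B = {}" "A \<noteq> {}" "B \<noteq> {}"
    and "\<And>i. i \<in> {1..s} \<Longrightarrow> 0 \<le> f i"
    and "\<And>i j. i \<in> A \<Longrightarrow> j \<in> B \<Longrightarrow> inf (f i) (f j) = 0"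
  shows "T f = 0"
  using assms(6-)
proof (induction "card ({1..s} - A - B)" arbitrary: A B f)
  case 0
  then have "{1..s} - A - B = {}" by simp
  with "0.prems" have "A \<union> B = {1..s}" by blast
  with "0.prems" show ?case
    by (intro orthogonally_additive_vanishes_on_partition[OF P oa, of A B f]) auto
next
  case (Suc k)
  note A = Suc.prems(1) and B = Suc.prems(2) and AB = Suc.prems(3,4,5) and f = Suc.prems(6)
    and disj = Suc.prems(7)
  have T: "symmetric_multilinear s T" using P by (simp add: homogeneous_polynomial_with_def)
  obtain l where l: "l \<in> {1..s}" "l \<notin> A" "l \<notin> B"
    using Suc(2) by (metis DiffE card_eq_0_iff equals0I nat.distinct(1))
  define u where "u = (\<Sum>i=1..s. f i)"
  have u: "0 \<le> u" unfolding u_def by (intro sum_nonneg f)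
  have fu: "f i \<le> u" if "i \<in> {1..s}" for i unfolding u_def using that f by (intro nonneg_le_sum) auto
  have finA: "finite A" using A finite_subset by blast
  show ?case
  proof (rule vanishes_of_truncations[OF cb sep T bdd A])
    show "0 \<le> f k \<and> f k \<le> u" if "k \<in> {1..s}" for k by (intro conjI f fu that)
    fix e :: "nat \<Rightarrow> real" assume e: "\<And>i. 0 < e i"
    define g where "g i = (if i \<in> A then pprt (f i - e i *\<^sub>R u) else f i)" for i
    define \<epsilon> where "\<epsilon> = Min (e ` A)"
    have \<epsilon>: "0 < \<epsilon>" "\<And>i. i \<in> A \<Longrightarrow> \<epsilon> \<le> e i" using e finA AB by (auto simp: \<epsilon>_def)
    \<comment> \<open>Chosen so large that \<open>real n * e i\<close> is at least \<open>1\<close>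
      on all of \<open>A\<close>; then \<open>f l\<close>, being at most \<open>u\<close>, is at
      most \<open>(real n * e i) *\<^sub>R u\<close>.\<close>
    obtain n :: nat where n: "1 / \<epsilon> < real n" using reals_Archimedean2 by blast
    have ne: "1 \<le> real n * e i" if "i \<in> A" for i
    proof -
      have "1 \<le> real n * \<epsilon>" using n \<epsilon>(1) by (simp add: field_simps)
      also have "\<dots> \<le> real n * e i" using \<epsilon>(2)[OF that] by (intro mult_left_mono) auto
      finally show ?thesis .
    qed
    define F where "F = (\<Sum>i\<in>A. f i)"
    have F: "0 \<le> F" unfolding F_def using A f by (intro sum_nonneg) auto
    have nF: "0 \<le> real n *\<^sub>R F" using F by (intro scaleR_nonneg_nonneg) auto
    define h1 where "h1 = inf (f l) (real n *\<^sub>R F)"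
    define h2 where "h2 = pprt (f l - real n *\<^sub>R F)"
    have h: "0 \<le> h1" "0 \<le> h2" "f l = h1 + h2"
    proof -
      show "0 \<le> h1" "0 \<le> h2" using f[OF l(1)] nF by (simp_all add: h1_def h2_def)
      show "f l = h1 + h2"
        unfolding add.commute[of h1 h2] by (simp only: h1_def h2_def pprt_diff_eq diff_add_cancel)
    qed
    have gf: "0 \<le> g i" "g i \<le> f i" if "i \<in> {1..s}" for i
    proof -
      show "0 \<le> g i" using f[OF that] by (simp add: g_def)
      have "0 \<le> e i *\<^sub>R u" using e[of i] u by (intro scaleR_nonneg_nonneg) auto
      then show "g i \<le> f i" using f[OF that] by (simp add: g_def pprt_def)
    qed
    have gdisj: "inf (g i) (g j) = 0" if "i \<in> A" "j \<in> B" for i j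
      by (rule disjoint_mono[OF disj[OF that] gf(1) gf(2) gf(1) gf(2)]) (use that A B in blast)+
    have cards: "k = card ({1..s} - insert l A - B)" "k = card ({1..s} - A - insert l B)"
    proof -
      have "{1..s} - insert l A - B = ({1..s} - A - B) - {l}" "{1..s} - A - insert l B = ({1..s} - A - B) - {l}"
        by auto
      then show "k = card ({1..s} - insert l A - B)" "k = card ({1..s} - A - insert l B)"
        using Suc(2) l by (simp_all add: card_Diff_singleton)
    qed
    have T1: "T (g(l := h1)) = 0"
    proof (rule Suc.hyps(1)[OF cards(1)])
      fix i j assume ij: "i \<in> insert l A" "j \<in> B"
      have "j \<noteq> l" using ij l by auto
      show "inf ((g(l := h1)) i) ((g(l := h1)) j) = 0"
      proof (cases "i = l")
        case True
        have fj: "0 \<le> f j" using ij B f by auto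
        have "inf F (f j) = 0" unfolding F_def
          using finA fj f A disj[OF _ ij(2)] by (intro disjoint_sum_left) auto
        then have "inf (f j) (real n *\<^sub>R F) = 0"
          using fj F by (intro disjoint_scaleR) (auto simp: inf_commute)
        then have "inf (real n *\<^sub>R F) (f j) = 0" by (simp add: inf_commute)
        moreover have "j \<in> {1..s}" using ij B by blast
        moreover have "h1 \<le> real n *\<^sub>R F" by (simp add: h1_def)
        ultimately have "inf h1 (g j) = 0" by (intro disjoint_mono[OF _ h(1) _ gf(1) gf(2)])
        then show ?thesis using True \<open>j \<noteq> l\<close> by simp
      qed (use ij gdisj \<open>j \<noteq> l\<close> in auto)
    qed (use A B AB l gf h in auto)
    have T2: "T (g(l := h2)) = 0"
    proof (rule Suc.hyps(1)[OF cards(2)])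
      fix i j assume ij: "i \<in> A" "j \<in> insert l B"
      have "i \<noteq> l" using ij l by auto
      show "inf ((g(l := h2)) i) ((g(l := h2)) j) = 0"
      proof (cases "j = l")
        case True
        define a where "a = f i - e i *\<^sub>R u"
        \<comment> \<open>Pointwise: where the truncation of \<open>f i\<close> is positive,
          \<open>f i\<close> exceeds \<open>e i\<close> times \<open>u\<close>, so \<open>n\<close>
          times \<open>F\<close> exceeds \<open>u\<close> and with it \<open>f l\<close>, and
          \<open>h2\<close> vanishes. Formally, \<open>h2\<close> is at most \<open>n\<close> times
          the negative part of \<open>a\<close>.\<close>
        have "f i \<le> F" unfolding F_def using ij A f finA by (intro nonneg_le_sum) auto
        then have "real n *\<^sub>R f i \<le> real n *\<^sub>R F" by (intro scaleR_left_mono) auto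
        moreover have "1 *\<^sub>R u \<le> (real n * e i) *\<^sub>R u" using ne[OF ij(1)] u by (intro scaleR_right_mono)
        then have "f l \<le> (real n * e i) *\<^sub>R u" using fu[OF l(1)] by simp
        ultimately have "f l + real n *\<^sub>R f i \<le> (real n * e i) *\<^sub>R u + real n *\<^sub>R F" by (rule add_mono[rotated])
        then have "f l - real n *\<^sub>R F \<le> real n *\<^sub>R (- a)"
          by (simp add: a_def scaleR_diff_right algebra_simps)
        then have "h2 \<le> pprt (real n *\<^sub>R (- a))" unfolding h2_def by (rule pprt_mono)
        then have "h2 \<le> real n *\<^sub>R pprt (- a)" by (simp only: pprt_scaleR of_nat_0_le_iff)
        moreover have "inf (pprt a) (real n *\<^sub>R pprt (- a)) = 0"
          by (rule disjoint_scaleR[OF inf_pprt_pprt_minus]) auto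
        ultimately have "inf (pprt a) h2 = 0"
          by (intro disjoint_mono[OF _ zero_le_pprt order_refl h(2)])
        then show ?thesis using True \<open>i \<noteq> l\<close> ij by (simp add: g_def a_def)
      qed (use ij gdisj \<open>i \<noteq> l\<close> in auto)
    qed (use A B AB l gf h in auto)
    have "g = g(l := h1 + h2)" using h(3) l by (auto simp: g_def)
    then have "T g = T (g(l := h1)) + T (g(l := h2))"
      using symmetric_multilinearD(2)[OF T l(1), of g h1 h2] by simp
    then show "T (\<lambda>i. if i \<in> A then pprt (f i - e i *\<^sub>R u) else f i) = 0"
      using T1 T2 by (simp add: g_def[abs_def])
  qed
qed

text \<open>Restricted to nonnegative tuples, where the harmonic mean identity is available; general
  signs are reached in \<open>orthosymmetric_vanishes\<close>.\<close>

definition orthosymmetric :: "nat \<Rightarrow> ((nat \<Rightarrow> 'a::archimedean_vector_lattice) \<Rightarrow> 'b::real_vector) \<Rightarrow> bool" where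
  "orthosymmetric s T \<longleftrightarrow> (\<forall>f. \<forall>i\<in>{1..s}. \<forall>j\<in>{1..s}.
     (\<forall>k\<in>{1..s}. 0 \<le> f k) \<longrightarrow> i \<noteq> j \<longrightarrow> inf (f i) (f j) = 0 \<longrightarrow> T f = 0)"

lemma orthogonally_additive_imp_orthosymmetric:
  fixes T :: "(nat \<Rightarrow> 'a::archimedean_vector_lattice) \<Rightarrow> 'b::real_vector"
  assumes "convex_bornology \<B>" "separated_bornology \<B>" "homogeneous_polynomial_with s P T"
    and "orthogonally_additive P" "bounded_on_intervals \<B> s T"
  shows "orthosymmetric s T"
  unfolding orthosymmetric_def
proof (intro allI ballI impI)
  fix f :: "nat \<Rightarrow> 'a" and i j assume "i \<in> {1..s}" "j \<in> {1..s}" "\<forall>k\<in>{1..s}. 0 \<le> f k" "i \<noteq> j" "inf (f i) (f j) = 0"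
  then show "T f = 0"
    by (intro orthogonally_additive_vanishes_on_disjoint_families[OF assms, of "{i}" "{j}"]) auto
qed

section \<open>Reduction to products\<close>

text \<open>A layer has thickness at most \<open>1 / n\<close> in units of \<open>u\<close> and
  lives where \<open>a\<close> exceeds \<open>k / n\<close>: the former controls the quadratic
  errors, the latter supplies disjointness.\<close>

lemma layer_bounds:
  assumes u: "0 \<le> u" and n: "0 < n"
  shows "0 \<le> layer n u a k" "real n *\<^sub>R layer n u a k \<le> u"
    "layer n u a k \<le> pprt (a - (real k / real n) *\<^sub>R u)"
proof -
  define c where "c = (real k / real n) *\<^sub>R u"
  define d where "d = (1 / real n) *\<^sub>R u"
  have d: "0 \<le> d" unfolding d_def using u by (intro scaleR_nonneg_nonneg) auto
  have cd: "(real (Suc k) / real n) *\<^sub>R u = c + d"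
    by (simp add: c_def d_def add_divide_distrib scaleR_add_left add.commute)
  have l: "layer n u a k = inf a (c + d) - inf a c"
    unfolding layer_def cd by (simp add: c_def)
  have "inf a c \<le> inf a (c + d)" using d by (intro inf_mono) auto
  then show "0 \<le> layer n u a k" unfolding l by (simp only: diff_ge_0_iff_ge)
  have "inf a (c + d) \<le> inf (a + d) (c + d)" using d by (intro inf_mono) auto
  also have "\<dots> = inf a c + d" by (rule add_inf_distrib_right[symmetric])
  finally have "layer n u a k \<le> d" unfolding l by (simp only: diff_le_eq add.commute)
  then have "real n *\<^sub>R layer n u a k \<le> real n *\<^sub>R d" by (intro scaleR_left_mono) auto
  then show "real n *\<^sub>R layer n u a k \<le> u" using n by (simp add: d_def)
  show "layer n u a k \<le> pprt (a - (real k / real n) *\<^sub>R u)"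
    unfolding l pprt_diff_eq c_def[symmetric] by (intro diff_right_mono) simp
qed

lemma symmetric_multilinear_swap:
  assumes T: "symmetric_multilinear s T" and ij: "i \<in> {1..s}" "j \<in> {1..s}" "i \<noteq> j"
  shows "T (f(i := x, j := y)) = T (f(i := y, j := x))"
proof -
  have "T (f(i := x, j := y) \<circ> Transposition.transpose i j) = T (f(i := x, j := y))"
    using ij by (intro symmetric_multilinearD(7)[OF T] permutes_swap_id) auto
  moreover have "f(i := x, j := y) \<circ> Transposition.transpose i j = f(i := y, j := x)"
    using ij by (auto simp: Transposition.transpose_def)
  ultimately show ?thesis by simp
qed

text \<open>The layers \<open>p\<^sub>k\<close> of \<open>a\<close> satisfy \<open>p\<^sub>k \<bottom> (k/n) u - m\<^sub>k\<close> with \<open>m\<^sub>k = a \<and> (k/n) u\<close>, so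
  telescoping the diagonal values at \<open>m\<^sub>k\<close> leaves the Riemann sum for \<open>a\<^sup>2\<close> and
  \<open>n\<close> error terms which are quadratic in \<open>1/n\<close>.\<close>

lemma orthosymmetric_square:
  fixes f :: "nat \<Rightarrow> 'a::archimedean_vector_lattice"
  assumes cb: "convex_bornology \<B>" and sep: "separated_bornology \<B>"
    and T: "symmetric_multilinear s T" and bdd: "bounded_on_intervals \<B> s T"
    and os: "orthosymmetric s T"
    and ij: "i \<in> {1..s}" "j \<in> {1..s}" "i \<noteq> j"
    and f: "\<And>k. k \<in> {1..s} \<Longrightarrow> 0 \<le> f k \<and> f k \<le> u"
    and a: "0 \<le> a" "a \<le> u" and q: "q \<in> principal_ideal u"
    and qw: "\<And>\<omega>. \<omega> \<in> unital_homs u \<Longrightarrow> \<omega> q = (\<omega> a)\<^sup>2"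
  shows "T (f(i := a, j := a)) = T (f(i := q, j := u))"
proof -
  define D where "D = {T f |f. \<forall>i\<in>{1..s}. 0 \<le> f i \<and> f i \<le> u}"
  have u: "0 \<le> u" using a by (rule order_trans)
  have D: "D \<in> \<B>" using bdd u by (simp add: bounded_on_intervals_def D_def)
  define b where "b x y = T (f(i := x, j := y))" for x y
  have b_upd: "b x y = T ((f(i := x))(j := y))" "b x y = T ((f(j := y))(i := x))" for x y
    using ij by (auto simp: b_def fun_upd_twist)
  have addl: "b (x + x') y = b x y + b x' y" and diffl: "b (x - x') y = b x y - b x' y"
    and scalel: "b (c *\<^sub>R x) y = c *\<^sub>R b x y" and suml: "b (sum g K) y = (\<Sum>k\<in>K. b (g k) y)"
    for x x' y c and g :: "nat \<Rightarrow> 'a" and K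
    unfolding b_upd(2)
    by (rule symmetric_multilinearD(2)[OF T ij(1)], rule symmetric_multilinearD(3)[OF T ij(1)],
        rule symmetric_multilinearD(4)[OF T ij(1)], rule symmetric_multilinearD(6)[OF T ij(1)])
  have addr: "b x (y + y') = b x y + b x y'" and diffr: "b x (y - y') = b x y - b x y'"
    and scaler: "b x (c *\<^sub>R y) = c *\<^sub>R b x y" and zero: "b x 0 = 0"
    for x y y' c
    unfolding b_upd(1)
    by (rule symmetric_multilinearD(2)[OF T ij(2)], rule symmetric_multilinearD(3)[OF T ij(2)],
        rule symmetric_multilinearD(4)[OF T ij(2)], rule symmetric_multilinearD(5)[OF T ij(2)])
  have sym: "b x y = b y x" for x y unfolding b_def by (rule symmetric_multilinear_swap[OF T ij])
  have orth: "b x y = 0" if "0 \<le> x" "0 \<le> y" "inf x y = 0" for x y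
  proof -
    define g where "g = f(i := x, j := y)"
    have "\<forall>k\<in>{1..s}. 0 \<le> g k" using f that by (simp add: g_def)
    moreover have "inf (g i) (g j) = 0" using ij that by (simp add: g_def)
    ultimately show ?thesis using os ij unfolding orthosymmetric_def b_def g_def[symmetric] by blast
  qed
  have bD: "b x y \<in> D" if "0 \<le> x" "x \<le> u" "0 \<le> y" "y \<le> u" for x y
    unfolding D_def b_def using f that by (auto intro!: exI[of _ "f(i := x, j := y)"])
  define w where "w = b q u - b a a"
  have "w = 0"
  proof (rule separated_bornology_eq_zero[OF cb sep])
    \<comment> \<open>The scaled defect will be a value in \<open>D\<close>, from the Riemann error,
      minus a point of the convex hull, from the averaged diagonal terms.\<close>
    have "(\<lambda>x. (-1) *\<^sub>R x) ` (convex hull D) \<in> \<B>"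
      using cb D unfolding convex_bornology_def by blast
    then show "{x + y |x y. x \<in> D \<and> y \<in> (\<lambda>x. (-1) *\<^sub>R x) ` (convex hull D)} \<in> \<B>"
      using cb D unfolding convex_bornology_def by blast
    fix n :: nat assume n: "0 < n"
    define m where "m k = inf a ((real k / real n) *\<^sub>R u)" for k
    define p where "p k = layer n u a k" for k
    have m0: "m 0 = 0" "m n = a" using a n by (auto simp: m_def inf_absorb1 inf_absorb2)
    have mp: "m (Suc k) = m k + p k" for k
      unfolding p_def layer_def m_def by (subst add.commute) (rule diff_add_cancel[symmetric])
    note p = layer_bounds[OF u n, of a, folded p_def]
    have pm: "b (p k) (m k) = (real k / real n) *\<^sub>R b (p k) u" for k
    proof -
      have mk: "(real k / real n) *\<^sub>R u - m k = pprt ((real k / real n) *\<^sub>R u - a)"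
        by (simp add: pprt_diff_eq m_def inf_commute)
      then have "(real k / real n) *\<^sub>R u - m k = pprt (- (a - (real k / real n) *\<^sub>R u))" by simp
      then have "b (p k) ((real k / real n) *\<^sub>R u - m k) = 0"
        by (intro orth disjoint_mono[OF inf_pprt_pprt_minus p(1) p(3)] p(1)) simp_all
      then show ?thesis by (simp add: diffr scaler)
    qed
    have "b a a = (\<Sum>k<n. b (m (Suc k)) (m (Suc k)) - b (m k) (m k))"
      using sum_lessThan_telescope[of "\<lambda>k. b (m k) (m k)" n] m0 zero by simp
    also have "\<dots> = (\<Sum>k<n. b ((2 * real k / real n) *\<^sub>R p k) u + b (p k) (p k))"
    proof (intro sum.cong refl)
      fix k
      have "b (m (Suc k)) (m (Suc k)) - b (m k) (m k) = b (p k) (m k) + b (p k) (m k) + b (p k) (p k)"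
        unfolding mp addl addr sym[of "m k" "p k"] by simp
      also have "\<dots> = b ((2 * real k / real n) *\<^sub>R p k) u + b (p k) (p k)"
        unfolding pm scalel by (simp add: scaleR_add_left[symmetric])
      finally show "b (m (Suc k)) (m (Suc k)) - b (m k) (m k) = b ((2 * real k / real n) *\<^sub>R p k) u + b (p k) (p k)" .
    qed
    also have "\<dots> = b (layer_square n u a) u + (\<Sum>k<n. b (p k) (p k))"
      by (simp add: sum.distrib suml layer_square_def p_def)
    finally have w: "w = b (q - layer_square n u a) u - (\<Sum>k<n. b (p k) (p k))"
      by (simp add: w_def diffl)
    \<comment> \<open>The Riemann sum undershoots the square by at most \<open>1 / n\<close>, so the
      error scaled by \<open>n\<close> lies between \<open>0\<close> and \<open>u\<close>.\<close>
    define x where "x = real n *\<^sub>R (q - layer_square n u a)"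
    have L: "layer_square n u a \<in> principal_ideal u" by (rule layer_in_principal_ideal[OF u a])
    have xI: "x \<in> principal_ideal u" unfolding x_def by (intro principal_ideal_closed[OF u] q L)
    have x: "0 \<le> x" "x \<le> u"
    proof -
      have "0 \<le> \<omega> x \<and> \<omega> x \<le> 1" if w: "\<omega> \<in> unital_homs u" for \<omega>
      proof -
        have "\<omega> x = real n * ((\<omega> a)\<^sup>2 - \<omega> (layer_square n u a))"
          unfolding x_def using unital_hom(4)[OF u w principal_ideal_closed(3)[OF u q L]]
            unital_hom(3)[OF u w q L] qw[OF w] by simp
        moreover have "real n * ((\<omega> a)\<^sup>2 - \<omega> (layer_square n u a)) \<le> real n * (1 / real n)"
          using layer_square_approx(2)[OF u a n w] by (intro mult_left_mono) auto
        ultimately show ?thesis using layer_square_approx(1)[OF u a n w] n by simp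
      qed
      then show "0 \<le> x" "x \<le> u" using unital_homs_intervalI[OF u xI] by blast+
    qed
    \<comment> \<open>Scaled by \<open>n\<close>, the sum of the \<open>n\<close> diagonal errors is
      the average of the values at \<open>n\<close> times the layers, so it stays in the convex hull
      of \<open>D\<close> for every \<open>n\<close>.\<close>
    define y where "y = (\<Sum>k<n. (1 / real n) *\<^sub>R b (real n *\<^sub>R p k) (real n *\<^sub>R p k))"
    have "y \<in> convex hull D"
      unfolding y_def
    proof (rule convex_sum[OF _ convex_convex_hull])
      fix k
      have "0 \<le> real n *\<^sub>R p k" using p(1) by (intro scaleR_nonneg_nonneg) auto
      then show "b (real n *\<^sub>R p k) (real n *\<^sub>R p k) \<in> convex hull D"
        using p(2) by (intro hull_inc bD)
    qed (use n in auto)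
    moreover have "y = real n *\<^sub>R (\<Sum>k<n. b (p k) (p k))"
      unfolding y_def scaleR_sum_right by (intro sum.cong refl) (use n in \<open>simp add: scalel scaler\<close>)
    then have "real n *\<^sub>R w = b x u + (-1) *\<^sub>R y"
      unfolding w x_def scalel by (simp add: scaleR_diff_right)
    moreover have "b x u \<in> D" using x u by (intro bD) auto
    ultimately show "real n *\<^sub>R w \<in> {x + y |x y. x \<in> D \<and> y \<in> (\<lambda>x. (-1) *\<^sub>R x) ` (convex hull D)}"
      by blast
  qed
  then show ?thesis by (simp add: w_def b_def)
qed

text \<open>The square is polarized: \<open>2 * a * b = 4 * m^2 - a^2 - b^2\<close> for the midpoint
  \<open>m\<close>, both for elements of the ideal, tested by unital homomorphisms, and for the
  bilinear form in the slots \<open>i\<close> and \<open>j\<close>.\<close>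

lemma orthosymmetric_product:
  fixes f :: "nat \<Rightarrow> 'a::archimedean_vector_lattice"
  assumes uc: "uniformly_complete TYPE('a)"
    and cb: "convex_bornology \<B>" and sep: "separated_bornology \<B>"
    and T: "symmetric_multilinear s T" and bdd: "bounded_on_intervals \<B> s T"
    and os: "orthosymmetric s T"
    and ij: "i \<in> {1..s}" "j \<in> {1..s}" "i \<noteq> j"
    and f: "\<And>k. k \<in> {1..s} \<Longrightarrow> 0 \<le> f k \<and> f k \<le> u"
    and a: "0 \<le> a" "a \<le> u" and b: "0 \<le> b" "b \<le> u" and c: "c \<in> principal_ideal u"
    and cw: "\<And>\<omega>. \<omega> \<in> unital_homs u \<Longrightarrow> \<omega> c = \<omega> a * \<omega> b"
  shows "T (f(i := a, j := b)) = T (f(i := c, j := u))"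
proof -
  have u: "0 \<le> u" using a by (rule order_trans)
  note cl = principal_ideal_closed[OF u]
  have sq: "\<exists>q\<in>principal_ideal u. (\<forall>\<omega>\<in>unital_homs u. \<omega> q = (\<omega> x)\<^sup>2)
      \<and> T (f(i := x, j := x)) = T (f(i := q, j := u))" if x: "0 \<le> x" "x \<le> u" for x
  proof -
    have "representable u (\<lambda>\<omega>. \<omega> x)" by (rule representableI[OF principal_ideal_interval[OF x]]) simp
    from representable_square[OF uc u this]
    obtain q where q: "q \<in> principal_ideal u" "\<And>\<omega>. \<omega> \<in> unital_homs u \<Longrightarrow> \<omega> q = (\<omega> x)\<^sup>2"
      by (rule representableE) blast
    have "T (f(i := x, j := x)) = T (f(i := q, j := u))"
      by (rule orthosymmetric_square[OF cb sep T bdd os ij _ x q(1)]) (simp_all only: f q(2))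
    with q show ?thesis by blast
  qed
  define B where "B x y = T (f(i := x, j := y))" for x y
  have B_upd: "B x y = T ((f(i := x))(j := y))" "B x y = T ((f(j := y))(i := x))" for x y
    using ij by (auto simp: B_def fun_upd_twist)
  have addl: "B (x + x') y = B x y + B x' y" and diffl: "B (x - x') y = B x y - B x' y"
    and scalel: "B (r *\<^sub>R x) y = r *\<^sub>R B x y" for x x' y r
    unfolding B_upd(2)
    by (rule symmetric_multilinearD(2)[OF T ij(1)], rule symmetric_multilinearD(3)[OF T ij(1)],
        rule symmetric_multilinearD(4)[OF T ij(1)])
  have addr: "B x (y + y') = B x y + B x y'" and scaler: "B x (r *\<^sub>R y) = r *\<^sub>R B x y" for x y y' r
    unfolding B_upd(1)
    by (rule symmetric_multilinearD(2)[OF T ij(2)], rule symmetric_multilinearD(4)[OF T ij(2)])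
  have sym: "B x y = B y x" for x y unfolding B_def by (rule symmetric_multilinear_swap[OF T ij])
  \<comment> \<open>The midpoint rather than the sum, so that \<open>m\<close> stays below
    \<open>u\<close>.\<close>
  define m where "m = (1 / 2) *\<^sub>R (a + b)"
  have m: "0 \<le> m" "m \<le> u"
  proof -
    show "0 \<le> m" unfolding m_def using a b by (intro scaleR_nonneg_nonneg add_nonneg_nonneg) auto
    have "m \<le> (1 / 2) *\<^sub>R (u + u)" unfolding m_def using a b by (intro scaleR_left_mono add_mono) auto
    then show "m \<le> u" by (simp add: scaleR_2[symmetric])
  qed
  obtain qa where qa: "qa \<in> principal_ideal u" "\<And>\<omega>. \<omega> \<in> unital_homs u \<Longrightarrow> \<omega> qa = (\<omega> a)\<^sup>2" "B a a = B qa u"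
    using sq[OF a] unfolding B_def by blast
  obtain qb where qb: "qb \<in> principal_ideal u" "\<And>\<omega>. \<omega> \<in> unital_homs u \<Longrightarrow> \<omega> qb = (\<omega> b)\<^sup>2" "B b b = B qb u"
    using sq[OF b] unfolding B_def by blast
  obtain qm where qm: "qm \<in> principal_ideal u" "\<And>\<omega>. \<omega> \<in> unital_homs u \<Longrightarrow> \<omega> qm = (\<omega> m)\<^sup>2" "B m m = B qm u"
    using sq[OF m] unfolding B_def by blast
  have aI: "a \<in> principal_ideal u" and bI: "b \<in> principal_ideal u"
    using a b by (auto intro: principal_ideal_interval)
  have "(2::real) *\<^sub>R c = (4::real) *\<^sub>R qm - (qa + qb)"
  proof (rule unital_homs_eq[OF u])
    show "(2::real) *\<^sub>R c \<in> principal_ideal u" "(4::real) *\<^sub>R qm - (qa + qb) \<in> principal_ideal u"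
      by (intro cl c qm(1) qa(1) qb(1))+
    fix \<omega> assume w: "\<omega> \<in> unital_homs u"
    note h = unital_hom[OF u w]
    have "\<omega> ((4::real) *\<^sub>R qm - (qa + qb)) = 4 * \<omega> qm - (\<omega> qa + \<omega> qb)"
      using qm(1) qa(1) qb(1) by (simp add: h(2,3,4) cl(2,4))
    moreover have "\<omega> m = (\<omega> a + \<omega> b) / 2" unfolding m_def using aI bI by (simp add: h(2,4) cl(2))
    moreover have "\<omega> ((2::real) *\<^sub>R c) = 2 * (\<omega> a * \<omega> b)" using h(4)[OF c] cw[OF w] by simp
    ultimately show "\<omega> ((2::real) *\<^sub>R c) = \<omega> ((4::real) *\<^sub>R qm - (qa + qb))"
      using qm(2)[OF w] qa(2)[OF w] qb(2)[OF w] by (simp add: power2_eq_square field_simps)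
  qed
  then have "(2::real) *\<^sub>R B c u = (4::real) *\<^sub>R B m m - (B a a + B b b)"
    by (metis addl diffl scalel qa(3) qb(3) qm(3))
  also have "(4::real) *\<^sub>R B m m = B (a + b) (a + b)" by (simp add: m_def scalel scaler)
  also have "\<dots> = B a a + (2::real) *\<^sub>R B a b + B b b"
    unfolding addl addr sym[of b a] scaleR_2 by simp
  finally have "(2::real) *\<^sub>R B c u = (2::real) *\<^sub>R B a b" by simp
  then show ?thesis by (simp add: B_def)
qed

text \<open>Slot \<open>1\<close> accumulates the product while each processed slot is filled with
  \<open>u\<close>. The accumulated factor takes values in \<open>[0, 1]\<close>, hence stays
  between \<open>0\<close> and \<open>u\<close>, and the product rule applies again.\<close>

lemma orthosymmetric_eq_product:
  fixes f :: "nat \<Rightarrow> 'a::archimedean_vector_lattice"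
  assumes uc: "uniformly_complete TYPE('a)"
    and cb: "convex_bornology \<B>" and sep: "separated_bornology \<B>"
    and T: "symmetric_multilinear s T" and bdd: "bounded_on_intervals \<B> s T"
    and os: "orthosymmetric s T" and s: "1 \<le> s"
    and f: "\<And>k. k \<in> {1..s} \<Longrightarrow> 0 \<le> f k \<and> f k \<le> u"
  obtains c where "c \<in> principal_ideal u"
    "\<And>\<omega>. \<omega> \<in> unital_homs u \<Longrightarrow> \<omega> c = (\<Prod>i=1..s. \<omega> (f i))" "T f = T ((\<lambda>_. u)(1 := c))"
proof -
  have u: "0 \<le> u" using f[of 1] s by (meson order_trans atLeastAtMost_iff order_refl)
  have "\<exists>c. 0 \<le> c \<and> c \<le> u \<and> (\<forall>\<omega>\<in>unital_homs u. \<omega> c = (\<Prod>i=1..k. \<omega> (f i)))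
      \<and> T f = T (\<lambda>i. if i = 1 then c else if i \<le> k then u else f i)" if "1 \<le> k" "k \<le> s" for k
    using that
  proof (induction k rule: dec_induct)
    case base
    show ?case
    proof (intro exI[of _ "f 1"] conjI ballI)
      show "T f = T (\<lambda>i. if i = 1 then f 1 else if i \<le> 1 then u else f i)"
        by (rule symmetric_multilinearD(1)[OF T]) auto
    qed (use f[of 1] s in auto)
  next
    case (step k)
    then obtain c where c: "0 \<le> c" "c \<le> u" "\<And>\<omega>. \<omega> \<in> unital_homs u \<Longrightarrow> \<omega> c = (\<Prod>i=1..k. \<omega> (f i))"
      "T f = T (\<lambda>i. if i = 1 then c else if i \<le> k then u else f i)" by auto
    have k: "Suc k \<in> {1..s}" using step by auto
    have fk: "0 \<le> f (Suc k)" "f (Suc k) \<le> u" using f[OF k] by auto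
    have "representable u (\<lambda>\<omega>. \<omega> c)" "representable u (\<lambda>\<omega>. \<omega> (f (Suc k)))"
      by (rule representableI[OF principal_ideal_interval[OF c(1,2)]],
          simp, rule representableI[OF principal_ideal_interval[OF fk]], simp)
    from representable_mult[OF uc u this]
    obtain c' where c': "c' \<in> principal_ideal u" "\<And>\<omega>. \<omega> \<in> unital_homs u \<Longrightarrow> \<omega> c' = \<omega> c * \<omega> (f (Suc k))"
      by (rule representableE) blast
    have "0 \<le> \<omega> c' \<and> \<omega> c' \<le> 1" if w: "\<omega> \<in> unital_homs u" for \<omega>
      unfolding c'(2)[OF w] using unital_hom_interval[OF u w c(1,2)] unital_hom_interval[OF u w fk]
      by (simp add: mult_le_one)
    then have c'01: "0 \<le> c'" "c' \<le> u" using unital_homs_intervalI[OF u c'(1)] by blast+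
    define g where "g i = (if i \<le> k then u else f i)" for i
    have "T f = T (g(1 := c, Suc k := f (Suc k)))"
      unfolding c(4) using step(1) by (intro arg_cong[of _ _ T]) (auto simp: g_def)
    also have "\<dots> = T (g(1 := c', Suc k := u))"
    proof (rule orthosymmetric_product[OF uc cb sep T bdd os _ k _ _ c(1,2) fk c'])
      show "0 \<le> g i \<and> g i \<le> u" if "i \<in> {1..s}" for i using f[OF that] u by (simp add: g_def)
    qed (use s step(1) in auto)
    also have "\<dots> = T (\<lambda>i. if i = 1 then c' else if i \<le> Suc k then u else f i)"
      using step(1) by (intro arg_cong[of _ _ T]) (auto simp: g_def le_Suc_eq)
    finally have "T f = T (\<lambda>i. if i = 1 then c' else if i \<le> Suc k then u else f i)" .
    moreover have "\<omega> c' = (\<Prod>i=1..Suc k. \<omega> (f i))" if "\<omega> \<in> unital_homs u" for \<omega>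
      using c'(2)[OF that] c(3)[OF that] by simp
    ultimately show ?case using c'01 by blast
  qed
  from this[OF s order_refl] obtain c where c: "0 \<le> c" "c \<le> u"
    "\<And>\<omega>. \<omega> \<in> unital_homs u \<Longrightarrow> \<omega> c = (\<Prod>i=1..s. \<omega> (f i))"
    "T f = T (\<lambda>i. if i = 1 then c else if i \<le> s then u else f i)" by blast
  have "T f = T ((\<lambda>_. u)(1 := c))"
    unfolding c(4) by (rule symmetric_multilinearD(1)[OF T]) auto
  with c show ?thesis by (intro that[of c]) (auto intro: principal_ideal_interval)
qed

text \<open>With \<open>H\<close> the sum of reciprocals, the mean divided by \<open>s\<close> is
  \<open>1 / H\<close> and the \<open>j\<close>-th partial product is the full product divided by
  \<open>x j\<close>, so summation cancels \<open>H\<close>. If a coordinate is zero, the mean and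
  the full product both vanish.\<close>

lemma sum_real_harmonic_mean_prod:
  assumes s: "1 \<le> s" and x: "\<And>i. i \<in> {1..s} \<Longrightarrow> 0 \<le> x i"
  shows "(\<Sum>j=1..s. real_harmonic_mean s x / real s * (\<Prod>i\<in>{1..s} - {j}. x i)) = (\<Prod>i=1..s. x i)"
proof (cases "\<forall>i\<in>{1..s}. x i \<noteq> 0")
  case True
  then have pos: "0 < x i" if "i \<in> {1..s}" for i using x that by force
  define H where "H = (\<Sum>j=1..s. 1 / \<bar>x j\<bar>)"
  have H: "0 < H" unfolding H_def using s pos by (intro sum_pos) fastforce+
  have "real_harmonic_mean s x / real s * (\<Prod>i\<in>{1..s} - {j}. x i) = (\<Prod>i=1..s. x i) / H * (1 / \<bar>x j\<bar>)"
    if j: "j \<in> {1..s}" for j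
  proof -
    have "(\<Prod>i=1..s. x i) = x j * (\<Prod>i\<in>{1..s} - {j}. x i)" using j by (intro prod.remove) auto
    moreover have "real_harmonic_mean s x = real s / H"
      unfolding H_def using True by (intro real_harmonic_mean_eq_divide) auto
    ultimately show ?thesis using pos[OF j] H s by (simp add: field_simps)
  qed
  then have "(\<Sum>j=1..s. real_harmonic_mean s x / real s * (\<Prod>i\<in>{1..s} - {j}. x i))
      = (\<Sum>j=1..s. (\<Prod>i=1..s. x i) / H * (1 / \<bar>x j\<bar>))" by (intro sum.cong) auto
  also have "\<dots> = (\<Prod>i=1..s. x i) / H * H" unfolding sum_distrib_left[symmetric] H_def ..
  finally show ?thesis using H by simp
next
  case False
  then obtain i where i: "i \<in> {1..s}" "x i = 0" by blast
  then have "(\<Prod>i=1..s. x i) = 0" by (intro prod_zero) auto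
  then show ?thesis using real_harmonic_mean_zero[of i s x] i by simp
qed

lemma orthosymmetric_harmonic_mean:
  fixes f :: "nat \<Rightarrow> 'a::archimedean_vector_lattice"
  assumes uc: "uniformly_complete TYPE('a)"
    and cb: "convex_bornology \<B>" and sep: "separated_bornology \<B>"
    and T: "symmetric_multilinear s T" and bdd: "bounded_on_intervals \<B> s T"
    and os: "orthosymmetric s T" and s: "1 \<le> s"
    and f: "\<And>i. i \<in> {1..s} \<Longrightarrow> 0 \<le> f i"
  shows "T f = (1 / real s) *\<^sub>R (\<Sum>j=1..s. T (f(j := harmonic_mean s f)))"
proof -
  define u where "u = (\<Sum>i=1..s. f i)"
  have u: "0 \<le> u" unfolding u_def by (intro sum_nonneg f)
  have fu: "f i \<le> u" if "i \<in> {1..s}" for i unfolding u_def using that f by (intro nonneg_le_sum) auto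
  have hm: "harmonic_mean s f \<in> principal_ideal u"
    "\<And>\<omega>. \<omega> \<in> unital_homs u \<Longrightarrow> \<omega> (harmonic_mean s f) = real_harmonic_mean s (\<lambda>i. \<omega> (f i))"
    using harmonic_mean_hom[OF uc s _ u_def] f by blast+
  \<comment> \<open>Dividing by \<open>s\<close> brings the mean into the interval from
    \<open>0\<close> to \<open>u\<close>, where the product rule applies, and absorbs the factor
    \<open>1 / s\<close> of the claim.\<close>
  define h where "h = (1 / real s) *\<^sub>R harmonic_mean s f"
  have hI: "h \<in> principal_ideal u" unfolding h_def by (intro principal_ideal_closed(4)[OF u] hm(1))
  have hw: "\<omega> h = real_harmonic_mean s (\<lambda>i. \<omega> (f i)) / real s" if w: "\<omega> \<in> unital_homs u" for \<omega>
    unfolding h_def using unital_hom(4)[OF u w hm(1)] hm(2)[OF w] by simp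
  have fw: "0 \<le> \<omega> (f i)" "\<omega> (f i) \<le> 1" if "\<omega> \<in> unital_homs u" "i \<in> {1..s}" for \<omega> i
    using unital_hom_interval[OF u that(1) f fu] that(2) by auto
  have "0 \<le> \<omega> h \<and> \<omega> h \<le> 1" if w: "\<omega> \<in> unital_homs u" for \<omega>
  proof -
    have "real_harmonic_mean s (\<lambda>i. \<omega> (f i)) \<le> real s * \<omega> (f 1)" "0 \<le> real_harmonic_mean s (\<lambda>i. \<omega> (f i))"
      using fw[OF w] s by (auto intro!: real_harmonic_mean_bounds)
    moreover have "real s * \<omega> (f 1) \<le> real s * 1" using fw(2)[OF w, of 1] s by (intro mult_left_mono) auto
    ultimately have "0 \<le> real_harmonic_mean s (\<lambda>i. \<omega> (f i))" "real_harmonic_mean s (\<lambda>i. \<omega> (f i)) \<le> real s"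
      by linarith+
    then show ?thesis unfolding hw[OF w] using s by (simp add: divide_le_eq)
  qed
  then have h: "0 \<le> h" "h \<le> u" using unital_homs_intervalI[OF u hI] by blast+
  have "\<exists>c\<in>principal_ideal u. (\<forall>\<omega>\<in>unital_homs u. \<omega> c = (\<Prod>i=1..s. \<omega> (g i))) \<and> T g = T ((\<lambda>_. u)(1 := c))"
    if "\<And>k. k \<in> {1..s} \<Longrightarrow> 0 \<le> g k \<and> g k \<le> u" for g
    using orthosymmetric_eq_product[OF uc cb sep T bdd os s, of g u] that by metis
  note prod = this
  obtain c where c: "c \<in> principal_ideal u" "\<And>\<omega>. \<omega> \<in> unital_homs u \<Longrightarrow> \<omega> c = (\<Prod>i=1..s. \<omega> (f i))"
    "T f = T ((\<lambda>_. u)(1 := c))"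
  proof -
    have "0 \<le> f k \<and> f k \<le> u" if "k \<in> {1..s}" for k by (intro conjI f fu that)
    then have "\<exists>c\<in>principal_ideal u. (\<forall>\<omega>\<in>unital_homs u. \<omega> c = (\<Prod>i=1..s. \<omega> (f i))) \<and> T f = T ((\<lambda>_. u)(1 := c))"
      by (rule prod)
    then show ?thesis using that by blast
  qed
  have "\<forall>j. \<exists>d. d \<in> principal_ideal u \<and> (\<forall>\<omega>\<in>unital_homs u. \<omega> d = (\<Prod>i=1..s. \<omega> ((f(j := h)) i)))
      \<and> T (f(j := h)) = T ((\<lambda>_. u)(1 := d))"
  proof
    fix j
    have "0 \<le> (f(j := h)) k \<and> (f(j := h)) k \<le> u" if "k \<in> {1..s}" for k using f[OF that] fu[OF that] h by simp
    then have "\<exists>d\<in>principal_ideal u. (\<forall>\<omega>\<in>unital_homs u. \<omega> d = (\<Prod>i=1..s. \<omega> ((f(j := h)) i)))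
      \<and> T (f(j := h)) = T ((\<lambda>_. u)(1 := d))" by (rule prod)
    then show "\<exists>d. d \<in> principal_ideal u \<and> (\<forall>\<omega>\<in>unital_homs u. \<omega> d = (\<Prod>i=1..s. \<omega> ((f(j := h)) i)))
      \<and> T (f(j := h)) = T ((\<lambda>_. u)(1 := d))" by blast
  qed
  then obtain d where d: "\<And>j. d j \<in> principal_ideal u"
    "\<And>j \<omega>. \<omega> \<in> unital_homs u \<Longrightarrow> \<omega> (d j) = (\<Prod>i=1..s. \<omega> ((f(j := h)) i))"
    "\<And>j. T (f(j := h)) = T ((\<lambda>_. u)(1 := d j))" by metis
  have one: "1 \<in> {1..s}" using s by simp
  \<comment> \<open>The identity between numbers lifts to elements by separation of points;
    linearity in slot \<open>1\<close> then carries it to the values of \<open>T\<close>.\<close>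
  have "(\<Sum>j=1..s. d j) = c"
  proof (rule unital_homs_eq[OF u _ c(1)])
    show "(\<Sum>j=1..s. d j) \<in> principal_ideal u" by (intro principal_ideal_closed[OF u] d)
    fix \<omega> assume w: "\<omega> \<in> unital_homs u"
    have "\<omega> (d j) = real_harmonic_mean s (\<lambda>i. \<omega> (f i)) / real s * (\<Prod>i\<in>{1..s} - {j}. \<omega> (f i))"
      if j: "j \<in> {1..s}" for j
    proof -
      have "\<omega> (d j) = \<omega> ((f(j := h)) j) * (\<Prod>i\<in>{1..s} - {j}. \<omega> ((f(j := h)) i))"
        unfolding d(2)[OF w] using j by (intro prod.remove) auto
      also have "(\<Prod>i\<in>{1..s} - {j}. \<omega> ((f(j := h)) i)) = (\<Prod>i\<in>{1..s} - {j}. \<omega> (f i))"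
        by (intro prod.cong) auto
      finally show ?thesis by (simp add: hw[OF w])
    qed
    then have "\<omega> (\<Sum>j=1..s. d j)
        = (\<Sum>j=1..s. real_harmonic_mean s (\<lambda>i. \<omega> (f i)) / real s * (\<Prod>i\<in>{1..s} - {j}. \<omega> (f i)))"
      unfolding unital_hom_sum[OF u w d(1)] by (intro sum.cong) auto
    also have "\<dots> = (\<Prod>i=1..s. \<omega> (f i))" using fw[OF w] by (intro sum_real_harmonic_mean_prod s)
    finally show "\<omega> (\<Sum>j=1..s. d j) = \<omega> c" using c(2)[OF w] by simp
  qed
  then have "T f = (\<Sum>j=1..s. T ((\<lambda>_. u)(1 := d j)))"
    using c(3) symmetric_multilinearD(6)[OF T one] by metis
  also have "\<dots> = (\<Sum>j=1..s. (1 / real s) *\<^sub>R T (f(j := harmonic_mean s f)))"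
  proof (intro sum.cong refl)
    fix j assume "j \<in> {1..s}"
    then show "T ((\<lambda>_. u)(1 := d j)) = (1 / real s) *\<^sub>R T (f(j := harmonic_mean s f))"
      unfolding d(3)[symmetric] h_def by (rule symmetric_multilinearD(4)[OF T])
  qed
  finally show ?thesis by (simp add: scaleR_sum_right)
qed

section \<open>Orthogonal additivity from orthosymmetry\<close>

text \<open>Induction on a set \<open>J\<close> of slots whose entries may have any sign. Such an
  entry is the difference of its positive and negative parts, both dominated by its absolute value,
  so disjointness survives the replacement.\<close>

lemma orthosymmetric_vanishes:
  fixes f :: "nat \<Rightarrow> 'a::archimedean_vector_lattice"
  assumes T: "symmetric_multilinear s T" and os: "orthosymmetric s T"
    and ij: "i \<in> {1..s}" "j \<in> {1..s}" "i \<noteq> j" and disj: "inf \<bar>f i\<bar> \<bar>f j\<bar> = 0"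
  shows "T f = 0"
proof -
  have "T f = 0" if "J \<subseteq> {1..s}" "\<And>k. k \<in> {1..s} - J \<Longrightarrow> 0 \<le> f k" "inf \<bar>f i\<bar> \<bar>f j\<bar> = 0" for J f
  proof -
    have "finite J" using that(1) finite_subset by blast
    then show ?thesis using that
    proof (induction J arbitrary: f)
      case empty
      then show ?case using os ij unfolding orthosymmetric_def by (metis Diff_empty abs_of_nonneg)
    next
      case (insert l J)
      have l: "l \<in> {1..s}" using insert.prems by simp
      have part: "T (f(l := x)) = 0" if x: "0 \<le> x" "x \<le> \<bar>f l\<bar>" for x
      proof (rule insert.IH)
        show "0 \<le> (f(l := x)) k" if "k \<in> {1..s} - J" for k using insert.prems(2) that x by auto
        have le: "\<bar>(f(l := x)) k\<bar> \<le> \<bar>f k\<bar>" for k using x by simp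
        show "inf \<bar>(f(l := x)) i\<bar> \<bar>(f(l := x)) j\<bar> = 0"
          by (rule disjoint_mono[OF insert.prems(3) abs_ge_zero le abs_ge_zero le])
      qed (use insert.prems in auto)
      have "f l = pprt (f l) - pprt (- f l)" using prts[of "f l"] by (simp add: pprt_neg)
      then have "T f = T (f(l := pprt (f l) - pprt (- f l)))" by (simp only: fun_upd_triv)
      also have "\<dots> = T (f(l := pprt (f l))) - T (f(l := pprt (- f l)))"
        by (rule symmetric_multilinearD(3)[OF T l])
      also have "\<dots> = 0"
        by (subst (1 2) part) (simp_all add: pprt_def abs_ge_self abs_ge_minus_self)
      finally show ?case .
    qed
  qed
  from this[of "{1..s}" f] disj show ?thesis by simp
qed

text \<open>In place of a binomial expansion: once slot \<open>1\<close> holds \<open>x\<close>,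
  each further \<open>x + y\<close> may be replaced by \<open>x\<close>, because the term with
  \<open>y\<close> there contains a disjoint pair. Expanding slot \<open>1\<close> alone then gives
  both summands.\<close>

lemma orthosymmetric_imp_orthogonally_additive:
  fixes P :: "'a::archimedean_vector_lattice \<Rightarrow> 'b::real_vector"
  assumes s: "1 \<le> s" and P: "homogeneous_polynomial_with s P T" and os: "orthosymmetric s T"
  shows "orthogonally_additive P"
  unfolding orthogonally_additive_def
proof (intro allI impI)
  have T: "symmetric_multilinear s T" and PT: "\<And>f. P f = T (\<lambda>_. f)"
    using P by (auto simp: homogeneous_polynomial_with_def)
  have one: "1 \<in> {1..s}" using s by simp
  have diag: "T ((\<lambda>_. x + y)(1 := x)) = P x" if disj: "inf \<bar>x\<bar> \<bar>y\<bar> = 0" for x y :: 'a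
  proof -
    have "T (\<lambda>i. if i \<le> k then x else x + y) = T ((\<lambda>_. x + y)(1 := x))" if "1 \<le> k" "k \<le> s" for k
      using that
    proof (induction k rule: dec_induct)
      case base
      show ?case by (rule symmetric_multilinearD(1)[OF T]) auto
    next
      case (step k)
      define g where "g i = (if i \<le> k then x else x + y)" for i
      have k: "Suc k \<in> {1..s}" using step by simp
      have "T g = T (g(Suc k := x + y))" by (rule arg_cong[of _ _ T]) (auto simp: g_def)
      also have "\<dots> = T (g(Suc k := x)) + T (g(Suc k := y))" by (rule symmetric_multilinearD(2)[OF T k])
      also have "T (g(Suc k := y)) = 0"
        by (rule orthosymmetric_vanishes[OF T os one k]) (use step(1) disj in \<open>auto simp: g_def\<close>)
      also have "T (g(Suc k := x)) = T (\<lambda>i. if i \<le> Suc k then x else x + y)"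
        by (rule arg_cong[of _ _ T]) (auto simp: g_def le_Suc_eq)
      finally show ?case using step by (simp add: g_def[abs_def])
    qed
    from this[OF s order_refl] have "T ((\<lambda>_. x + y)(1 := x)) = T (\<lambda>i. if i \<le> s then x else x + y)" by simp
    also have "\<dots> = T (\<lambda>_. x)" by (rule symmetric_multilinearD(1)[OF T]) simp
    finally show ?thesis by (simp add: PT)
  qed
  fix f g :: 'a assume disj: "inf \<bar>f\<bar> \<bar>g\<bar> = 0"
  have "P (f + g) = T ((\<lambda>_. f + g)(1 := f + g))"
    unfolding PT by (rule symmetric_multilinearD(1)[OF T]) simp
  also have "\<dots> = T ((\<lambda>_. f + g)(1 := f)) + T ((\<lambda>_. f + g)(1 := g))"
    by (rule symmetric_multilinearD(2)[OF T one])
  also have "T ((\<lambda>_. f + g)(1 := f)) = P f" by (rule diag[OF disj])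
  also have "T ((\<lambda>_. f + g)(1 := g)) = P g"
    using diag[of g f] disj by (simp add: inf_commute add.commute)
  finally show "P (f + g) = P f + P g" .
qed

theorem theorem2p4:
  fixes s :: nat
    and \<B> :: "'b::real_vector set set"
    and P :: "'a::archimedean_vector_lattice \<Rightarrow> 'b"
    and T :: "(nat \<Rightarrow> 'a) \<Rightarrow> 'b"
  assumes "s \<ge> 2"
    and "uniformly_complete TYPE('a)"
    and "convex_bornology \<B>"
    and "separated_bornology \<B>"
    and "homogeneous_polynomial_with s P T"
    and "bounded_map \<B> P"
  shows "orthogonally_additive P \<longleftrightarrow>
    (\<forall>f. (\<forall>i\<in>{1..s}. 0 \<le> f i) \<longrightarrow>
      (let h = harmonic_mean s f in
        T f = (1 / real s) *\<^sub>R (\<Sum>j=1..s. T (f(j := h)))))"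
proof -
  have s: "1 \<le> s" using assms(1) by simp
  have T: "symmetric_multilinear s T" using assms(5) by (simp add: homogeneous_polynomial_with_def)
  have bdd: "bounded_on_intervals \<B> s T"
    by (rule bounded_on_intervals_polynomial[OF assms(3,5,6)])
  show ?thesis
  proof
    assume "orthogonally_additive P"
    then have os: "orthosymmetric s T"
      by (intro orthogonally_additive_imp_orthosymmetric[OF assms(3,4,5) _ bdd])
    show "\<forall>f. (\<forall>i\<in>{1..s}. 0 \<le> f i) \<longrightarrow>
      (let h = harmonic_mean s f in T f = (1 / real s) *\<^sub>R (\<Sum>j=1..s. T (f(j := h))))"
      unfolding Let_def
      by (intro allI impI orthosymmetric_harmonic_mean[OF assms(2-4) T bdd os s]) blast
  next
    assume identity: "\<forall>f. (\<forall>i\<in>{1..s}. 0 \<le> f i) \<longrightarrow>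
      (let h = harmonic_mean s f in T f = (1 / real s) *\<^sub>R (\<Sum>j=1..s. T (f(j := h))))"
    have "orthosymmetric s T"
      unfolding orthosymmetric_def
    proof (intro allI ballI impI)
      fix f :: "nat \<Rightarrow> 'a" and i j
      assume *: "i \<in> {1..s}" "j \<in> {1..s}" "\<forall>k\<in>{1..s}. 0 \<le> f k" "i \<noteq> j" "inf (f i) (f j) = 0"
      have "harmonic_mean s f = 0"
        by (rule harmonic_mean_disjoint[OF assms(2) _ *(1,2,5)]) (use *(3) in blast)
      then have "T f = (1 / real s) *\<^sub>R (\<Sum>k=1..s. T (f(k := 0)))"
        using identity *(3) by (simp add: Let_def)
      also have "(\<Sum>k=1..s. T (f(k := 0))) = 0"
        by (intro sum.neutral ballI symmetric_multilinearD(5)[OF T])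
      finally show "T f = 0" by simp
    qed
    then show "orthogonally_additive P"
      by (rule orthosymmetric_imp_orthogonally_additive[OF s assms(5)])
  qed
qed

end
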